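(* Let $\alpha\in(0,2]$ and let $S$ be the $\alpha$-stable Lévy process. For every function $\psi:\mathbb R\to\mathbb R$ of bounded variation with compact support, the limit $$\Lambda_\psi(f)=\lim_{T\to\infty}T^{-1}\log\mathbb E\exp\int_0^Tf(\mathcal S_\psi^1(t))\,dt$$ exists for every $f\in\mathcal C_b(\mathbb R)$, and the family of random probability measures $(\mu_{\mathcal S_\psi^\varepsilon})_{\varepsilon>0}$ satisfies, as $\varepsilon\to0$, the large deviation principle in $\mathcal M^1(\mathbb R)$ equipped with the $\tau$-topology, in the scale $\varepsilon^{-1}$, with good rate function $$\Lambda_\psi^*(\mu)=\sup_{f\in\mathcal C_b(\mathbb R)}\left\{\int f\,d\mu-\Lambda_\psi(f)\right\}.$$
   Context: The $\alpha$-stable Lévy process $S=(S(t),t\in\mathbb R)$ (two-sided, $S(0)=0$) has independent and stationary increments, càdlàg paths, $S(1)$ with an $\alpha$-stable law, and is $1/\alpha$-self-similar: $\{S(at),t\in\mathbb R\}\overset{(d)}{=}\{a^{1/\alpha}S(t),t\in\mathbb R\}$ for all $a>0$. For $\psi$ of bounded variation with compact support and $\varepsilon>0$, $$\mathcal S_\psi^\varepsilon(t)=\varepsilon^{1-1/\alpha}\int S(s)\,d\psi^\varepsilon(t-s)=\varepsilon^{-1/\alpha}\int S(t-\varepsilon u)\,d\psi(u),\qquad \psi^\varepsilon(t)=\varepsilon^{-1}\psi(t/\varepsilon).$$ The occupation measure is $\mu_Z=\int_0^1\delta_{Z(t)}\,dt$. $\mathcal M^1(\mathbb R)$ is the set of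 Borel probability measures on $\mathbb R$ (with the $\sigma$-field generated by the maps $\mu\mapsto\mu(A)$, $A$ Borel); the $\tau$-topology on it is the topology induced by integration against bounded measurable functions. $\mathcal C_b(\mathbb R)$ is the set of bounded continuous functions. The LDP in the scale $\varepsilon^{-1}$ with good rate function $I$ means: $I$ has compact level sets and for every measurable set $\Gamma$, $-\inf_{\mathrm{int}\,\Gamma}I\le\liminf_{\varepsilon\to0}\varepsilon\log\mathbb P(\mu_{\mathcal S_\psi^\varepsilon}\in\Gamma)\le\limsup_{\varepsilon\to0}\varepsilon\log\mathbb P(\mu_{\mathcal S_\psi^\varepsilon}\in\Gamma)\le-\inf_{\mathrm{clo}\,\Gamma}I$. *)

theory Defs
  imports "HOL-Probability.Probability"
begin

section \<open>Stable Levy processes\<close>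

(* The index is determined by the law only if point masses are excluded. The shift d is
   allowed here; strict stability of S 1 is a consequence of self-similarity. *)
definition stable_law :: "real \<Rightarrow> real measure \<Rightarrow> bool" where
  "stable_law \<alpha> \<mu> \<longleftrightarrow> real_distribution \<mu> \<and> (\<forall>c. \<mu> \<noteq> return borel c) \<and>
     (\<forall>a>0. \<forall>b>0. \<exists>d. distr (\<mu> \<Otimes>\<^sub>M \<mu>) borel (\<lambda>(x, y). a * x + b * y) =
        distr \<mu> borel (\<lambda>x. (a powr \<alpha> + b powr \<alpha>) powr (1 / \<alpha>) * x + d))"

definition cadlag :: "(real \<Rightarrow> real) \<Rightarrow> bool" where
  "cadlag g \<longleftrightarrow> (\<forall>t. continuous (at_right t) g \<and> (\<exists>l. (g \<longlongrightarrow> l) (at_left t)))"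

(* Self-similarity is equality in law of the two processes as random elements of the space of
   all functions on the line with its product sigma-algebra. *)
locale stable_levy_process = prob_space M
  for M :: "'a measure" +
  fixes \<alpha> :: real and S :: "real \<Rightarrow> 'a \<Rightarrow> real"
  assumes random_variable_S: "S t \<in> borel_measurable M"
    and start_zero: "\<omega> \<in> space M \<Longrightarrow> S 0 \<omega> = 0"
    and independent_increments:
      "mono (u :: nat \<Rightarrow> real) \<Longrightarrow>
         indep_vars (\<lambda>_. borel) (\<lambda>i \<omega>. S (u (Suc i)) \<omega> - S (u i) \<omega>) {..<n}"
    and stationary_increments:
      "s \<le> t \<Longrightarrow> distr M borel (\<lambda>\<omega>. S (t + h) \<omega> - S (s + h) \<omega>) =
         distr M borel (\<lambda>\<omega>. S t \<omega> - S s \<omega>)"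
    and cadlag_paths: "\<omega> \<in> space M \<Longrightarrow> cadlag (\<lambda>t. S t \<omega>)"
    and stable_S1: "stable_law \<alpha> (distr M borel (S 1))"
    and self_similar:
      "a > 0 \<Longrightarrow> distr M (\<Pi>\<^sub>M t\<in>UNIV. borel) (\<lambda>\<omega> t. S (a * t) \<omega>) =
         distr M (\<Pi>\<^sub>M t\<in>UNIV. borel) (\<lambda>\<omega> t. a powr (1 / \<alpha>) * S t \<omega>)"

section \<open>Bounded variation and the Lebesgue-Stieltjes integral\<close>

definition variation_sums :: "(real \<Rightarrow> real) \<Rightarrow> real set \<Rightarrow> real set" where
  "variation_sums g A =
     {(\<Sum>i<n. \<bar>g (x (Suc i)) - g (x i)\<bar>) | n x. mono_on {..n} x \<and> x ` {..n} \<subseteq> A}"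

definition bounded_variation :: "(real \<Rightarrow> real) \<Rightarrow> bool" where
  "bounded_variation g \<longleftrightarrow> bdd_above (variation_sums g UNIV)"

definition total_variation :: "(real \<Rightarrow> real) \<Rightarrow> real set \<Rightarrow> real" where
  "total_variation g A = Sup (variation_sums g A)"

definition right_limit :: "(real \<Rightarrow> real) \<Rightarrow> real \<Rightarrow> real" where
  "right_limit g t = Lim (at_right t) g"

(* For g of bounded variation, dg is the finite signed measure with
   dg (a, b] = g (b+) - g (a+). It is integrated through its Jordan decomposition, obtained from
   the positive and negative variation functions of the right-continuous modification g+.
   Both are nondecreasing and right-continuous, as interval_measure requires. *)
definition pos_variation :: "(real \<Rightarrow> real) \<Rightarrow> real \<Rightarrow> real" where
  "pos_variation g t = (total_variation (right_limit g) {..t} + right_limit g t) / 2"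

definition neg_variation :: "(real \<Rightarrow> real) \<Rightarrow> real \<Rightarrow> real" where
  "neg_variation g t = (total_variation (right_limit g) {..t} - right_limit g t) / 2"

definition stieltjes_integral :: "(real \<Rightarrow> real) \<Rightarrow> (real \<Rightarrow> real) \<Rightarrow> real" where
  "stieltjes_integral h g =
     (\<integral>u. h u \<partial>interval_measure (pos_variation g)) -
     (\<integral>u. h u \<partial>interval_measure (neg_variation g))"

section \<open>Moving averages and occupation measures\<close>

definition moving_average ::
  "real \<Rightarrow> (real \<Rightarrow> 'a \<Rightarrow> real) \<Rightarrow> (real \<Rightarrow> real) \<Rightarrow> real \<Rightarrow> real \<Rightarrow> 'a \<Rightarrow> real" where
  "moving_average \<alpha> S \<psi> \<epsilon> t \<omega> =
     \<epsilon> powr (- 1 / \<alpha>) * stieltjes_integral (\<lambda>u. S (t - \<epsilon> * u) \<omega>) \<psi>"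

definition occupation_measure :: "(real \<Rightarrow> real) \<Rightarrow> real measure" where
  "occupation_measure Z = distr (restrict_space lborel {0..1}) borel Z"

definition tau_topology :: "real measure topology" where
  "tau_topology = topology_generated_by
     {{\<mu> \<in> space (prob_algebra borel). (\<integral>x. f x \<partial>\<mu>) \<in> U} | f U.
        f \<in> borel_measurable borel \<and> bounded (range f) \<and> open (U :: real set)}"

section \<open>Large deviations\<close>

definition log_prob :: "real \<Rightarrow> ereal" where
  "log_prob p = (if p = 0 then - \<infinity> else ereal (ln p))"

(* N carries the sigma-field of the state space; the topology X need not generate it. *)
definition large_deviation_principle ::
  "'a measure \<Rightarrow> 'b measure \<Rightarrow> 'b topology \<Rightarrow> (real \<Rightarrow> 'a \<Rightarrow> 'b) \<Rightarrow> ('b \<Rightarrow> ereal) \<Rightarrow> bool" where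
  "large_deviation_principle M N X Y I \<longleftrightarrow>
     (\<forall>\<epsilon>>0. Y \<epsilon> \<in> measurable M N) \<and>
     (\<forall>c::real. compactin X {x \<in> topspace X. I x \<le> ereal c}) \<and>
     (\<forall>\<Gamma>\<in>sets N.
        let L = (\<lambda>\<epsilon>. ereal \<epsilon> * log_prob (measure M {\<omega> \<in> space M. Y \<epsilon> \<omega> \<in> \<Gamma>}))
        in - (INF x \<in> X interior_of \<Gamma>. I x) \<le> Liminf (at_right 0) L \<and>
           Liminf (at_right 0) L \<le> Limsup (at_right 0) L \<and>
           Limsup (at_right 0) L \<le> - (INF x \<in> X closure_of \<Gamma>. I x))"

definition scaled_log_mgf ::
  "'a measure \<Rightarrow> (real \<Rightarrow> 'a \<Rightarrow> real) \<Rightarrow> (real \<Rightarrow> real) \<Rightarrow> real \<Rightarrow> real" where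
  "scaled_log_mgf M Z f T =
     ln (\<integral>\<omega>. exp (LINT t:{0..T}|lborel. f (Z t \<omega>)) \<partial>M) / T"

definition Lambda ::
  "'a measure \<Rightarrow> (real \<Rightarrow> 'a \<Rightarrow> real) \<Rightarrow> (real \<Rightarrow> real) \<Rightarrow> real" where
  "Lambda M Z f = Lim at_top (scaled_log_mgf M Z f)"

definition Lambda_star ::
  "'a measure \<Rightarrow> (real \<Rightarrow> 'a \<Rightarrow> real) \<Rightarrow> real measure \<Rightarrow> ereal" where
  "Lambda_star M Z \<mu> = (SUP f \<in> bcontfun. ereal ((\<integral>x. f x \<partial>\<mu>) - Lambda M Z f))"

end

theory Submission
  imports Defs
begin

text \<open>The process \<open>Z t = moving_average \<alpha> S \<psi> 1 t\<close> depends only on the increments of \<open>S\<close> near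
  \<open>t\<close>, because \<open>d\<psi>\<close> has compact support and total mass zero. Hence it is stationary and finitely
  dependent, and by self-similarity the occupation measure at scale \<open>\<epsilon>\<close> has the law of that of
  \<open>Z\<close> over a time span \<open>1 / \<epsilon>\<close>. Cutting time into independent blocks separated by gaps shows that
  \<open>log_mgf f T\<close> is additive in \<open>T\<close> up to a constant proportional to the bound of \<open>f\<close>. This gives the
  limit \<open>\<Lambda>\<close>, and its continuity under bounded convergence in mean, so that continuous and bounded
  measurable test functions define the same conjugate.

  The law of the occupation measure need not be exponentially tight in the \<open>\<tau>\<close>-topology. The upper
  bound is therefore proved in the compact space of all families of values on bounded measurable
  functions: the continuity of \<open>\<Lambda>\<close> at indicators of sets decreasing to the empty set forces points of
  finite rate to be countably additive. For the lower bound only finitely many functions matter, and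
  the averages over independent blocks are treated by an exponential change of measure whose
  parameter nearly maximises a quadratically penalised Legendre transform.\<close>

section \<open>Functions of bounded variation\<close>

text \<open>Two obstacles shape the argument. The logarithmic moment generating function over a
  finite length is compared with its limit up to an error proportional to the bound of the test
  function. For a combination of functions with coefficients \<theta> this error grows linearly in
  \<theta>, and it carries a factor one over the block length. A quadratic penalty dominates every
  linear error, and the error itself disappears when the block length is chosen after the penalty.
  The axioms on increments speak of finitely many times, while the moving average integrates a whole
  path. Paths are therefore read at rational times only: this makes all functionals measurable on a
  countable product, and finitely many rationals lie on one grid, where path segments are functions
  of independent, identically distributed increments. On \<open>[h, h + T]\<close> the moving
  average sees \<open>S\<close> on \<open>[h - R, h + T + R]\<close>; approximating times from above
  adds one unit. Hence the gap \<open>2 * R + 1\<close> between independent blocks.\<close>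

lemma telescoping_variation_le:
  fixes g W :: "real \<Rightarrow> real"
  assumes x: "mono_on {..n} x" and le: "\<And>a b. a \<le> b \<Longrightarrow> b \<le> c \<Longrightarrow> \<bar>g b - g a\<bar> \<le> W b - W a" and c: "x ` {..n} \<subseteq> {..c}"
  shows "(\<Sum>i<n. \<bar>g (x (Suc i)) - g (x i)\<bar>) \<le> W (x n) - W (x 0)"
proof -
  have "(\<Sum>i<n. \<bar>g (x (Suc i)) - g (x i)\<bar>) \<le> (\<Sum>i<n. W (x (Suc i)) - W (x i))"
    using c by (intro sum_mono le mono_onD[OF x]) (auto simp: image_subset_iff)
  also have "\<dots> = W (x n) - W (x 0)" by (rule sum_lessThan_telescope)
  finally show ?thesis .
qed

lemma zero_in_variation_sums: "0 \<in> variation_sums g {..t :: real}"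
  unfolding variation_sums_def
  by (rule CollectI, rule exI[of _ 0], rule exI[of _ "\<lambda>_. t"]) (simp add: mono_on_def)

lemma variation_sums_mono: "A \<subseteq> B \<Longrightarrow> variation_sums g A \<subseteq> variation_sums g B"
  unfolding variation_sums_def by blast

lemma partition_snoc:
  fixes x :: "nat \<Rightarrow> real"
  assumes "mono_on {..n} x" "x ` {..n} \<subseteq> {..a}" "a \<le> b"
  shows "mono_on {..Suc n} (x(Suc n := b))" "x(Suc n := b) ` {..Suc n} \<subseteq> {..b}"
    "(\<Sum>i<Suc n. \<bar>g ((x(Suc n := b)) (Suc i)) - g ((x(Suc n := b)) i)\<bar>) =
      (\<Sum>i<n. \<bar>g (x (Suc i)) - g (x i)\<bar>) + \<bar>g b - g (x n)\<bar>"
proof -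
  have xb: "x i \<le> b" if "i \<le> n" for i using assms that by force
  show "mono_on {..Suc n} (x(Suc n := b))"
    using assms(1) xb by (auto simp: mono_on_def le_Suc_eq)
  show "x(Suc n := b) ` {..Suc n} \<subseteq> {..b}" using xb by (auto simp: le_Suc_eq)
  show "(\<Sum>i<Suc n. \<bar>g ((x(Suc n := b)) (Suc i)) - g ((x(Suc n := b)) i)\<bar>) =
      (\<Sum>i<n. \<bar>g (x (Suc i)) - g (x i)\<bar>) + \<bar>g b - g (x n)\<bar>"
    by simp
qed

context
  fixes g :: "real \<Rightarrow> real"
  assumes bdd: "bdd_above (variation_sums g UNIV)"
begin

lemma bdd_variation_sums: "bdd_above (variation_sums g A)"
  by (rule bdd_above_mono[OF bdd variation_sums_mono]) simp

lemma total_variation_nonneg: "0 \<le> total_variation g {..t}"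
  unfolding total_variation_def by (rule cSup_upper[OF zero_in_variation_sums bdd_variation_sums])

lemma total_variation_le_UNIV: "total_variation g {..t} \<le> total_variation g UNIV"
  unfolding total_variation_def
  using zero_in_variation_sums variation_sums_mono[of "{..t}" UNIV g] bdd by (intro cSup_subset_mono) auto

text \<open>Any partition of \<open>{..a}\<close> can be continued by the points \<open>a\<close>
  and \<open>b\<close>. The increment from its last point to \<open>a\<close> is nonnegative and
  dropped, and the one from \<open>a\<close> to \<open>b\<close> is gained.\<close>

lemma abs_diff_le_total_variation:
  assumes "a \<le> b"
  shows "\<bar>g b - g a\<bar> \<le> total_variation g {..b} - total_variation g {..a}"
proof -
  have "total_variation g {..a} \<le> total_variation g {..b} - \<bar>g b - g a\<bar>"
    unfolding total_variation_def[of g "{..a}"]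
  proof (rule cSup_least)
    show "variation_sums g {..a} \<noteq> {}" using zero_in_variation_sums by blast
    fix s assume "s \<in> variation_sums g {..a}"
    then obtain n x where x: "mono_on {..n} x" "x ` {..n} \<subseteq> {..a}" and s: "s = (\<Sum>i<n. \<bar>g (x (Suc i)) - g (x i)\<bar>)"
      unfolding variation_sums_def by blast
    let ?y = "x(Suc n := a)"
    let ?z = "?y(Suc (Suc n) := b)"
    note y = partition_snoc(1,2)[OF x order_refl] partition_snoc(3)[where g=g, OF x order_refl]
    note z = partition_snoc(1,2)[OF y(1,2) assms] partition_snoc(3)[where g=g, OF y(1,2) assms]
    have "(\<Sum>i<Suc (Suc n). \<bar>g (?z (Suc i)) - g (?z i)\<bar>) \<in> variation_sums g {..b}"
      unfolding variation_sums_def using z(1,2) by blast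
    then have "(\<Sum>i<Suc (Suc n). \<bar>g (?z (Suc i)) - g (?z i)\<bar>) \<le> total_variation g {..b}"
      unfolding total_variation_def by (rule cSup_upper[OF _ bdd_variation_sums])
    then have "s + \<bar>g a - g (x n)\<bar> + \<bar>g b - g a\<bar> \<le> total_variation g {..b}"
      unfolding z(3) y(3) s by simp
    then show "s \<le> total_variation g {..b} - \<bar>g b - g a\<bar>" by linarith
  qed
  then show ?thesis by linarith
qed

text \<open>If the variation function jumped by \<open>j\<close> to the right of \<open>t\<close>, then lowering it by \<open>j\<close>
  beyond \<open>t\<close> would still dominate all increments of \<open>g\<close>.\<close>

lemma total_variation_right_continuous:
  assumes rc: "\<And>t. (g \<longlongrightarrow> g t) (at_right t)"
  shows "((\<lambda>t. total_variation g {..t}) \<longlongrightarrow> total_variation g {..t}) (at_right t)"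
proof -
  define V where "V t = total_variation g {..t}" for t
  note inc = abs_diff_le_total_variation[folded V_def]
  have mono: "V a \<le> V b" if "a \<le> b" for a b using inc[OF that] by linarith
  \<comment> \<open>By monotonicity the infimum over the points to the right of \<open>t\<close> is
    the right limit of \<open>V\<close>.\<close>
  define l where "l = (INF s\<in>{t<..}. V s)"
  have ne: "{t<..} \<noteq> {}" by simp
  have bb: "bdd_below (V ` {t<..})" by (rule bdd_belowI[of _ "V t"]) (auto intro: mono)
  have lV: "l \<le> V s" if "t < s" for s unfolding l_def using that bb by (intro cINF_lower) auto
  have Vl: "V t \<le> l" unfolding l_def by (intro cINF_greatest ne) (auto intro: mono)
  have lim: "(V \<longlongrightarrow> l) (at_right t)"
  proof (rule order_tendstoI)
    fix a assume "a < l"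
    then show "eventually (\<lambda>s. a < V s) (at_right t)"
      unfolding eventually_at_right_field using lV by (intro exI[of _ "t + 1"]) (force intro: less_le_trans)
  next
    fix a assume "l < a"
    then obtain s where s: "t < s" "V s < a" unfolding l_def using cINF_less_iff[OF ne bb] by auto
    then show "eventually (\<lambda>s. V s < a) (at_right t)"
      unfolding eventually_at_right_field by (intro exI[of _ s]) (auto intro: le_less_trans[OF mono[OF less_imp_le]])
  qed
  define j where "j = l - V t"
  define W where "W s = (if s \<le> t then V s else V s - j)" for s
  have j: "0 \<le> j" using Vl by (simp add: j_def)
  \<comment> \<open>Right continuity of \<open>g\<close> lets the left end of the increment decrease
    to \<open>t\<close>, so \<open>V t\<close> may be replaced by the larger value
    \<open>l\<close>.\<close>
  have jump: "\<bar>g b - g t\<bar> \<le> V b - l" if "t < b" for b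
  proof (rule tendsto_le[of "at_right t"])
    show "((\<lambda>c. V b - V c) \<longlongrightarrow> V b - l) (at_right t)" by (intro tendsto_intros lim)
    show "((\<lambda>c. \<bar>g b - g c\<bar>) \<longlongrightarrow> \<bar>g b - g t\<bar>) (at_right t)" by (intro tendsto_intros rc)
    show "eventually (\<lambda>c. \<bar>g b - g c\<bar> \<le> V b - V c) (at_right t)"
      unfolding eventually_at_right_field using that by (intro exI[of _ b]) (auto intro: inc)
  qed simp
  have W: "\<bar>g b - g a\<bar> \<le> W b - W a" if ab: "a \<le> b" for a b
  proof (cases "a \<le> t \<and> t < b")
    case True
    then have "\<bar>g b - g t\<bar> \<le> V b - l" "\<bar>g t - g a\<bar> \<le> V t - V a" using jump inc by auto
    then show ?thesis using True by (simp add: W_def j_def)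
  next
    case False
    then show ?thesis using inc[OF ab] ab by (auto simp: W_def)
  qed
  have "V b \<le> V b - j" if b: "t < b" for b
    unfolding V_def[of b] total_variation_def
  proof (rule cSup_least)
    show "variation_sums g {..b} \<noteq> {}" using zero_in_variation_sums by blast
    fix s assume "s \<in> variation_sums g {..b}"
    then obtain n x where x: "mono_on {..n} x" "x ` {..n} \<subseteq> {..b}" and s: "s = (\<Sum>i<n. \<bar>g (x (Suc i)) - g (x i)\<bar>)"
      unfolding variation_sums_def by blast
    have "s \<le> W (x n) - W (x 0)" unfolding s using telescoping_variation_le[OF x(1) W x(2)] .
    moreover have "W (x n) \<le> W b" using W[of "x n" b] x(2) by (force simp: abs_le_iff)
    moreover have "0 \<le> W (x 0)"
    proof (cases "x 0 \<le> t")
      case True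
      then show ?thesis by (simp add: W_def V_def total_variation_nonneg)
    next
      case False
      then have "0 \<le> W t" "W t \<le> W (x 0)"
        using W[of t "x 0"] by (auto simp: W_def V_def total_variation_nonneg)
      then show ?thesis by linarith
    qed
    ultimately have "s \<le> W b" by linarith
    then show "s \<le> Sup (variation_sums g {..b}) - j" using b by (simp add: W_def V_def total_variation_def)
  qed
  from this[of "t + 1"] have "j = 0" using j by simp
  then show ?thesis using lim by (simp add: V_def[symmetric] j_def)
qed

end

text \<open>The variation function and its difference with \<psi> are both nondecreasing, hence have
  right limits, and \<psi> is the difference of the two. The function \<open>W\<close> of the second
  part is the right limit of the variation function; being bounded, it certifies that the right
  limits of \<psi> have bounded variation.\<close>

lemma right_limit_exists:
  assumes bdd: "bdd_above (variation_sums \<psi> UNIV)"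
  shows "(\<psi> \<longlongrightarrow> right_limit \<psi> t) (at_right t)"
    and "\<exists>W. (\<forall>a b. a \<le> b \<longrightarrow> \<bar>right_limit \<psi> b - right_limit \<psi> a\<bar> \<le> W b - W a) \<and> (\<forall>t. 0 \<le> W t \<and> W t \<le> total_variation \<psi> UNIV)"
proof -
  define V where "V t = total_variation \<psi> {..t}" for t
  note inc = abs_diff_le_total_variation[OF bdd, folded V_def]
  have mono_lim: "\<exists>l. (F \<longlongrightarrow> l) (at_right t)" if mono: "\<And>a b. a \<le> b \<Longrightarrow> F a \<le> F b" for F :: "real \<Rightarrow> real" and t
  proof -
    have "(F \<longlongrightarrow> Inf (F ` ({t<..} \<inter> UNIV))) (at t within ({t<..} \<inter> UNIV))"
      by (rule Lim_right_bound[where K="F t"]) (auto intro: mono)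
    then show ?thesis by auto
  qed
  have "V a \<le> V b" "V a - \<psi> a \<le> V b - \<psi> b" if "a \<le> b" for a b using inc[OF that] by linarith+
  then have "\<exists>l. (V \<longlongrightarrow> l) (at_right t)" "\<exists>l. ((\<lambda>t. V t - \<psi> t) \<longlongrightarrow> l) (at_right t)" for t
    by (auto intro!: mono_lim)
  then obtain W N where W: "\<And>t. (V \<longlongrightarrow> W t) (at_right t)" and N: "\<And>t. ((\<lambda>t. V t - \<psi> t) \<longlongrightarrow> N t) (at_right t)"
    by metis
  have lim: "(\<psi> \<longlongrightarrow> right_limit \<psi> t) (at_right t)" for t
  proof -
    have "((\<lambda>t. V t - (V t - \<psi> t)) \<longlongrightarrow> W t - N t) (at_right t)" by (intro tendsto_diff W N)
    then have *: "(\<psi> \<longlongrightarrow> W t - N t) (at_right t)" by simp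
    then have "right_limit \<psi> t = W t - N t" unfolding right_limit_def by (intro tendsto_Lim) auto
    with * show ?thesis by simp
  qed
  then show "(\<psi> \<longlongrightarrow> right_limit \<psi> t) (at_right t)" .
  have shift: "((\<lambda>h. F (a + h)) \<longlongrightarrow> l) (at_right 0)" if "(F \<longlongrightarrow> l) (at_right a)" for F :: "real \<Rightarrow> real" and a l
    using that filterlim_at_right_to_0[of F "nhds l" a] by (simp add: add.commute)
  have "\<bar>right_limit \<psi> b - right_limit \<psi> a\<bar> \<le> W b - W a" if "a \<le> b" for a b
  proof (rule tendsto_le[of "at_right 0"])
    show "((\<lambda>h. V (b + h) - V (a + h)) \<longlongrightarrow> W b - W a) (at_right 0)" by (intro tendsto_intros shift W)
    show "((\<lambda>h. \<bar>\<psi> (b + h) - \<psi> (a + h)\<bar>) \<longlongrightarrow> \<bar>right_limit \<psi> b - right_limit \<psi> a\<bar>) (at_right 0)"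
      by (intro tendsto_intros shift lim)
    show "eventually (\<lambda>h. \<bar>\<psi> (b + h) - \<psi> (a + h)\<bar> \<le> V (b + h) - V (a + h)) (at_right 0)"
      using that by (intro always_eventually allI inc) simp
  qed simp
  moreover have "0 \<le> W t" "W t \<le> total_variation \<psi> UNIV" for t
    using total_variation_nonneg[OF bdd] total_variation_le_UNIV[OF bdd]
    by (auto intro!: tendsto_lowerbound[OF W] tendsto_upperbound[OF W] always_eventually simp: V_def)
  ultimately show "\<exists>W. (\<forall>a b. a \<le> b \<longrightarrow> \<bar>right_limit \<psi> b - right_limit \<psi> a\<bar> \<le> W b - W a) \<and> (\<forall>t. 0 \<le> W t \<and> W t \<le> total_variation \<psi> UNIV)"
    by blast
qed

lemma bdd_variation_right_limit:
  assumes bdd: "bdd_above (variation_sums \<psi> UNIV)"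
  shows "bdd_above (variation_sums (right_limit \<psi>) UNIV)"
proof -
  obtain W where W: "\<And>a b. a \<le> b \<Longrightarrow> \<bar>right_limit \<psi> b - right_limit \<psi> a\<bar> \<le> W b - W a"
    and Wb: "\<And>t. 0 \<le> W t" "\<And>t. W t \<le> total_variation \<psi> UNIV"
    using right_limit_exists(2)[OF bdd] by blast
  show ?thesis
  proof (rule bdd_aboveI)
    fix s assume "s \<in> variation_sums (right_limit \<psi>) UNIV"
    then obtain n x where x: "mono_on {..n} x" and s: "s = (\<Sum>i<n. \<bar>right_limit \<psi> (x (Suc i)) - right_limit \<psi> (x i)\<bar>)"
      unfolding variation_sums_def by blast
    have "x ` {..n} \<subseteq> {..x n}" using mono_onD[OF x] by auto
    from telescoping_variation_le[OF x W this] have "s \<le> W (x n) - W (x 0)" unfolding s .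
    then show "s \<le> total_variation \<psi> UNIV" using Wb(1)[of "x 0"] Wb(2)[of "x n"] by linarith
  qed
qed

lemma right_limit_right_continuous:
  assumes bdd: "bdd_above (variation_sums \<psi> UNIV)"
  shows "(right_limit \<psi> \<longlongrightarrow> right_limit \<psi> t) (at_right t)"
proof (rule tendstoI)
  fix e :: real assume e: "0 < e"
  note lim = right_limit_exists(1)[OF bdd]
  have "eventually (\<lambda>s. dist (\<psi> s) (right_limit \<psi> t) < e / 2) (at_right t)"
    using tendstoD[OF lim, of "e / 2"] e by simp
  then obtain b where b: "t < b" "\<And>s. t < s \<Longrightarrow> s < b \<Longrightarrow> dist (\<psi> s) (right_limit \<psi> t) < e / 2"
    unfolding eventually_at_right_field by blast
  have "dist (right_limit \<psi> u) (right_limit \<psi> t) \<le> e / 2" if u: "t < u" "u < b" for u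
  proof (rule tendsto_upperbound[of _ _ "at_right u"])
    show "((\<lambda>s. dist (\<psi> s) (right_limit \<psi> t)) \<longlongrightarrow> dist (right_limit \<psi> u) (right_limit \<psi> t)) (at_right u)"
      by (intro tendsto_intros lim)
    show "eventually (\<lambda>s. dist (\<psi> s) (right_limit \<psi> t) \<le> e / 2) (at_right u)"
      unfolding eventually_at_right_field using u b(2) by (intro exI[of _ b]) (auto intro: less_imp_le)
  qed simp
  then show "eventually (\<lambda>s. dist (right_limit \<psi> s) (right_limit \<psi> t) < e) (at_right t)"
    unfolding eventually_at_right_field using b(1) e by (intro exI[of _ b]) force
qed

text \<open>The left tail is assumed only strictly below \<open>- R\<close>, since the measure may
  have an atom at \<open>- R\<close> itself. The half-open interval that carries all the mass
  therefore starts at \<open>- R - 1\<close>, which explains the support radius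
  \<open>R + 1\<close>.\<close>

lemma interval_measure_constant_tails:
  fixes F :: "real \<Rightarrow> real"
  assumes mono: "\<And>x y. x \<le> y \<Longrightarrow> F x \<le> F y" and rc: "\<And>a. continuous (at_right a) F"
    and tails: "\<And>t. t < - R \<Longrightarrow> F t = 0" "\<And>t. R \<le> t \<Longrightarrow> F t = c" and R: "0 \<le> R"
  shows "finite_measure (interval_measure F)" "measure (interval_measure F) UNIV = c"
    "AE u in interval_measure F. \<bar>u\<bar> \<le> R + 1"
proof -
  let ?\<mu> = "interval_measure F"
  have c: "0 \<le> c" using mono[of "- R - 1" R] tails(1)[of "- R - 1"] tails(2)[of R] R by simp
  have Ioc: "emeasure ?\<mu> {a<..b} = F b - F a" if "a \<le> b" for a b
    by (rule emeasure_interval_measure_Ioc[OF that mono rc])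
  have UN: "(\<Union>n. {- R - 1 - real n<..R + real n}) = UNIV"
  proof (rule UNIV_eq_I[symmetric])
    fix x :: real
    obtain n :: nat where "\<bar>x\<bar> \<le> real n" using real_arch_simple by blast
    then show "x \<in> (\<Union>n. {- R - 1 - real n<..R + real n})" using R by (intro UN_I[of n]) auto
  qed
  have "(\<lambda>n. emeasure ?\<mu> {- R - 1 - real n<..R + real n}) \<longlonglongrightarrow> emeasure ?\<mu> (\<Union>n. {- R - 1 - real n<..R + real n})"
    by (rule Lim_emeasure_incseq) (auto simp: incseq_def)
  moreover have "emeasure ?\<mu> {- R - 1 - real n<..R + real n} = ennreal c" for n
    using R by (subst Ioc) (auto simp: tails)
  ultimately have "(\<lambda>n. ennreal c) \<longlonglongrightarrow> emeasure ?\<mu> UNIV" by (simp only: UN)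
  then have total: "emeasure ?\<mu> UNIV = ennreal c" by (simp add: LIMSEQ_const_iff)
  then show fin: "finite_measure ?\<mu>" by (intro finite_measureI) simp
  show "measure ?\<mu> UNIV = c" using total c by (simp add: measure_def)
  have m: "emeasure ?\<mu> {- R - 1<..R} = ennreal c" using R by (subst Ioc) (auto simp: tails)
  have "emeasure ?\<mu> (UNIV - {- R - 1<..R}) = 0"
    using m total by (subst emeasure_Diff) auto
  then show "AE u in ?\<mu>. \<bar>u\<bar> \<le> R + 1"
    by (intro AE_I[of _ _ "UNIV - {- R - 1<..R}"]) (use R in auto)
qed

text \<open>The two masses agree because the right limits of \<psi> vanish far out on both sides: at
  infinity the positive and negative variations are both half the total variation. This equality
  says that the signed measure has total mass zero, so the moving average does not change when a
  constant is added to the path.\<close>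

lemma variation_measures:
  assumes bv: "bounded_variation \<psi>" and cpt: "compact (closure {x. \<psi> x \<noteq> 0})"
  shows "\<exists>(R :: nat) c. 
    finite_measure (interval_measure (pos_variation \<psi>)) \<and> measure (interval_measure (pos_variation \<psi>)) UNIV = c \<and>
    (AE u in interval_measure (pos_variation \<psi>). \<bar>u\<bar> \<le> real R) \<and>
    finite_measure (interval_measure (neg_variation \<psi>)) \<and> measure (interval_measure (neg_variation \<psi>)) UNIV = c \<and>
    (AE u in interval_measure (neg_variation \<psi>). \<bar>u\<bar> \<le> real R)"
proof -
  have bdd: "bdd_above (variation_sums \<psi> UNIV)" using bv by (simp add: bounded_variation_def)
  define g where "g = right_limit \<psi>"
  note gb = bdd_variation_right_limit[OF bdd, folded g_def]
  note grc = right_limit_right_continuous[OF bdd, folded g_def]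
  define V where "V t = total_variation g {..t}" for t
  note inc = abs_diff_le_total_variation[OF gb, folded V_def]
  note Vrc = total_variation_right_continuous[OF gb grc, folded V_def]
  have pos: "pos_variation \<psi> = (\<lambda>t. (V t + g t) / 2)" and neg: "neg_variation \<psi> = (\<lambda>t. (V t - g t) / 2)"
    by (auto simp: pos_variation_def neg_variation_def V_def g_def)
  have "bounded {x. \<psi> x \<noteq> 0}"
    using compact_imp_bounded[OF cpt] closure_subset bounded_subset by blast
  then obtain R0 where R0: "\<And>x. \<psi> x \<noteq> 0 \<Longrightarrow> \<bar>x\<bar> \<le> R0" by (auto simp: bounded_iff)
  obtain R :: nat where R: "R0 < real R" using reals_Archimedean2 by blast
  have \<psi>0: "\<psi> x = 0" if "real R \<le> \<bar>x\<bar>" for x using R0[of x] R that by fastforce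
  have g_zero: "g t = 0" if ev: "eventually (\<lambda>s. \<psi> s = 0) (at_right t)" for t
  proof (rule tendsto_unique[of "at_right t"])
    show "(\<psi> \<longlongrightarrow> g t) (at_right t)" unfolding g_def by (rule right_limit_exists(1)[OF bdd])
    show "(\<psi> \<longlongrightarrow> 0) (at_right t)"
      by (rule Lim_transform_eventually[OF tendsto_const]) (use ev in \<open>auto elim: eventually_mono\<close>)
  qed simp
  have g_left: "g t = 0" if "t < - real R" for t
    by (rule g_zero) (auto simp: eventually_at_right_field intro!: exI[of _ "- real R"] \<psi>0 that)
  have g_right: "g t = 0" if "real R \<le> t" for t
    by (rule g_zero) (use that in \<open>auto simp: eventually_at_right_field intro!: exI[of _ "t + 1"] \<psi>0\<close>)
  have V_left: "V t = 0" if t: "t < - real R" for t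
  proof (rule antisym)
    show "V t \<le> 0" unfolding V_def total_variation_def
    proof (rule cSup_least)
      show "variation_sums g {..t} \<noteq> {}" using zero_in_variation_sums by blast
      fix s assume "s \<in> variation_sums g {..t}"
      then obtain n x where x: "x ` {..n} \<subseteq> {..t}" and s: "s = (\<Sum>i<n. \<bar>g (x (Suc i)) - g (x i)\<bar>)"
        unfolding variation_sums_def by blast
      have "g (x i) = 0" if "i \<le> n" for i using x t that by (intro g_left) force
      then show "s \<le> 0" unfolding s by simp
    qed
    show "0 \<le> V t" unfolding V_def by (rule total_variation_nonneg[OF gb])
  qed
  have V_right: "V t = V (real R)" if t: "real R \<le> t" for t
  proof (rule antisym)
    show "V t \<le> V (real R)" unfolding V_def[of t] total_variation_def
    proof (rule cSup_least)
      show "variation_sums g {..t} \<noteq> {}" using zero_in_variation_sums by blast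
      fix s assume "s \<in> variation_sums g {..t}"
      then obtain n x where x: "mono_on {..n} x" and s: "s = (\<Sum>i<n. \<bar>g (x (Suc i)) - g (x i)\<bar>)"
        unfolding variation_sums_def by blast
      \<comment> \<open>Cutting a partition at \<open>real R\<close> does not change its sum,
        because \<open>g\<close> vanishes from there on.\<close>
      have gmin: "g (min y (real R)) = g y" for y using g_right by (auto simp: min_def)
      have "s = (\<Sum>i<n. \<bar>g (min (x (Suc i)) (real R)) - g (min (x i) (real R))\<bar>)" by (simp add: s gmin)
      moreover have "mono_on {..n} (\<lambda>i. min (x i) (real R))"
        using mono_onD[OF x] by (intro mono_onI min.mono) auto
      ultimately have "s \<in> variation_sums g {..real R}" unfolding variation_sums_def by fastforce
      then show "s \<le> V (real R)" unfolding V_def total_variation_def by (rule cSup_upper[OF _ bdd_variation_sums[OF gb]])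
    qed
    show "V (real R) \<le> V t" using inc[OF t] by linarith
  qed
  have mono: "(V x + g x) / 2 \<le> (V y + g y) / 2" "(V x - g x) / 2 \<le> (V y - g y) / 2" if "x \<le> y" for x y
    using inc[OF that] by (simp_all add: abs_le_iff)
  have cont: "continuous (at_right a) (\<lambda>t. (V t + g t) / 2)" "continuous (at_right a) (\<lambda>t. (V t - g t) / 2)" for a
    unfolding continuous_within by (intro tendsto_intros Vrc grc; simp)+
  have tails: "(V t + g t) / 2 = 0" "(V t - g t) / 2 = 0" if "t < - real R" for t using V_left[OF that] g_left[OF that] by simp_all
  have tails': "(V t + g t) / 2 = V (real R) / 2" "(V t - g t) / 2 = V (real R) / 2" if "real R \<le> t" for t
    using V_right[OF that] g_right[OF that] by simp_all
  have P: "finite_measure (interval_measure (\<lambda>t. (V t + g t) / 2))"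
      "measure (interval_measure (\<lambda>t. (V t + g t) / 2)) UNIV = V (real R) / 2"
      "AE u in interval_measure (\<lambda>t. (V t + g t) / 2). \<bar>u\<bar> \<le> real R + 1"
    by (rule interval_measure_constant_tails[where R="real R" and c="V (real R) / 2"];
        fact mono(1) cont(1) tails(1) tails'(1) of_nat_0_le_iff)+
  have N: "finite_measure (interval_measure (\<lambda>t. (V t - g t) / 2))"
      "measure (interval_measure (\<lambda>t. (V t - g t) / 2)) UNIV = V (real R) / 2"
      "AE u in interval_measure (\<lambda>t. (V t - g t) / 2). \<bar>u\<bar> \<le> real R + 1"
    by (rule interval_measure_constant_tails[where R="real R" and c="V (real R) / 2"];
        fact mono(2) cont(2) tails(2) tails'(2) of_nat_0_le_iff)+
  have Suc: "real R + 1 = real (Suc R)" by simp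
  show ?thesis unfolding pos neg using P N unfolding Suc by blast
qed

section \<open>Moving averages of cadlag paths\<close>

text \<open>The least multiple of \<open>1 / (n + 1)\<close> strictly above \<open>x\<close>.
  Strictness matters: a cadlag path is continuous from the right only, and may jump at
  \<open>x\<close> when approached from the left. The type \<open>rat\<close> makes the set of
  sampling times countable.\<close>

definition upper_rat :: "nat \<Rightarrow> real \<Rightarrow> rat" where
  "upper_rat n x = (of_int \<lfloor>real (Suc n) * x\<rfloor> + 1) / of_nat (Suc n)"

lemma of_rat_upper_rat: "of_rat (upper_rat n x) = (real_of_int \<lfloor>real (Suc n) * x\<rfloor> + 1) / real (Suc n)"
  unfolding upper_rat_def by (simp add: of_rat_divide of_rat_add del: of_nat_Suc)

lemma upper_rat_bounds: "x < of_rat (upper_rat n x)" "of_rat (upper_rat n x) \<le> x + 1 / real (Suc n)"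
proof -
  have "real (Suc n) * x < real_of_int \<lfloor>real (Suc n) * x\<rfloor> + 1" "real_of_int \<lfloor>real (Suc n) * x\<rfloor> + 1 \<le> real (Suc n) * x + 1"
    by linarith+
  then have "x < (real_of_int \<lfloor>real (Suc n) * x\<rfloor> + 1) / real (Suc n)"
    "(real_of_int \<lfloor>real (Suc n) * x\<rfloor> + 1) / real (Suc n) \<le> (real (Suc n) * x + 1) / real (Suc n)"
    by (simp_all add: pos_less_divide_eq mult.commute divide_right_mono del: of_nat_Suc)
  then show "x < of_rat (upper_rat n x)" "of_rat (upper_rat n x) \<le> x + 1 / real (Suc n)"
    unfolding of_rat_upper_rat by (simp_all add: add_divide_distrib del: of_nat_Suc)
qed

lemma upper_rat_tendsto: "filterlim (\<lambda>n. of_rat (upper_rat n x) :: real) (at_right x) sequentially"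
proof (rule filterlim_at_withinI)
  show "(\<lambda>n. of_rat (upper_rat n x) :: real) \<longlonglongrightarrow> x"
  proof (rule tendsto_sandwich[of "\<lambda>_. x" _ _ "\<lambda>n. x + 1 / real (Suc n)"])
    show "(\<lambda>n. x + 1 / real (Suc n)) \<longlonglongrightarrow> x"
      using tendsto_add[OF tendsto_const LIMSEQ_inverse_real_of_nat, of x] by (simp add: inverse_eq_divide)
  qed (use upper_rat_bounds in \<open>auto intro!: always_eventually less_imp_le\<close>)
  show "\<forall>\<^sub>F n in sequentially. of_rat (upper_rat n x) \<in> {x<..} - {x}"
    using upper_rat_bounds(1) by (auto intro!: always_eventually less_imp_neq[symmetric])
qed

lemma measurable_upper_rat [measurable]: "upper_rat n \<in> measurable borel (count_space UNIV)"
proof -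
  have "(\<lambda>x. \<lfloor>real (Suc n) * x\<rfloor>) \<in> measurable borel (count_space UNIV)" by measurable
  then show ?thesis unfolding upper_rat_def[abs_def]
    by (rule measurable_compose) simp
qed

lemma cadlag_tendsto:
  assumes "cadlag s"
  shows "(\<lambda>n. s (of_rat (upper_rat n x))) \<longlonglongrightarrow> s x"
proof -
  have "(s \<longlongrightarrow> s x) (at_right x)" using assms by (simp add: cadlag_def continuous_within)
  then show ?thesis by (rule filterlim_compose[OF _ upper_rat_tendsto])
qed

lemma cadlag_measurable:
  assumes "cadlag s"
  shows "s \<in> borel_measurable borel"
proof (rule borel_measurable_LIMSEQ_real[OF cadlag_tendsto[OF assms]])
  show "(\<lambda>x. s (of_rat (upper_rat i x))) \<in> borel_measurable borel" for i
    by (rule measurable_compose[OF measurable_upper_rat]) simp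
qed

text \<open>One-sided limits bound the path near every point, and bisection of the interval glues
  the local bounds together.\<close>

lemma cadlag_bounded:
  assumes s: "cadlag s" and ab: "a \<le> b"
  shows "\<exists>C. \<forall>x\<in>{a..b}. \<bar>s x\<bar> \<le> C"
  using ab
proof (induction rule: Bolzano)
  case (trans a b c)
  then obtain C D where C: "\<And>x. x \<in> {a..b} \<Longrightarrow> \<bar>s x\<bar> \<le> C" and D: "\<And>x. x \<in> {b..c} \<Longrightarrow> \<bar>s x\<bar> \<le> D" by blast
  have "\<bar>s x\<bar> \<le> max C D" if "x \<in> {a..c}" for x
    using C[of x] D[of x] that by (cases "x \<le> b") auto
  then show ?case by blast
next
  case (local x)
  obtain l where l: "(s \<longlongrightarrow> l) (at_left x)" using s by (auto simp: cadlag_def)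
  have r: "(s \<longlongrightarrow> s x) (at_right x)" using s by (simp add: cadlag_def continuous_within)
  obtain p where p: "p < x" "\<And>y. p < y \<Longrightarrow> y < x \<Longrightarrow> \<bar>s y - l\<bar> < 1"
    using tendstoD[OF l, of 1] unfolding eventually_at_left_field dist_real_def by auto
  obtain q where q: "x < q" "\<And>y. x < y \<Longrightarrow> y < q \<Longrightarrow> \<bar>s y - s x\<bar> < 1"
    using tendstoD[OF r, of 1] unfolding eventually_at_right_field dist_real_def by auto
  show ?case
  proof (rule exI[of _ "min (x - p) (q - x)"], intro conjI allI impI)
    fix a b assume ab: "a \<le> x \<and> x \<le> b \<and> b - a < min (x - p) (q - x)"
    have "\<bar>s y\<bar> \<le> \<bar>l\<bar> + \<bar>s x\<bar> + 1" if "y \<in> {a..b}" for y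
    proof -
      consider "y < x" | "y = x" | "x < y" by linarith
      then show ?thesis
      proof cases
        case 1
        then show ?thesis using p(2)[of y] ab that by auto
      next
        case 3
        then show ?thesis using q(2)[of y] ab that by auto
      qed auto
    qed
    then show "\<exists>C. \<forall>y\<in>{a..b}. \<bar>s y\<bar> \<le> C" by blast
  qed (use p q in auto)
qed

lemma cadlag_affine:
  assumes s: "cadlag s" and a: "0 < a"
  shows "cadlag (\<lambda>x. k * s (h + a * x) - m)"
  unfolding cadlag_def
proof (intro allI conjI)
  fix t
  have R: "filterlim (\<lambda>x. h + a * x) (at_right (h + a * t)) (at_right t)"
  proof (rule filterlim_at_withinI)
    show "((\<lambda>x. h + a * x) \<longlongrightarrow> h + a * t) (at_right t)" by (intro tendsto_intros)
    show "\<forall>\<^sub>F x in at_right t. h + a * x \<in> {h + a * t<..} - {h + a * t}"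
      unfolding eventually_at_right_field using a by (intro exI[of _ "t + 1"]) auto
  qed
  have L: "filterlim (\<lambda>x. h + a * x) (at_left (h + a * t)) (at_left t)"
  proof (rule filterlim_at_withinI)
    show "((\<lambda>x. h + a * x) \<longlongrightarrow> h + a * t) (at_left t)" by (intro tendsto_intros)
    show "\<forall>\<^sub>F x in at_left t. h + a * x \<in> {..<h + a * t} - {h + a * t}"
      unfolding eventually_at_left_field using a by (intro exI[of _ "t - 1"]) auto
  qed
  have "(s \<longlongrightarrow> s (h + a * t)) (at_right (h + a * t))" using s by (simp add: cadlag_def continuous_within)
  from filterlim_compose[OF this R]
  show "continuous (at_right t) (\<lambda>x. k * s (h + a * x) - m)"
    unfolding continuous_within by (intro tendsto_intros)
  obtain l where "(s \<longlongrightarrow> l) (at_left (h + a * t))" using s by (auto simp: cadlag_def)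
  from filterlim_compose[OF this L]
  have "((\<lambda>x. k * s (h + a * x) - m) \<longlongrightarrow> k * l - m) (at_left t)" by (intro tendsto_intros)
  then show "\<exists>l. ((\<lambda>x. k * s (h + a * x) - m) \<longlongrightarrow> l) (at_left t)" by blast
qed

text \<open>The signed measure of the Stieltjes integral, given by two positive parts of equal mass
  carried by \<open>[- R, R]\<close>. The radius is a natural number so that the ends of path
  segments fall on every grid of mesh \<open>1 / q\<close>.\<close>

locale compact_signed_measure =
  fixes \<mu>p \<mu>n :: "real measure" and R :: nat
  assumes finite_p: "finite_measure \<mu>p" and finite_n: "finite_measure \<mu>n"
    and sets_p: "sets \<mu>p = sets borel" and sets_n: "sets \<mu>n = sets borel"
    and mass_zero: "measure \<mu>p UNIV = measure \<mu>n UNIV"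
    and support_p: "AE u in \<mu>p. \<bar>u\<bar> \<le> real R" and support_n: "AE u in \<mu>n. \<bar>u\<bar> \<le> real R"
begin

sublocale p: finite_measure \<mu>p by (rule finite_p)
sublocale n: finite_measure \<mu>n by (rule finite_n)

lemma space_pn: "space \<mu>p = UNIV" "space \<mu>n = UNIV"
  using sets_eq_imp_space_eq[OF sets_p] sets_eq_imp_space_eq[OF sets_n] by simp_all

declare sets_p [measurable_cong] sets_n [measurable_cong]

definition signed_integral :: "(real \<Rightarrow> real) \<Rightarrow> real" where
  "signed_integral h = (\<integral>u. h u \<partial>\<mu>p) - (\<integral>u. h u \<partial>\<mu>n)"

text \<open>Evaluates the moving average from the values of a path at rational times; the right limit in
  \<open>upper_rat\<close> recovers a cadlag path.\<close>

definition smoothing :: "(rat \<Rightarrow> real) \<Rightarrow> real \<Rightarrow> real" where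
  "smoothing g t = lim (\<lambda>n. signed_integral (\<lambda>u. g (upper_rat n (t - u))))"

lemma signed_integral_cong:
  assumes "f \<in> borel_measurable borel" "g \<in> borel_measurable borel" "\<And>u. \<bar>u\<bar> \<le> real R \<Longrightarrow> f u = g u"
  shows "signed_integral f = signed_integral g"
proof -
  have "AE u in \<mu>p. f u = g u" "AE u in \<mu>n. f u = g u"
    using support_p support_n assms(3) by (auto elim: eventually_mono)
  then have "(\<integral>u. f u \<partial>\<mu>p) = (\<integral>u. g u \<partial>\<mu>p)" "(\<integral>u. f u \<partial>\<mu>n) = (\<integral>u. g u \<partial>\<mu>n)"
    using assms(1,2) by (auto intro!: integral_cong_AE simp: measurable_cong_sets[OF sets_p refl] measurable_cong_sets[OF sets_n refl])
  then show ?thesis by (simp add: signed_integral_def)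
qed

lemma signed_integral_cmult: "signed_integral (\<lambda>u. c * h u) = c * signed_integral h"
  by (simp add: signed_integral_def right_diff_distrib)

lemma integrable_pn:
  fixes h :: "real \<Rightarrow> real"
  assumes "h \<in> borel_measurable borel" "\<And>u. \<bar>u\<bar> \<le> real R \<Longrightarrow> \<bar>h u\<bar> \<le> C"
  shows "integrable \<mu>p h" "integrable \<mu>n h"
proof -
  have "AE u in \<mu>p. norm (h u) \<le> C" "AE u in \<mu>n. norm (h u) \<le> C"
    using support_p support_n assms(2) by (auto elim: eventually_mono)
  then show "integrable \<mu>p h" "integrable \<mu>n h"
    using assms(1) by (auto intro!: p.integrable_const_bound n.integrable_const_bound
      simp: measurable_cong_sets[OF sets_p refl] measurable_cong_sets[OF sets_n refl])
qed

text \<open>Equal masses cancel the constant. With \<open>k\<close> the value of \<open>S\<close> at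
  the start of a block, the moving average becomes a functional of increments alone.\<close>

lemma signed_integral_diff_const:
  fixes h :: "real \<Rightarrow> real"
  assumes "h \<in> borel_measurable borel" "\<And>u. \<bar>u\<bar> \<le> real R \<Longrightarrow> \<bar>h u\<bar> \<le> C"
  shows "signed_integral (\<lambda>u. h u - k) = signed_integral h"
  using integrable_pn[OF assms] mass_zero by (simp add: signed_integral_def space_pn)

text \<open>Dominated convergence: the sampled values converge pointwise by right continuity, and
  for \<open>u\<close> in the support all sampling times stay in a compact interval, where a cadlag
  path is bounded.\<close>

lemma smoothing_sequence:
  assumes s: "cadlag s"
  shows "(\<lambda>n. signed_integral (\<lambda>u. s (of_rat (upper_rat n (t - u))))) \<longlonglongrightarrow> signed_integral (\<lambda>u. s (t - u))"
proof -
  obtain C where C: "\<And>x. x \<in> {t - real R..t + real R + 1} \<Longrightarrow> \<bar>s x\<bar> \<le> C"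
  proof -
    have "\<exists>C. \<forall>x\<in>{t - real R..t + real R + 1}. \<bar>s x\<bar> \<le> C" by (rule cadlag_bounded[OF s]) simp
    then show ?thesis using that by blast
  qed
  have [measurable]: "s \<in> borel_measurable borel" by (rule cadlag_measurable[OF s])
  have m: "(\<lambda>u. s (of_rat (upper_rat n (t - u)))) \<in> borel_measurable borel" for n
    by (rule measurable_compose[of "\<lambda>u. t - u" borel borel]) (auto intro: measurable_compose[OF measurable_upper_rat])
  have bd: "norm (s (of_rat (upper_rat n (t - u)))) \<le> C" if "\<bar>u\<bar> \<le> real R" for n u
  proof -
    have "1 / real (Suc n) \<le> 1" by simp
    then show ?thesis
      unfolding real_norm_def
    proof (intro C)
      show "of_rat (upper_rat n (t - u)) \<in> {t - real R..t + real R + 1}"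
        unfolding atLeastAtMost_iff using that upper_rat_bounds[where x="t - u" and n=n] \<open>1 / real (Suc n) \<le> 1\<close>
        by linarith
    qed
  qed
  have lim: "(\<lambda>n. \<integral>u. s (of_rat (upper_rat n (t - u))) \<partial>\<mu>) \<longlonglongrightarrow> (\<integral>u. s (t - u) \<partial>\<mu>)"
    if \<mu>: "finite_measure \<mu>" "sets \<mu> = sets borel" "AE u in \<mu>. \<bar>u\<bar> \<le> real R" for \<mu>
  proof (rule integral_dominated_convergence[where w="\<lambda>_. C"])
    interpret finite_measure \<mu> by fact
    show "integrable \<mu> (\<lambda>_. C)" by simp
    show "AE u in \<mu>. norm (s (of_rat (upper_rat n (t - u)))) \<le> C" for n
      using \<mu>(3) by eventually_elim (rule bd)
    show "AE u in \<mu>. (\<lambda>n. s (of_rat (upper_rat n (t - u)))) \<longlonglongrightarrow> s (t - u)"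
      by (intro AE_I2 cadlag_tendsto[OF s])
  qed (use m in \<open>simp_all add: measurable_cong_sets[OF \<mu>(2) refl]\<close>)
  show ?thesis unfolding signed_integral_def
    by (intro tendsto_diff lim finite_p finite_n sets_p sets_n support_p support_n)
qed

lemma smoothing_cadlag:
  assumes "cadlag s"
  shows "smoothing (\<lambda>q. s (of_rat q)) t = signed_integral (\<lambda>u. s (t - u))"
  unfolding smoothing_def by (rule limI[OF smoothing_sequence[OF assms]])

text \<open>A sampling time lies strictly above \<open>t - u\<close> and at most one unit beyond it,
  so for \<open>t\<close> in \<open>[0, T]\<close> and \<open>u\<close> in the support it stays
  between \<open>- R\<close> and \<open>T + R + 1\<close>.\<close>

lemma smoothing_cong:
  assumes eq: "\<And>q. - real R \<le> of_rat q \<Longrightarrow> of_rat q \<le> T + real R + 1 \<Longrightarrow> f q = g q" and t: "0 \<le> t" "t \<le> T"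
  shows "smoothing f t = smoothing g t"
proof -
  have "signed_integral (\<lambda>u. f (upper_rat n (t - u))) = signed_integral (\<lambda>u. g (upper_rat n (t - u)))" for n
  proof (rule signed_integral_cong)
    have m: "(\<lambda>u. h (upper_rat n (t - u))) \<in> borel_measurable borel" for h :: "rat \<Rightarrow> real"
      by (rule measurable_compose[of "\<lambda>u. t - u" borel borel]) (auto intro: measurable_compose[OF measurable_upper_rat])
    show "(\<lambda>u. f (upper_rat n (t - u))) \<in> borel_measurable borel" "(\<lambda>u. g (upper_rat n (t - u))) \<in> borel_measurable borel"
      by (rule m)+
    fix u :: real assume "\<bar>u\<bar> \<le> real R"
    moreover have "1 / real (Suc n) \<le> 1" by simp
    ultimately show "f (upper_rat n (t - u)) = g (upper_rat n (t - u))"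
      using upper_rat_bounds[where x="t - u" and n=n] t by (intro eq) linarith+
  qed
  then show ?thesis by (simp add: smoothing_def)
qed

text \<open>Evaluating \<open>g\<close> at a varying time is measurable in both arguments because
  the time takes countably many values. The function \<open>lim\<close> preserves measurability also
  on families \<open>g\<close> for which the limit fails to exist.\<close>

lemma smoothing_measurable:
  "(\<lambda>(t, g). smoothing g t) \<in> borel_measurable (borel \<Otimes>\<^sub>M (\<Pi>\<^sub>M q\<in>UNIV. borel))"
proof -
  let ?N = "borel \<Otimes>\<^sub>M (\<Pi>\<^sub>M q\<in>(UNIV::rat set). (borel :: real measure))"
  have m: "(\<lambda>(x, u). snd x (upper_rat n (fst x - u))) \<in> borel_measurable (?N \<Otimes>\<^sub>M borel)" for n
  proof -
    have "(\<lambda>y. (\<lambda>q y. snd (fst y) q) (upper_rat n (fst (fst y) - snd y)) y) \<in> borel_measurable (?N \<Otimes>\<^sub>M borel)"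
    proof (rule measurable_compose_countable)
      show "(\<lambda>y. snd (fst y) q) \<in> borel_measurable (?N \<Otimes>\<^sub>M borel)" for q
        by measurable
      show "(\<lambda>y. upper_rat n (fst (fst y) - snd y)) \<in> measurable (?N \<Otimes>\<^sub>M borel) (count_space UNIV)"
        by (rule measurable_compose[OF _ measurable_upper_rat]) measurable
    qed
    then show ?thesis by (simp add: case_prod_unfold)
  qed
  have p: "(\<lambda>x. \<integral>u. snd x (upper_rat n (fst x - u)) \<partial>\<mu>p) \<in> borel_measurable ?N" for n
    by (rule p.borel_measurable_lebesgue_integral) (use m in \<open>simp cong: measurable_cong_sets sets_pair_measure_cong add: sets_p\<close>)
  have q: "(\<lambda>x. \<integral>u. snd x (upper_rat n (fst x - u)) \<partial>\<mu>n) \<in> borel_measurable ?N" for n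
    by (rule n.borel_measurable_lebesgue_integral) (use m in \<open>simp cong: measurable_cong_sets sets_pair_measure_cong add: sets_n\<close>)
  have "(\<lambda>x. smoothing (snd x) (fst x)) \<in> borel_measurable ?N"
    unfolding smoothing_def signed_integral_def using p q by (intro borel_measurable_lim_metric borel_measurable_diff)
  then show ?thesis by (simp add: case_prod_unfold)
qed

end

section \<open>Block integrals of a measurable process\<close>

definition bounded_by :: "real \<Rightarrow> (real \<Rightarrow> real) \<Rightarrow> bool" where
  "bounded_by B f \<longleftrightarrow> f \<in> borel_measurable borel \<and> (\<forall>x. \<bar>f x\<bar> \<le> B)"

lemma bounded_byD:
  assumes "bounded_by B f"
  shows "f \<in> borel_measurable borel" "\<bar>f x\<bar> \<le> B" "0 \<le> B"
  using assms abs_ge_zero[of "f 0"] order_trans unfolding bounded_by_def by blast+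

lemma bounded_by_iff_range:
  "(\<exists>B. bounded_by B f) \<longleftrightarrow> f \<in> borel_measurable borel \<and> bounded (range f)"
  by (auto simp: bounded_by_def bounded_iff)

lemma bounded_by_sum:
  assumes "\<And>i. i \<in> I \<Longrightarrow> bounded_by B (f i)"
  shows "bounded_by ((\<Sum>i\<in>I. \<bar>c i\<bar>) * B) (\<lambda>x. \<Sum>i\<in>I. c i * f i x)"
  unfolding bounded_by_def
proof (intro conjI allI)
  show "(\<lambda>x. \<Sum>i\<in>I. c i * f i x) \<in> borel_measurable borel"
    using bounded_byD(1)[OF assms] by measurable
  show "\<bar>\<Sum>i\<in>I. c i * f i x\<bar> \<le> (\<Sum>i\<in>I. \<bar>c i\<bar>) * B" for x
    unfolding sum_distrib_right
    by (rule order_trans[OF sum_abs])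
      (auto simp: abs_mult intro!: sum_mono mult_left_mono bounded_byD(2)[OF assms])
qed

locale block_process = prob_space M
  for M :: "'a measure" +
  fixes Z :: "real \<Rightarrow> 'a \<Rightarrow> real" and r :: nat
  assumes Z_measurable: "(\<lambda>(t, \<omega>). Z t \<omega>) \<in> borel_measurable (borel \<Otimes>\<^sub>M M)"
begin

definition block :: "(real \<Rightarrow> real) \<Rightarrow> real \<Rightarrow> real \<Rightarrow> 'a \<Rightarrow> real" where
  "block f T h \<omega> = (LINT t:{0..T}|lborel. f (Z (h + t) \<omega>))"

lemma Z_measurable' [measurable (raw)]:
  assumes [measurable]: "g \<in> borel_measurable N" "k \<in> measurable N M"
  shows "(\<lambda>x. Z (g x) (k x)) \<in> borel_measurable N"
  using measurable_compose[OF _ Z_measurable, of "\<lambda>x. (g x, k x)" N] by simp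

lemma block_measurable:
  assumes [measurable]: "f \<in> borel_measurable borel"
  shows "block f T h \<in> borel_measurable M"
  unfolding block_def set_lebesgue_integral_def by measurable

lemma block_integrable:
  assumes f: "bounded_by B f" and w[measurable]: "\<omega> \<in> space M"
  shows "set_integrable lborel {a..b} (\<lambda>t. f (Z (h + t) \<omega>))"
proof -
  note [measurable] = bounded_byD(1)[OF f]
  show ?thesis
    unfolding set_integrable_def
    by (rule integrableI_bounded_set[where A="{a..b}" and B=B])
      (use bounded_byD(2)[OF f] in \<open>auto simp: emeasure_lborel_Icc_eq split: split_indicator\<close>)
qed

lemma abs_block_le:
  assumes f: "bounded_by B f" and "\<omega> \<in> space M" "0 \<le> T"
  shows "\<bar>block f T h \<omega>\<bar> \<le> B * T"
proof -
  have "integrable lborel (indicator {0..T} :: real \<Rightarrow> real)"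
    by (simp add: integrable_indicator_iff emeasure_lborel_Icc_eq)
  note [simp] = this
  have "\<bar>block f T h \<omega>\<bar> \<le> (\<integral>t. \<bar>indicator {0..T} t *\<^sub>R f (Z (h + t) \<omega>)\<bar> \<partial>lborel)"
    unfolding block_def set_lebesgue_integral_def by (rule integral_abs_bound)
  also have "\<dots> \<le> (LINT t:{0..T}|lborel. B)"
    unfolding set_lebesgue_integral_def
    using block_integrable[OF f assms(2), of 0 T h] bounded_byD[OF f]
    by (intro integral_mono) (auto simp: set_integrable_def intro!: integrable_abs integrable_mult_left
        simp: integrable_indicator_iff emeasure_lborel_Icc_eq split: split_indicator)
  also have "\<dots> = B * T"
    using assms(3) by (simp add: set_lebesgue_integral_def)
  finally show ?thesis .
qed

lemma block_split:
  assumes f: "bounded_by B f" and w: "\<omega> \<in> space M" and "0 \<le> T" "0 \<le> U"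
  shows "block f (T + U) h \<omega> = block f T h \<omega> + block f U (h + T) \<omega>"
proof -
  let ?g = "\<lambda>t. f (Z (h + t) \<omega>)"
  have "block f (T + U) h \<omega> = (LINT t:{0..T} \<union> {T<..T+U}|lborel. ?g t)"
    unfolding block_def using assms by (intro arg_cong2[where f="\<lambda>A. set_lebesgue_integral lborel A"]) auto
  also have "\<dots> = (LINT t:{0..T}|lborel. ?g t) + (LINT t:{T<..T+U}|lborel. ?g t)"
    using block_integrable[OF f w, of 0 T h] block_integrable[OF f w, of T "T+U" h]
    by (intro set_integral_Un) (auto elim: set_integrable_subset)
  also have "(LINT t:{T<..T+U}|lborel. ?g t) = (LINT t:{T..T+U}|lborel. ?g t)"
    unfolding set_lebesgue_integral_def using assms bounded_byD(1)[OF f]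
    by (intro integral_cong_AE) (auto intro!: AE_I'[of "{T}"] split: split_indicator)
  also have "\<dots> = (\<integral>t. indicator {0..U} t *\<^sub>R ?g (T + t) \<partial>lborel)"
    unfolding set_lebesgue_integral_def
    by (subst lborel_integral_real_affine[where c=1 and t=T])
      (auto intro!: Bochner_Integration.integral_cong split: split_indicator)
  also have "\<dots> = block f U (h + T) \<omega>"
    unfolding block_def set_lebesgue_integral_def by (simp add: add.assoc)
  finally show ?thesis unfolding block_def .
qed

lemma block_zero_length [simp]: "block f 0 h \<omega> = 0"
  unfolding block_def set_lebesgue_integral_def
  by (intro integral_eq_zero_AE AE_I'[of "{0}"]) (auto split: split_indicator_asm)

lemma block_sum:
  assumes f: "\<And>i. i \<in> I \<Longrightarrow> bounded_by B (f i)" and w: "\<omega> \<in> space M"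
  shows "block (\<lambda>x. \<Sum>i\<in>I. c i * f i x) T h \<omega> = (\<Sum>i\<in>I. c i * block (f i) T h \<omega>)"
proof -
  let ?g = "\<lambda>i t. indicator {0..T} t *\<^sub>R f i (Z (h + t) \<omega>)"
  have int: "integrable lborel (?g i)" if "i \<in> I" for i
    using block_integrable[OF f[OF that] w] unfolding set_integrable_def .
  have "block (\<lambda>x. \<Sum>i\<in>I. c i * f i x) T h \<omega> = (\<integral>t. (\<Sum>i\<in>I. c i * ?g i t) \<partial>lborel)"
    unfolding block_def set_lebesgue_integral_def
    by (intro Bochner_Integration.integral_cong) (auto simp: sum_distrib_left algebra_simps)
  also have "\<dots> = (\<Sum>i\<in>I. \<integral>t. c i * ?g i t \<partial>lborel)"
    using int by (intro Bochner_Integration.integral_sum) (auto intro!: integrable_mult_right)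
  also have "\<dots> = (\<Sum>i\<in>I. c i * block (f i) T h \<omega>)"
    unfolding block_def set_lebesgue_integral_def by simp
  finally show ?thesis .
qed

end

section \<open>Logarithmic moment generating functions\<close>

context prob_space
begin

lemma integrable_bounded:
  fixes X :: "'a \<Rightarrow> real"
  assumes "X \<in> borel_measurable M" "\<And>\<omega>. \<omega> \<in> space M \<Longrightarrow> \<bar>X \<omega>\<bar> \<le> c"
  shows "integrable M X"
  by (rule integrable_const_bound[where B=c]) (use assms in auto)

lemma expectation_exp_pos:
  fixes X :: "'a \<Rightarrow> real"
  assumes [measurable]: "X \<in> borel_measurable M" and bd: "\<And>\<omega>. \<omega> \<in> space M \<Longrightarrow> \<bar>X \<omega>\<bar> \<le> c"
  shows "0 < expectation (\<lambda>\<omega>. exp (X \<omega>))"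
proof -
  have "exp (-c) = expectation (\<lambda>_. exp (-c))" by (simp add: prob_space)
  also have "\<dots> \<le> expectation (\<lambda>\<omega>. exp (X \<omega>))"
  proof (intro integral_mono)
    show "integrable M (\<lambda>\<omega>. exp (X \<omega>))"
      by (rule integrable_bounded[where c="exp c"]) (use bd in \<open>auto simp: abs_le_iff\<close>)
  qed (use bd in \<open>auto simp: abs_le_iff minus_le_iff\<close>)
  finally show ?thesis by (meson exp_gt_zero less_le_trans)
qed

lemma ln_expectation_exp_mono:
  fixes X Y :: "'a \<Rightarrow> real"
  assumes [measurable]: "X \<in> borel_measurable M" "Y \<in> borel_measurable M"
    and bd: "\<And>\<omega>. \<omega> \<in> space M \<Longrightarrow> \<bar>X \<omega>\<bar> \<le> a" "\<And>\<omega>. \<omega> \<in> space M \<Longrightarrow> \<bar>Y \<omega>\<bar> \<le> b"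
    and le: "\<And>\<omega>. \<omega> \<in> space M \<Longrightarrow> X \<omega> \<le> Y \<omega> + c"
  shows "ln (expectation (\<lambda>\<omega>. exp (X \<omega>))) \<le> ln (expectation (\<lambda>\<omega>. exp (Y \<omega>))) + c"
proof -
  have int: "integrable M (\<lambda>\<omega>. exp (X \<omega>))" "integrable M (\<lambda>\<omega>. exp (Y \<omega>))"
    by (rule integrable_bounded[where c="exp a"], use bd in \<open>auto simp: abs_le_iff\<close>)
      (rule integrable_bounded[where c="exp b"], use bd in \<open>auto simp: abs_le_iff\<close>)
  have "expectation (\<lambda>\<omega>. exp (X \<omega>)) \<le> expectation (\<lambda>\<omega>. exp c * exp (Y \<omega>))"
  proof (intro integral_mono)
    show "exp (X \<omega>) \<le> exp c * exp (Y \<omega>)" if "\<omega> \<in> space M" for \<omega>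
      using le[OF that] by (simp add: add.commute flip: exp_add)
  qed (use int in auto)
  then have "expectation (\<lambda>\<omega>. exp (X \<omega>)) \<le> exp c * expectation (\<lambda>\<omega>. exp (Y \<omega>))" by simp
  then have "ln (expectation (\<lambda>\<omega>. exp (X \<omega>))) \<le> ln (exp c * expectation (\<lambda>\<omega>. exp (Y \<omega>)))"
    using expectation_exp_pos[of X a] bd by (intro ln_mono) auto
  also have "\<dots> = ln (expectation (\<lambda>\<omega>. exp (Y \<omega>))) + c"
    using expectation_exp_pos[of Y b] bd by (subst ln_mult) auto
  finally show ?thesis .
qed

text \<open>A uniform error in the exponent becomes an additive error of the same size after the
  logarithm. This is how gaps and remainders between blocks are discarded.\<close>

lemma ln_expectation_exp_diff:
  fixes X Y :: "'a \<Rightarrow> real"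
  assumes [measurable]: "X \<in> borel_measurable M" "Y \<in> borel_measurable M"
    and bd: "\<And>\<omega>. \<omega> \<in> space M \<Longrightarrow> \<bar>X \<omega>\<bar> \<le> a" "\<And>\<omega>. \<omega> \<in> space M \<Longrightarrow> \<bar>Y \<omega>\<bar> \<le> b"
    and le: "\<And>\<omega>. \<omega> \<in> space M \<Longrightarrow> \<bar>X \<omega> - Y \<omega>\<bar> \<le> c"
  shows "\<bar>ln (expectation (\<lambda>\<omega>. exp (X \<omega>))) - ln (expectation (\<lambda>\<omega>. exp (Y \<omega>)))\<bar> \<le> c"
proof -
  have "X \<omega> \<le> Y \<omega> + c" "Y \<omega> \<le> X \<omega> + c" if "\<omega> \<in> space M" for \<omega>
    using le[OF that] by linarith+
  then show ?thesis
    using ln_expectation_exp_mono[of X Y a b c, OF assms(1,2) bd(1) bd(2)]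
      ln_expectation_exp_mono[of Y X b a c, OF assms(2,1) bd(2) bd(1)]
    by (simp add: abs_le_iff)
qed

end

text \<open>Both axioms concern pairs of block integrals, since in the change of measure one
  function builds the density while the other is averaged. The number \<open>r\<close> is the length
  of the gap that separates consecutive blocks.\<close>

locale dependent_process = block_process +
  assumes independent_blocks:
      "bounded_by B f \<Longrightarrow> bounded_by B g \<Longrightarrow>
        indep_vars (\<lambda>_. borel) (\<lambda>k \<omega>. (block f (real T) (real (k * (T + r))) \<omega>,
          block g (real T) (real (k * (T + r))) \<omega>)) {..<n::nat}"
    and stationary_blocks:
      "bounded_by B f \<Longrightarrow> bounded_by B g \<Longrightarrow>
        distr M borel (\<lambda>\<omega>. (block f (real T) (real (k * (T + r))) \<omega>,
          block g (real T) (real (k * (T + r))) \<omega>)) =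
        distr M borel (\<lambda>\<omega>. (block f (real T) 0 \<omega>, block g (real T) 0 \<omega>))"
begin

text \<open>The functions \<open>h k\<close> may vary with the block, so that products in which one
  or two chosen blocks carry an additional factor are covered; the second moment below is computed
  from such products.\<close>

lemma expectation_prod_blocks:
  fixes h :: "nat \<Rightarrow> real \<times> real \<Rightarrow> real"
  assumes f: "bounded_by B f" and g: "bounded_by B g"
    and [measurable]: "\<And>k. h k \<in> borel_measurable (borel :: (real \<times> real) measure)"
    and bd: "\<And>k x y. \<bar>x\<bar> \<le> B * T \<Longrightarrow> \<bar>y\<bar> \<le> B * T \<Longrightarrow> \<bar>h k (x, y)\<bar> \<le> C"
  shows "expectation (\<lambda>\<omega>. \<Prod>k<n. h k (block f (real T) (real (k * (T + r))) \<omega>,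
            block g (real T) (real (k * (T + r))) \<omega>)) =
         (\<Prod>k<n. expectation (\<lambda>\<omega>. h k (block f (real T) 0 \<omega>, block g (real T) 0 \<omega>)))"
    (is "expectation (\<lambda>\<omega>. \<Prod>k<n. h k (?P k \<omega>)) = _")
    and "integrable M (\<lambda>\<omega>. \<Prod>k<n. h k (block f (real T) (real (k * (T + r))) \<omega>,
            block g (real T) (real (k * (T + r))) \<omega>))"
proof -
  note [measurable] = block_measurable[OF bounded_byD(1)[OF f]] block_measurable[OF bounded_byD(1)[OF g]]
  have [measurable]: "(\<lambda>\<omega>. (block f a b \<omega>, block g a b \<omega>)) \<in> measurable M borel" for a b
    unfolding borel_prod[symmetric] by measurable
  have ind: "indep_vars (\<lambda>_. borel) (\<lambda>k \<omega>. h k (?P k \<omega>)) {..<n}"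
    by (rule indep_vars_compose2[OF independent_blocks[OF f g]]) simp
  have int: "integrable M (\<lambda>\<omega>. h k (?P k \<omega>))" for k
    by (rule integrable_bounded[where c=C]) (auto intro!: bd abs_block_le[OF f] abs_block_le[OF g])
  show "integrable M (\<lambda>\<omega>. \<Prod>k<n. h k (?P k \<omega>))"
    by (rule indep_vars_integrable[OF _ ind int]) simp
  have eq: "expectation (\<lambda>\<omega>. h k (?P k \<omega>)) =
      expectation (\<lambda>\<omega>. h k (block f (real T) 0 \<omega>, block g (real T) 0 \<omega>))" for k
  proof -
    have "expectation (\<lambda>\<omega>. h k (?P k \<omega>)) = integral\<^sup>L (distr M borel (?P k)) (h k)"
      by (subst integral_distr) auto
    also have "\<dots> = expectation (\<lambda>\<omega>. h k (block f (real T) 0 \<omega>, block g (real T) 0 \<omega>))"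
      unfolding stationary_blocks[OF f g]
      by (subst integral_distr) auto
    finally show ?thesis .
  qed
  have "expectation (\<lambda>\<omega>. \<Prod>k<n. h k (?P k \<omega>)) = (\<Prod>k<n. expectation (\<lambda>\<omega>. h k (?P k \<omega>)))"
    by (rule indep_vars_lebesgue_integral[OF _ ind int]) simp
  then show "expectation (\<lambda>\<omega>. \<Prod>k<n. h k (?P k \<omega>)) =
      (\<Prod>k<n. expectation (\<lambda>\<omega>. h k (block f (real T) 0 \<omega>, block g (real T) 0 \<omega>)))"
    by (simp only: eq)
qed

lemma block_multiple:
  assumes f: "bounded_by B f" and w: "\<omega> \<in> space M"
  shows "block f (real (n * (T + r))) 0 \<omega> =
    (\<Sum>k<n. block f (real T) (real (k * (T + r))) \<omega> + block f (real r) (real (k * (T + r) + T)) \<omega>)"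
proof (induction n)
  case (Suc n)
  have "block f (real (Suc n * (T + r))) 0 \<omega> = block f (real (n * (T + r)) + (real T + real r)) 0 \<omega>"
    by (simp add: algebra_simps)
  also have "\<dots> = block f (real (n * (T + r))) 0 \<omega> + block f (real T + real r) (real (n * (T + r))) \<omega>"
    by (subst block_split[OF f w]) auto
  also have "block f (real T + real r) (real (n * (T + r))) \<omega> =
      block f (real T) (real (n * (T + r))) \<omega> + block f (real r) (real (n * (T + r) + T)) \<omega>"
    by (subst block_split[OF f w]) auto
  finally show ?case using Suc by simp
qed simp

definition log_mgf :: "(real \<Rightarrow> real) \<Rightarrow> real \<Rightarrow> real" where
  "log_mgf f T = ln (expectation (\<lambda>\<omega>. exp (block f T 0 \<omega>)))"

lemma scaled_log_mgf_eq: "scaled_log_mgf M Z f T = log_mgf f T / T"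
  by (simp add: scaled_log_mgf_def log_mgf_def block_def)

lemma abs_log_mgf_le:
  assumes f: "bounded_by B f" and "0 \<le> T"
  shows "\<bar>log_mgf f T\<bar> \<le> B * T"
  using ln_expectation_exp_diff[of "block f T 0" "\<lambda>_. 0" "B * T" 0 "B * T"]
    block_measurable[OF bounded_byD(1)[OF f]] abs_block_le[OF f _ assms(2)]
  by (simp add: log_mgf_def prob_space)

lemma log_mgf_add:
  assumes f: "bounded_by B f" and "0 \<le> T" "0 \<le> U"
  shows "\<bar>log_mgf f (T + U) - log_mgf f T\<bar> \<le> B * U"
  unfolding log_mgf_def
proof (rule ln_expectation_exp_diff[of _ _ "B * (T + U)" "B * T"])
  show "\<bar>block f (T + U) 0 \<omega> - block f T 0 \<omega>\<bar> \<le> B * U" if "\<omega> \<in> space M" for \<omega>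
    using abs_block_le[OF f that \<open>0 \<le> U\<close>, of T] block_split[OF f that, of T U 0] assms by simp
qed (use assms in \<open>auto intro!: block_measurable bounded_byD(1)[OF f] abs_block_le[OF f]\<close>)

lemma expectation_exp_blocks:
  assumes f: "bounded_by B f"
  shows "ln (expectation (\<lambda>\<omega>. exp (\<Sum>k<n. block f (real T) (real (k * (T + r))) \<omega>))) = real n * log_mgf f (real T)"
proof -
  have "expectation (\<lambda>\<omega>. exp (\<Sum>k<n. block f (real T) (real (k * (T + r))) \<omega>)) =
      (\<Prod>k<n. expectation (\<lambda>\<omega>. exp (block f (real T) 0 \<omega>)))"
    using expectation_prod_blocks(1)[OF f f, of "\<lambda>_ p. exp (fst p)" T "exp (B * real T)" n]
    by (simp add: exp_sum borel_prod[symmetric])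
  then show ?thesis
    using expectation_exp_pos[OF block_measurable[OF bounded_byD(1)[OF f]] abs_block_le[OF f]]
    by (simp add: log_mgf_def ln_realpow)
qed

text \<open>The factor 2 counts the gaps twice: once when they are removed from the stretch of
  length \<open>n * \<tau>\<close>, and once when the full period \<tau> is put back in place of the
  block of length \<open>\<tau> - r\<close>.\<close>

lemma log_mgf_multiple:
  assumes f: "bounded_by B f" and \<tau>: "r \<le> \<tau>"
  shows "\<bar>log_mgf f (real (n * \<tau>)) - real n * log_mgf f (real \<tau>)\<bar> \<le> 2 * real n * real r * B"
proof -
  define T where "T = \<tau> - r"
  have \<tau>_eq: "\<tau> = T + r" using \<tau> by (simp add: T_def)
  let ?S = "\<lambda>\<omega>. \<Sum>k<n. block f (real T) (real (k * (T + r))) \<omega>"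
  have [measurable]: "block f a h \<in> borel_measurable M" for a h
    by (rule block_measurable[OF bounded_byD(1)[OF f]])
  have sum_bd: "\<bar>\<Sum>k<n. block f (real a) (real (c k)) \<omega>\<bar> \<le> real n * (B * real a)" if "\<omega> \<in> space M" for a c \<omega>
    by (rule order_trans[OF sum_abs], rule order_trans[OF sum_mono[where g="\<lambda>_. B * real a"]])
      (auto intro!: abs_block_le[OF f that])
  have "\<bar>log_mgf f (real (n * (T + r))) - ln (expectation (\<lambda>\<omega>. exp (?S \<omega>)))\<bar> \<le> real n * (B * real r)"
    unfolding log_mgf_def
  proof (rule ln_expectation_exp_diff[where a="B * real (n * (T + r))" and b="real n * (B * real T)"])
    fix \<omega> assume w: "\<omega> \<in> space M"
    show "\<bar>block f (real (n * (T + r))) 0 \<omega> - ?S \<omega>\<bar> \<le> real n * (B * real r)"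
      using sum_bd[OF w, of r "\<lambda>k. k * (T + r) + T"]
      unfolding block_multiple[OF f w] sum.distrib by simp
  qed (auto intro!: abs_block_le[OF f] sum_bd simp del: of_nat_mult of_nat_add)
  then have "\<bar>log_mgf f (real (n * \<tau>)) - real n * log_mgf f (real T)\<bar> \<le> real n * (B * real r)"
    unfolding expectation_exp_blocks[OF f] \<tau>_eq .
  moreover have "\<bar>real n * log_mgf f (real \<tau>) - real n * log_mgf f (real T)\<bar> \<le> real n * (B * real r)"
    using log_mgf_add[OF f, of "real T" "real r"]
    by (simp add: \<tau>_eq abs_mult mult_left_mono flip: right_diff_distrib)
  ultimately show ?thesis by (simp add: abs_le_iff algebra_simps)
qed

text \<open>Normalised values at \<tau> and \<sigma> are both close to the value at their product,
  which gives a Cauchy sequence with rate \<open>K / \<tau>\<close>. In the final constant,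
  \<open>2 * real r\<close> comes from \<open>K\<close>; rounding \<open>T\<close> up to an integer
  above \<open>r\<close> changes the length by at most \<open>r + 2\<close>, and this is paid once
  for \<open>log_mgf\<close> and once for the linear term, which gives
  \<open>2 * (real r + 2)\<close>.\<close>

lemma log_mgf_asymptotics:
  assumes f: "bounded_by B f"
  shows "\<exists>l. \<bar>l\<bar> \<le> B \<and> (\<forall>T\<ge>0. \<bar>log_mgf f T - T * l\<bar> \<le> (4 * real r + 4) * B)"
proof -
  define b where "b n = log_mgf f (real n) / real n" for n :: nat
  define K where "K = 2 * real r * B"
  have B: "0 \<le> B" by (rule bounded_byD(3)[OF f])
  have K: "0 \<le> K" using B by (simp add: K_def)
  have mult: "\<bar>b (n * \<tau>) - b \<tau>\<bar> \<le> K / real \<tau>" if "Suc r \<le> \<tau>" "1 \<le> n" for n \<tau>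
  proof -
    have "b (n * \<tau>) - b \<tau> = (log_mgf f (real (n * \<tau>)) - real n * log_mgf f (real \<tau>)) / (real n * real \<tau>)"
      using that by (simp add: b_def field_simps)
    then have "\<bar>b (n * \<tau>) - b \<tau>\<bar> = \<bar>log_mgf f (real (n * \<tau>)) - real n * log_mgf f (real \<tau>)\<bar> / (real n * real \<tau>)"
      by simp
    also have "\<dots> \<le> (2 * real n * real r * B) / (real n * real \<tau>)"
      by (rule divide_right_mono[OF log_mgf_multiple[OF f]]) (use that in auto)
    also have "\<dots> = K / real \<tau>" using that by (simp add: K_def)
    finally show ?thesis .
  qed
  have diff: "\<bar>b \<tau> - b \<sigma>\<bar> \<le> K / real \<tau> + K / real \<sigma>" if "Suc r \<le> \<tau>" "Suc r \<le> \<sigma>" for \<tau> \<sigma>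
    using mult[of \<tau> \<sigma>] mult[of \<sigma> \<tau>] that by (simp add: mult.commute abs_le_iff)
  have "Cauchy b"
  proof (rule metric_CauchyI)
    fix e :: real assume e: "0 < e"
    obtain N where N: "2 * K / e < real N" using reals_Archimedean2 by blast
    define n0 where "n0 = max N (Suc r)"
    have "dist (b \<tau>) (b \<sigma>) < e" if "n0 \<le> \<tau>" "n0 \<le> \<sigma>" for \<tau> \<sigma>
    proof -
      have small: "K / real m < e / 2" if "n0 \<le> m" for m
      proof -
        have "2 * K / e < real m" "0 < real m" using N that by (auto simp: n0_def)
        then show ?thesis using e by (simp add: field_simps)
      qed
      moreover have "\<bar>b \<tau> - b \<sigma>\<bar> \<le> K / real \<tau> + K / real \<sigma>"
        by (rule diff) (use that in \<open>simp_all add: n0_def\<close>)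
      ultimately show ?thesis
        using small[OF that(1)] small[OF that(2)] unfolding dist_real_def by linarith
    qed
    then show "\<exists>n0. \<forall>m\<ge>n0. \<forall>n\<ge>n0. dist (b m) (b n) < e" by blast
  qed
  then obtain l where l: "b \<longlonglongrightarrow> l" by (auto simp: Cauchy_convergent_iff convergent_def)
  have lim: "\<bar>b \<tau> - l\<bar> \<le> K / real \<tau>" if "Suc r \<le> \<tau>" for \<tau>
  proof (rule LIMSEQ_le)
    show "(\<lambda>\<sigma>. \<bar>b \<tau> - b \<sigma>\<bar>) \<longlonglongrightarrow> \<bar>b \<tau> - l\<bar>" by (intro tendsto_intros l)
    have "(\<lambda>\<sigma>. K / real \<sigma>) \<longlonglongrightarrow> 0" by (rule lim_const_over_n)
    then show "(\<lambda>\<sigma>. K / real \<tau> + K / real \<sigma>) \<longlonglongrightarrow> K / real \<tau>"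
      by (auto intro: tendsto_eq_intros)
    show "\<exists>N. \<forall>n\<ge>N. \<bar>b \<tau> - b n\<bar> \<le> K / real \<tau> + K / real n" using diff[OF that] by blast
  qed
  have "\<bar>b n\<bar> \<le> B" for n
    using abs_log_mgf_le[OF f, of "real n"] B by (cases "n = 0") (auto simp: b_def field_simps)
  then have l_le: "\<bar>l\<bar> \<le> B"
    by (intro LIMSEQ_le_const2[OF tendsto_rabs[OF l]]) auto
  moreover have "\<bar>log_mgf f T - T * l\<bar> \<le> (4 * real r + 4) * B" if T: "0 \<le> T" for T
  proof -
    \<comment> \<open>The added \<open>Suc r\<close> puts \<tau> into the range where the rate
      \<open>lim\<close> applies, at the cost of a rounding error \<open>U\<close> that is bounded
      independently of \<open>T\<close>.\<close>
    define \<tau> where "\<tau> = nat \<lceil>T\<rceil> + Suc r"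
    define U where "U = real \<tau> - T"
    have U: "0 \<le> U" "U \<le> real r + 2" "real \<tau> = T + U"
      unfolding U_def \<tau>_def using T by linarith+
    have \<tau>: "Suc r \<le> \<tau>" by (simp add: \<tau>_def)
    have "\<bar>log_mgf f (real \<tau>) - real \<tau> * l\<bar> = real \<tau> * \<bar>b \<tau> - l\<bar>"
    proof -
      have "log_mgf f (real \<tau>) - real \<tau> * l = real \<tau> * (b \<tau> - l)"
        using \<tau> by (simp add: b_def field_simps)
      then show ?thesis by (simp add: abs_mult)
    qed
    also have "\<dots> \<le> real \<tau> * (K / real \<tau>)" by (intro mult_left_mono lim \<tau>) simp
    also have "\<dots> = K" using \<tau> by simp
    finally have 1: "\<bar>log_mgf f (T + U) - (T + U) * l\<bar> \<le> K" by (simp add: U)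
    have 2: "\<bar>log_mgf f (T + U) - log_mgf f T\<bar> \<le> B * U" by (rule log_mgf_add[OF f T U(1)])
    have 3: "\<bar>U * l\<bar> \<le> U * B" using l_le U by (simp add: abs_mult mult_left_mono)
    have 4: "U * B \<le> (real r + 2) * B" using U B by (intro mult_right_mono) auto
    show ?thesis using 1 2 3 4 by (simp add: K_def abs_le_iff algebra_simps)
  qed
  ultimately show ?thesis by blast
qed

text \<open>The second part is the quantitative form on which the estimates below rest: the error
  stays bounded as \<open>T\<close> grows and is linear in the bound of \<open>f\<close>.\<close>

lemma tendsto_scaled_log_mgf:
  assumes f: "bounded_by B f"
  shows "(scaled_log_mgf M Z f \<longlongrightarrow> Lambda M Z f) at_top"
    and abs_log_mgf_Lambda: "0 \<le> T \<Longrightarrow> \<bar>log_mgf f T - T * Lambda M Z f\<bar> \<le> (4 * real r + 4) * B"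
proof -
  obtain l where l: "\<forall>T\<ge>0. \<bar>log_mgf f T - T * l\<bar> \<le> (4 * real r + 4) * B"
    using log_mgf_asymptotics[OF f] by blast
  have lim: "(scaled_log_mgf M Z f \<longlongrightarrow> l) at_top"
  proof (rule Lim_transform_eventually[OF _ ])
    show "((\<lambda>T. l + (log_mgf f T - T * l) / T) \<longlongrightarrow> l) at_top"
    proof (rule tendsto_eq_intros)
      show "((\<lambda>T. (log_mgf f T - T * l) / T) \<longlongrightarrow> 0) at_top"
      proof (rule Lim_null_comparison)
        show "\<forall>\<^sub>F T in at_top. norm ((log_mgf f T - T * l) / T) \<le> (4 * real r + 4) * B / T"
          using eventually_gt_at_top[of 0] by eventually_elim (use l in \<open>auto intro!: divide_right_mono\<close>)
        show "((\<lambda>T. (4 * real r + 4) * B / T) \<longlongrightarrow> 0) at_top"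
          by (intro tendsto_divide_0[OF tendsto_const] filterlim_at_top_imp_at_infinity filterlim_ident)
      qed
    qed auto
    show "\<forall>\<^sub>F T in at_top. l + (log_mgf f T - T * l) / T = scaled_log_mgf M Z f T"
      using eventually_gt_at_top[of 0] by eventually_elim (simp add: scaled_log_mgf_eq field_simps)
  qed
  then have "Lambda M Z f = l"
    unfolding Lambda_def by (intro tendsto_Lim) auto
  with l lim show "(scaled_log_mgf M Z f \<longlongrightarrow> Lambda M Z f) at_top"
    "0 \<le> T \<Longrightarrow> \<bar>log_mgf f T - T * Lambda M Z f\<bar> \<le> (4 * real r + 4) * B" by auto
qed

end

section \<open>Continuous approximation in mean\<close>

lemma integrable_bounded_by:
  assumes "finite_measure \<mu>" "sets \<mu> = sets borel" "bounded_by B f"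
  shows "integrable \<mu> f"
proof -
  interpret finite_measure \<mu> by fact
  show ?thesis
    by (rule integrable_const_bound[where B=B])
      (use assms(2) bounded_byD[OF assms(3)] in \<open>auto simp: measurable_cong_sets[OF assms(2) refl]\<close>)
qed

lemma bounded_by_indicator:
  "A \<in> sets borel \<Longrightarrow> bounded_by \<bar>c\<bar> (\<lambda>x. c * indicator A x)"
  by (auto simp: bounded_by_def split: split_indicator)

lemma bounded_by_diff:
  assumes "bounded_by B f" "bounded_by C g"
  shows "bounded_by (B + C) (\<lambda>x. \<bar>f x - g x\<bar>)"
  using assms unfolding bounded_by_def by (auto intro!: order_trans[OF abs_triangle_ineq4] add_mono)

text \<open>Regularity squeezes \<open>A\<close> between a compact set \<open>K\<close> and an open
  set \<open>U\<close> whose difference has small mass. A Urysohn function for the pair differs from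
  the indicator of \<open>A\<close> only on \<open>U - K\<close>, and there by at most one.\<close>

lemma L1_continuous_approx_indicator:
  fixes \<rho> :: "real measure"
  assumes fin: "finite_measure \<rho>" and [measurable_cong, simp]: "sets \<rho> = sets borel" and A: "A \<in> sets borel" and d: "0 < (d :: real)"
  obtains g :: "real \<Rightarrow> real" where "continuous_on UNIV g" "bounded_by 1 g" "(\<integral>x. \<bar>indicator A x - g x\<bar> \<partial>\<rho>) < d"
proof -
  interpret finite_measure \<rho> by fact
  have fin': "emeasure \<rho> (space \<rho>) \<noteq> \<infinity>" by simp
  have "emeasure \<rho> A < emeasure \<rho> A + ennreal (d / 2)"
    using d by (simp add: emeasure_eq_measure ennreal_plus[symmetric] ennreal_less_iff del: ennreal_plus)
  then have "(INF U\<in>{U. A \<subseteq> U \<and> open U}. emeasure \<rho> U) < emeasure \<rho> A + ennreal (d / 2)"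
    using outer_regular[of \<rho>, OF _ fin' A] by simp
  then obtain U where U: "A \<subseteq> U" "open U" "emeasure \<rho> U < emeasure \<rho> A + ennreal (d / 2)"
    unfolding INF_less_iff by auto
  \<comment> \<open>Inner regularity is applied at the level
    \<open>measure \<rho> A - d / 2\<close>. When this is negative, the empty set serves, and
    truncation at zero in \<open>ennreal\<close> is avoided.\<close>
  obtain K where K: "K \<subseteq> A" "compact K" "emeasure \<rho> A < emeasure \<rho> K + ennreal (d / 2)"
  proof (cases "measure \<rho> A < d / 2")
    case True
    then show ?thesis
      by (intro that[of "{}"]) (auto simp: emeasure_eq_measure ennreal_less_iff)
  next
    case False
    have "ennreal (measure \<rho> A - d / 2) < emeasure \<rho> A"
      using d False by (simp add: emeasure_eq_measure ennreal_less_iff)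
    also have "\<dots> = (SUP K\<in>{K. K \<subseteq> A \<and> compact K}. emeasure \<rho> K)"
      by (rule inner_regular) (use A in simp_all)
    finally obtain K where K: "K \<subseteq> A" "compact K" "ennreal (measure \<rho> A - d / 2) < emeasure \<rho> K"
      unfolding less_SUP_iff by auto
    then show ?thesis using False d
      by (intro that[of K]) (auto simp: emeasure_eq_measure ennreal_less_iff ennreal_plus[symmetric] simp del: ennreal_plus)
  qed
  have [measurable]: "U \<in> sets borel" "K \<in> sets borel"
    using U K by (auto intro: borel_compact borel_open)
  have UK: "measure \<rho> (U - K) < d"
  proof -
    have "measure \<rho> U < measure \<rho> A + d / 2" "measure \<rho> A < measure \<rho> K + d / 2"
      using U(3) K(3) d by (auto simp: emeasure_eq_measure ennreal_less_iff ennreal_plus[symmetric] simp del: ennreal_plus)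
    then show ?thesis
      using U K by (subst finite_measure_Diff) auto
  qed
  have cl: "closed K" "closed (- U)" "K \<inter> - U = {}"
    using U K by (auto intro: compact_imp_closed)
  obtain g :: "real \<Rightarrow> real" where g: "continuous_on UNIV g" "\<And>x. g x \<in> closed_segment 1 0"
    "\<And>x. x \<in> K \<Longrightarrow> g x = 1" "\<And>x. x \<in> - U \<Longrightarrow> g x = 0"
    using Urysohn[OF cl, where a="1::real" and b="0::real"] by metis
  have g01: "0 \<le> g x" "g x \<le> 1" for x using g(2)[of x] by (auto simp: closed_segment_eq_real_ivl)
  have [measurable]: "g \<in> borel_measurable borel" by (rule borel_measurable_continuous_onI[OF g(1)])
  have bd: "\<bar>indicator A x - g x\<bar> \<le> 1" for x
    using g01[of x] by (auto split: split_indicator)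
  have "(\<integral>x. \<bar>indicator A x - g x\<bar> \<partial>\<rho>) \<le> (\<integral>x. indicator (U - K) x \<partial>\<rho>)"
  proof (rule integral_mono)
    show "integrable \<rho> (\<lambda>x. \<bar>indicator A x - g x\<bar>)"
      using A by (intro integrable_const_bound[where B=1] AE_I2) (simp_all add: bd)
    show "integrable \<rho> (\<lambda>x. indicat_real (U - K) x)"
      by (rule integrable_const_bound[where B=1]) (auto split: split_indicator)
    show "\<bar>indicator A x - g x\<bar> \<le> indicator (U - K) x" for x
      using g01[of x] g(3,4)[of x] U(1) K(1) by (auto split: split_indicator)
  qed
  also have "\<dots> = measure \<rho> (U - K)" by simp
  finally have "(\<integral>x. \<bar>indicator A x - g x\<bar> \<partial>\<rho>) < d" using UK by simp
  then show ?thesis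
    using g01 by (intro that[OF g(1)]) (auto simp: bounded_by_def abs_le_iff intro: order_trans[OF _ g01(1)])
qed

lemma L1_continuous_approx:
  fixes \<rho> :: "real measure"
  assumes fin: "finite_measure \<rho>" and sets_eq [measurable_cong, simp]: "sets \<rho> = sets borel" and f: "bounded_by B f" and d: "0 < d"
  obtains g where "continuous_on UNIV g" "bounded_by B g" "(\<integral>x. \<bar>f x - g x\<bar> \<partial>\<rho>) < d"
proof -
  interpret finite_measure \<rho> by fact
  define P where "P f \<longleftrightarrow> (\<forall>d>0. \<exists>g. continuous_on UNIV g \<and> (\<exists>C. bounded_by C g) \<and> (\<integral>x. \<bar>f x - g x\<bar> \<partial>\<rho>) < d)"
    for f :: "real \<Rightarrow> real"
  have cint: "integrable \<rho> g" if "bounded_by C g" for C g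
    by (rule integrable_bounded_by[OF fin sets_eq that])
  have "integrable \<rho> f" by (rule cint[OF f])
  then have "P f"
  proof (induction rule: integrable_induct)
    case (base A c)
    show ?case unfolding P_def
    proof (intro allI impI)
      fix d :: real assume d: "0 < d"
      obtain g where g: "continuous_on UNIV g" "bounded_by 1 g" "(\<integral>x. \<bar>indicator A x - g x\<bar> \<partial>\<rho>) < d / (\<bar>c\<bar> + 1)"
        using L1_continuous_approx_indicator[OF fin sets_eq, of A "d / (\<bar>c\<bar> + 1)"] base d by auto
      have "(\<integral>x. \<bar>indicator A x *\<^sub>R c - c * g x\<bar> \<partial>\<rho>) = (\<integral>x. \<bar>c\<bar> * \<bar>indicator A x - g x\<bar> \<partial>\<rho>)"
        by (intro Bochner_Integration.integral_cong) (auto simp: abs_mult[symmetric] algebra_simps)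
      also have "\<dots> = \<bar>c\<bar> * (\<integral>x. \<bar>indicator A x - g x\<bar> \<partial>\<rho>)" by simp
      also have "\<dots> \<le> \<bar>c\<bar> * (d / (\<bar>c\<bar> + 1))" using g(3) by (intro mult_left_mono) auto
      also have "\<dots> < d" using d by (simp add: field_simps)
      finally show "\<exists>g. continuous_on UNIV g \<and> (\<exists>C. bounded_by C g) \<and> (\<integral>x. \<bar>indicator A x *\<^sub>R c - g x\<bar> \<partial>\<rho>) < d"
        using g by (intro exI[of _ "\<lambda>x. c * g x"] conjI exI[of _ "\<bar>c\<bar>"] continuous_intros)
          (auto simp: bounded_by_def abs_mult mult_left_le)
    qed
  next
    case (add f1 f2)
    show ?case unfolding P_def
    proof (intro allI impI)
      fix d :: real assume d: "0 < d"
      obtain g1 C1 where g1: "continuous_on UNIV g1" "bounded_by C1 g1" "(\<integral>x. \<bar>f1 x - g1 x\<bar> \<partial>\<rho>) < d / 2"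
        using add.IH(1) d unfolding P_def by (meson half_gt_zero)
      obtain g2 C2 where g2: "continuous_on UNIV g2" "bounded_by C2 g2" "(\<integral>x. \<bar>f2 x - g2 x\<bar> \<partial>\<rho>) < d / 2"
        using add.IH(2) d unfolding P_def by (meson half_gt_zero)
      note int = add.hyps(1,2) cint[OF g1(2)] cint[OF g2(2)]
      have "(\<integral>x. \<bar>(f1 x + f2 x) - (g1 x + g2 x)\<bar> \<partial>\<rho>) \<le> (\<integral>x. \<bar>f1 x - g1 x\<bar> + \<bar>f2 x - g2 x\<bar> \<partial>\<rho>)"
        using int by (intro integral_mono) auto
      also have "\<dots> = (\<integral>x. \<bar>f1 x - g1 x\<bar> \<partial>\<rho>) + (\<integral>x. \<bar>f2 x - g2 x\<bar> \<partial>\<rho>)"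
        using int by (intro Bochner_Integration.integral_add) auto
      also have "\<dots> < d" using g1(3) g2(3) by simp
      finally show "\<exists>g. continuous_on UNIV g \<and> (\<exists>C. bounded_by C g) \<and> (\<integral>x. \<bar>f1 x + f2 x - g x\<bar> \<partial>\<rho>) < d"
        using g1 g2 by (intro exI[of _ "\<lambda>x. g1 x + g2 x"] conjI exI[of _ "C1 + C2"] continuous_intros)
          (auto simp: bounded_by_def intro!: order_trans[OF abs_triangle_ineq] add_mono)
    qed
  next
    case (lim f s)
    show ?case unfolding P_def
    proof (intro allI impI)
      fix d :: real assume d: "0 < d"
      have [measurable]: "f \<in> borel_measurable \<rho>" "\<And>i. s i \<in> borel_measurable \<rho>"
        using lim.hyps(1,4) by auto
      have "(\<lambda>i. \<integral>x. \<bar>f x - s i x\<bar> \<partial>\<rho>) \<longlonglongrightarrow> (\<integral>x. 0 \<partial>\<rho>)"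
      proof (rule integral_dominated_convergence[where w="\<lambda>x. 3 * \<bar>f x\<bar>"])
        show "AE x in \<rho>. (\<lambda>i. \<bar>f x - s i x\<bar>) \<longlonglongrightarrow> 0"
        proof (rule AE_I2)
          fix x assume "x \<in> space \<rho>"
          then have "(\<lambda>i. \<bar>f x - s i x\<bar>) \<longlonglongrightarrow> \<bar>f x - f x\<bar>" by (intro tendsto_intros lim.hyps(2))
          then show "(\<lambda>i. \<bar>f x - s i x\<bar>) \<longlonglongrightarrow> 0" by simp
        qed
        show "AE x in \<rho>. norm \<bar>f x - s i x\<bar> \<le> 3 * \<bar>f x\<bar>" for i
        proof (rule AE_I2)
          fix x assume "x \<in> space \<rho>"
          then have "norm (s i x) \<le> 2 * norm (f x)" by (rule lim.hyps(3))
          then show "norm \<bar>f x - s i x\<bar> \<le> 3 * \<bar>f x\<bar>"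
            using abs_triangle_ineq4[of "f x" "s i x"] by simp
        qed
      qed (use lim.hyps(1,4) in auto)
      then have "eventually (\<lambda>i. (\<integral>x. \<bar>f x - s i x\<bar> \<partial>\<rho>) < d / 2) sequentially"
        using d by (intro order_tendstoD(2)) auto
      then obtain i where i: "(\<integral>x. \<bar>f x - s i x\<bar> \<partial>\<rho>) < d / 2"
        by (auto simp: eventually_sequentially)
      obtain g C where g: "continuous_on UNIV g" "bounded_by C g" "(\<integral>x. \<bar>s i x - g x\<bar> \<partial>\<rho>) < d / 2"
        using lim.IH[of i] d unfolding P_def by (meson half_gt_zero)
      note int = lim.hyps(1)[of i] lim.hyps(4) cint[OF g(2)]
      have "(\<integral>x. \<bar>f x - g x\<bar> \<partial>\<rho>) \<le> (\<integral>x. \<bar>f x - s i x\<bar> + \<bar>s i x - g x\<bar> \<partial>\<rho>)"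
        using int by (intro integral_mono) auto
      also have "\<dots> = (\<integral>x. \<bar>f x - s i x\<bar> \<partial>\<rho>) + (\<integral>x. \<bar>s i x - g x\<bar> \<partial>\<rho>)"
        using int by (intro Bochner_Integration.integral_add) auto
      also have "\<dots> < d" using i g(3) by simp
      finally show "\<exists>g. continuous_on UNIV g \<and> (\<exists>C. bounded_by C g) \<and> (\<integral>x. \<bar>f x - g x\<bar> \<partial>\<rho>) < d"
        using g by blast
    qed
  qed
  then obtain g C where g: "continuous_on UNIV g" "bounded_by C g" "(\<integral>x. \<bar>f x - g x\<bar> \<partial>\<rho>) < d"
    unfolding P_def using d by blast
  \<comment> \<open>The induction yields some bound \<open>C\<close> only. Clipping to
    \<open>[- B, B]\<close> brings \<open>g\<close> no farther from \<open>f\<close>, which already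
    lies there. The bound \<open>B\<close> must be kept because the modulus of continuity of
    \<open>Lambda\<close> in mean depends on it.\<close>
  let ?h = "\<lambda>x. max (- B) (min B (g x))"
  have h: "bounded_by B ?h"
    using bounded_byD[OF g(2)] bounded_byD(3)[OF f] by (auto simp: bounded_by_def)
  have "(\<integral>x. \<bar>f x - ?h x\<bar> \<partial>\<rho>) \<le> (\<integral>x. \<bar>f x - g x\<bar> \<partial>\<rho>)"
  proof (rule integral_mono)
    show "\<bar>f x - ?h x\<bar> \<le> \<bar>f x - g x\<bar>" for x using bounded_byD(2)[OF f, of x] by auto
  qed (use cint[OF f] cint[OF g(2)] cint[OF h] in auto)
  then show ?thesis using g by (intro that[OF _ h]) (auto intro!: continuous_intros)
qed

text \<open>Allows a single continuous function to approximate in mean under two measures at once.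
  The witness is the supremum of the two measures, whose mass is at most the sum of theirs.\<close>

lemma finite_measure_common_bound:
  assumes "finite_measure \<mu>" "finite_measure \<nu>" and sets_eq: "sets \<nu> = sets \<mu>"
  shows "\<exists>\<rho>. finite_measure \<rho> \<and> sets \<rho> = sets \<mu> \<and>
    (\<forall>h :: 'a \<Rightarrow> real. integrable \<rho> h \<longrightarrow> (\<forall>x. 0 \<le> h x) \<longrightarrow>
      integral\<^sup>L \<mu> h \<le> integral\<^sup>L \<rho> h \<and> integral\<^sup>L \<nu> h \<le> integral\<^sup>L \<rho> h)"
proof -
  interpret \<mu>: finite_measure \<mu> by fact
  interpret \<nu>: finite_measure \<nu> by fact
  let ?\<rho> = "sup_measure' \<mu> \<nu>"
  have sets': "sets ?\<rho> = sets \<mu>" "space ?\<rho> = space \<mu>" by (auto simp: sets_eq)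
  have "emeasure ?\<rho> (space ?\<rho>) \<le> emeasure \<mu> (space \<mu>) + emeasure \<nu> (space \<nu>)"
  proof -
    have "emeasure ?\<rho> (space \<mu>) = (SUP Y\<in>sets \<mu>. emeasure \<mu> (space \<mu> \<inter> Y) + emeasure \<nu> (space \<mu> \<inter> - Y))"
      by (rule emeasure_sup_measure'[OF sets_eq sets.top])
    also have "\<dots> \<le> emeasure \<mu> (space \<mu>) + emeasure \<nu> (space \<nu>)"
      by (intro SUP_least add_mono emeasure_space)
    finally show ?thesis unfolding sets'(2) .
  qed
  also have "\<dots> < \<infinity>" 
    by (simp add: \<mu>.emeasure_eq_measure \<nu>.emeasure_eq_measure flip: ennreal_plus)
  finally have fin: "finite_measure ?\<rho>" by (intro finite_measureI) auto
  have le: "integral\<^sup>L \<kappa> h \<le> integral\<^sup>L ?\<rho> h"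
    if s: "sets \<kappa> = sets ?\<rho>" and le: "\<kappa> \<le> ?\<rho>" and h: "integrable ?\<rho> h" "\<And>x. 0 \<le> h x" for \<kappa> and h :: "'a \<Rightarrow> real"
  proof -
    have m: "h \<in> borel_measurable ?\<rho>" "h \<in> borel_measurable \<kappa>"
      using h(1) measurable_cong_sets[OF s refl] by auto
    have "nn_integral \<kappa> (\<lambda>x. ennreal (h x)) \<le> nn_integral ?\<rho> (\<lambda>x. ennreal (h x))"
      by (rule nn_integral_mono_measure[OF s le])
    moreover have "nn_integral ?\<rho> (\<lambda>x. ennreal (h x)) < \<infinity>"
      using h by (simp add: integrable_iff_bounded)
    ultimately show ?thesis using m h(2)
      by (simp add: integral_eq_nn_integral enn2real_mono)
  qed
  have "\<mu> \<le> ?\<rho>" "\<nu> \<le> ?\<rho>"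
    unfolding le_measure[OF sets'(1)[symmetric]] le_measure[OF trans[OF sets_eq sets'(1)[symmetric]]]
    using le_emeasure_sup_measure'1[OF sets_eq] le_emeasure_sup_measure'2[OF sets_eq]
    by (simp_all only: sets_eq simp_thms ball_simps) blast+
  then have "integral\<^sup>L \<mu> h \<le> integral\<^sup>L ?\<rho> h \<and> integral\<^sup>L \<nu> h \<le> integral\<^sup>L ?\<rho> h"
    if "integrable ?\<rho> h" "\<forall>x. 0 \<le> h x" for h :: "'a \<Rightarrow> real"
    using le[of \<mu> h] le[of \<nu> h] that by (simp add: sets_eq)
  then show ?thesis using fin sets'(1) by (intro exI[of _ ?\<rho>]) simp
qed

lemma occupation_measure_measurable:
  assumes [measurable]: "(\<lambda>(t, x). Y t x) \<in> borel_measurable (borel \<Otimes>\<^sub>M N)"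
  shows "(\<lambda>x. occupation_measure (\<lambda>t. Y t x)) \<in> measurable N (prob_algebra borel)"
  unfolding occupation_measure_def
proof (rule measurable_distr_prob_space2[where f="\<lambda>x t. Y t x" and M="restrict_space borel {0..1}"])
  have "prob_space (restrict_space lborel {0..1::real})"
    by (intro prob_spaceI) (simp add: space_restrict_space emeasure_restrict_space)
  then show "(\<lambda>x. restrict_space lborel {0..1::real}) \<in> measurable N (prob_algebra (restrict_space borel {0..1}))"
    using sets_restrict_space_cong[OF sets_lborel, of "{0..1::real}"]
    by (intro measurable_const) (simp add: space_prob_algebra)
  have [measurable]: "(\<lambda>t. t) \<in> measurable (restrict_space borel {0..1}) (borel :: real measure)"
    by (rule measurable_restrict_space1) simp
  have "(\<lambda>p. (snd p, fst p)) \<in> measurable (N \<Otimes>\<^sub>M restrict_space borel {0..1::real}) (borel \<Otimes>\<^sub>M N)"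
    by measurable
  from measurable_compose[OF this assms]
  show "(\<lambda>(x, t). Y t x) \<in> borel_measurable (N \<Otimes>\<^sub>M restrict_space borel {0..1})"
    by (simp add: case_prod_unfold)
qed

section \<open>The tau-topology\<close>

definition bounded_measurable :: "(real \<Rightarrow> real) set" where
  "bounded_measurable = {f. \<exists>B. bounded_by B f}"

definition bound_of :: "(real \<Rightarrow> real) \<Rightarrow> real" where
  "bound_of f = (SOME B. bounded_by B f)"

lemma bounded_by_bound_of: "f \<in> bounded_measurable \<Longrightarrow> bounded_by (bound_of f) f"
  unfolding bounded_measurable_def bound_of_def by (auto intro: someI)

lemma bounded_measurable_indicator:
  "A \<in> sets borel \<Longrightarrow> (\<lambda>x. c * indicator A x) \<in> bounded_measurable"
  using bounded_by_indicator by (auto simp: bounded_measurable_def)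

abbreviation probs :: "real measure set" where
  "probs \<equiv> space (prob_algebra borel)"

lemma probsD:
  assumes "\<mu> \<in> probs"
  shows "prob_space \<mu>" "finite_measure \<mu>" "sets \<mu> = sets borel" "space \<mu> = UNIV"
proof -
  show *: "prob_space \<mu>" "sets \<mu> = sets borel" using assms by (auto simp: space_prob_algebra)
  interpret prob_space \<mu> by fact
  show "finite_measure \<mu>" by unfold_locales
  show "space \<mu> = UNIV" using sets_eq_imp_space_eq[OF *(2)] by simp
qed

lemma integrable_probs:
  assumes "\<mu> \<in> probs" "bounded_by B f"
  shows "integrable \<mu> f"
  using integrable_bounded_by[OF probsD(2,3)[OF assms(1)] assms(2)] .

lemma abs_integral_probs_le:
  assumes \<mu>: "\<mu> \<in> probs" and f: "bounded_by B f"
  shows "\<bar>\<integral>x. f x \<partial>\<mu>\<bar> \<le> B"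
proof -
  interpret prob_space \<mu> by (rule probsD(1)[OF \<mu>])
  have "\<bar>\<integral>x. f x \<partial>\<mu>\<bar> \<le> (\<integral>x. \<bar>f x\<bar> \<partial>\<mu>)" by (rule integral_abs_bound)
  also have "\<dots> \<le> (\<integral>x. B \<partial>\<mu>)"
    using integrable_probs[OF \<mu> f] bounded_byD(2)[OF f] by (intro integral_mono) auto
  finally show ?thesis by (simp add: prob_space)
qed

lemma integral_indicator_probs:
  assumes "\<mu> \<in> probs" "A \<in> sets borel"
  shows "(\<integral>x. indicator A x \<partial>\<mu>) = measure \<mu> A"
  using probsD[OF assms(1)] assms(2) by simp

lemma topspace_tau: "topspace tau_topology = probs"
proof -
  let ?B = "{{\<mu> \<in> probs. (\<integral>x. f x \<partial>\<mu>) \<in> U} |f U. f \<in> borel_measurable borel \<and> bounded (range f) \<and> open (U :: real set)}"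
  have "{\<mu> \<in> probs. (\<integral>x. 0 \<partial>\<mu>) \<in> (UNIV :: real set)} \<in> ?B"
    by (intro CollectI exI conjI) (rule refl, simp_all)
  then have "probs \<in> ?B" by simp
  then have "\<Union> ?B = probs" by blast
  then show ?thesis unfolding tau_topology_def topology_generated_by_topspace .
qed

text \<open>Induction over the generated topology: an intersection takes the union of the two sets
  of functions and the smaller radius. The lower bound for an open set is thereby reduced to
  finitely many integrals.\<close>

lemma tau_neighbourhood:
  assumes "openin tau_topology G" "\<mu> \<in> G"
  shows "\<exists>F d. finite F \<and> F \<subseteq> bounded_measurable \<and> 0 < d \<and>
    (\<forall>\<nu>\<in>probs. (\<forall>f\<in>F. \<bar>(\<integral>x. f x \<partial>\<nu>) - (\<integral>x. f x \<partial>\<mu>)\<bar> < d) \<longrightarrow> \<nu> \<in> G)"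
proof -
  have "generate_topology_on {{\<mu> \<in> probs. (\<integral>x. f x \<partial>\<mu>) \<in> U} | f U.
        f \<in> borel_measurable borel \<and> bounded (range f) \<and> open (U :: real set)} G"
    using assms(1) unfolding tau_topology_def by (simp add: openin_topology_generated_by_iff)
  then show ?thesis using assms(2)
  proof (induction rule: generate_topology_on.induct)
    case Empty
    then show ?case by simp
  next
    case (Int a b)
    obtain F1 d1 where "finite F1" "F1 \<subseteq> bounded_measurable" "0 < d1"
      "\<forall>\<nu>\<in>probs. (\<forall>f\<in>F1. \<bar>(\<integral>x. f x \<partial>\<nu>) - (\<integral>x. f x \<partial>\<mu>)\<bar> < d1) \<longrightarrow> \<nu> \<in> a"
      using Int.IH(1)[OF IntD1[OF Int.prems]] by blast
    moreover obtain F2 d2 where "finite F2" "F2 \<subseteq> bounded_measurable" "0 < d2"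
      "\<forall>\<nu>\<in>probs. (\<forall>f\<in>F2. \<bar>(\<integral>x. f x \<partial>\<nu>) - (\<integral>x. f x \<partial>\<mu>)\<bar> < d2) \<longrightarrow> \<nu> \<in> b"
      using Int.IH(2)[OF IntD2[OF Int.prems]] by blast
    ultimately show ?case
      by (intro exI[of _ "F1 \<union> F2"] exI[of _ "min d1 d2"]) auto
  next
    case (UN K)
    then obtain k where "k \<in> K" "\<mu> \<in> k" by blast
    from UN.IH[OF this] \<open>k \<in> K\<close> show ?case by (meson UnionI)
  next
    case (Basis s)
    then obtain f U where f: "f \<in> bounded_measurable" "open U" "s = {\<mu> \<in> probs. (\<integral>x. f x \<partial>\<mu>) \<in> U}"
      unfolding bounded_measurable_def mem_Collect_eq bounded_by_iff_range by blast
    then obtain d where "0 < d" "\<forall>y. dist y (\<integral>x. f x \<partial>\<mu>) < d \<longrightarrow> y \<in> U"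
      using Basis.prems unfolding open_dist by blast
    then show ?case using f
      by (intro exI[of _ "{f}"] exI[of _ d]) (auto simp: dist_real_def)
  qed
qed

text \<open>The compactness arguments take place in the product of the intervals
  \<open>[- bound_of f, bound_of f]\<close>, which contains every probability measure as the family of
  its integrals.\<close>

definition evaluation_space :: "((real \<Rightarrow> real) \<Rightarrow> real) topology" where
  "evaluation_space =
     product_topology (\<lambda>f. top_of_set {- bound_of f..bound_of f}) bounded_measurable"

definition evaluation :: "real measure \<Rightarrow> (real \<Rightarrow> real) \<Rightarrow> real" where
  "evaluation \<mu> = (\<lambda>f\<in>bounded_measurable. \<integral>x. f x \<partial>\<mu>)"

lemma compact_space_evaluation: "compact_space evaluation_space"
  unfolding evaluation_space_def by (simp add: compact_space_product_topology compact_space_subtopology)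

lemma evaluation_in_space:
  assumes \<mu>: "\<mu> \<in> probs"
  shows "evaluation \<mu> \<in> topspace evaluation_space"
proof -
  have "- bound_of f \<le> (\<integral>x. f x \<partial>\<mu>) \<and> (\<integral>x. f x \<partial>\<mu>) \<le> bound_of f" if "f \<in> bounded_measurable" for f
    using abs_integral_probs_le[OF \<mu> bounded_by_bound_of[OF that]] by linarith
  then show ?thesis by (simp add: evaluation_space_def evaluation_def)
qed

lemma inj_on_evaluation: "inj_on evaluation probs"
proof (rule inj_onI)
  fix \<mu> \<nu> assume m: "\<mu> \<in> probs" "\<nu> \<in> probs" and eq: "evaluation \<mu> = evaluation \<nu>"
  interpret \<mu>: finite_measure \<mu> by (rule probsD(2)[OF m(1)])
  interpret \<nu>: finite_measure \<nu> by (rule probsD(2)[OF m(2)])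
  show "\<mu> = \<nu>"
  proof (rule measure_eqI)
    fix A assume "A \<in> sets \<mu>"
    then have A: "A \<in> sets borel" using probsD(3)[OF m(1)] by simp
    have "measure \<mu> A = measure \<nu> A"
      using fun_cong[OF eq, of "indicator A"] bounded_measurable_indicator[OF A, of 1]
        integral_indicator_probs[OF m(1) A] integral_indicator_probs[OF m(2) A]
      by (simp add: evaluation_def)
    then show "emeasure \<mu> A = emeasure \<nu> A"
      by (simp add: \<mu>.emeasure_eq_measure \<nu>.emeasure_eq_measure)
  qed (simp add: probsD(3)[OF m(1)] probsD(3)[OF m(2)])
qed

lemma continuous_map_evaluation_space:
  assumes "f \<in> bounded_measurable"
  shows "continuous_map evaluation_space euclideanreal (\<lambda>y. y f)"
  unfolding evaluation_space_def
  using continuous_map_product_projection[OF assms] by (rule continuous_map_into_fulltopology)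

text \<open>The preimage of a subbasic set is a condition on one coordinate. In this direction
  compact sets and closures are carried from the product to the space of measures.\<close>

lemma continuous_map_inv_evaluation:
  "continuous_map (subtopology evaluation_space (evaluation ` probs)) tau_topology (inv_into probs evaluation)"
  unfolding tau_topology_def
proof (rule continuous_on_generated_topo)
  let ?X = "subtopology evaluation_space (evaluation ` probs)"
  have top: "topspace ?X = evaluation ` probs" using evaluation_in_space by (auto simp: topspace_subtopology)
  show "inv_into probs evaluation ` topspace ?X \<subseteq>
      \<Union> {{\<mu> \<in> probs. (\<integral>x. f x \<partial>\<mu>) \<in> U} |f U. f \<in> borel_measurable borel \<and> bounded (range f) \<and> open (U :: real set)}"
    unfolding top topspace_tau[unfolded tau_topology_def topology_generated_by_topspace]
    by (auto simp: inv_into_f_f[OF inj_on_evaluation])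
  fix V assume "V \<in> {{\<mu> \<in> probs. (\<integral>x. f x \<partial>\<mu>) \<in> U} |f U. f \<in> borel_measurable borel \<and> bounded (range f) \<and> open (U :: real set)}"
  then obtain f U where f: "f \<in> bounded_measurable" "open U" "V = {\<mu> \<in> probs. (\<integral>x. f x \<partial>\<mu>) \<in> U}"
    unfolding bounded_measurable_def mem_Collect_eq bounded_by_iff_range by blast
  have "inv_into probs evaluation -` V \<inter> topspace ?X = {y \<in> topspace ?X. y f \<in> U}"
  proof -
    have "evaluation \<mu> f = (\<integral>x. f x \<partial>\<mu>)" for \<mu> using f(1) by (simp add: evaluation_def)
    then show ?thesis unfolding top f(3) by (auto simp: inv_into_f_f[OF inj_on_evaluation])
  qed
  also have "openin ?X \<dots>"
    using continuous_map_from_subtopology[OF continuous_map_evaluation_space[OF f(1)]] f(2)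
    by (intro openin_continuous_map_preimage) (simp_all only: open_openin)
  finally show "openin ?X (inv_into probs evaluation -` V \<inter> topspace ?X)" .
qed

text \<open>A weak inequality between finitely many coordinates defines a closed set of the product,
  so it passes from measures to all limit points. Positivity, additivity and homogeneity of limit
  points are obtained in this way.\<close>

lemma evaluation_closure_linear:
  assumes y: "y \<in> evaluation_space closure_of (evaluation ` probs)"
    and f: "finite I" "\<And>i. i \<in> I \<Longrightarrow> f i \<in> bounded_measurable"
    and le: "\<And>\<mu>. \<mu> \<in> probs \<Longrightarrow> a \<le> (\<Sum>i\<in>I. c i * (\<integral>x. f i x \<partial>\<mu>))"
  shows "a \<le> (\<Sum>i\<in>I. c i * y (f i))"
proof -
  let ?C = "{y \<in> topspace evaluation_space. (\<Sum>i\<in>I. c i * y (f i)) \<in> {a..}}"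
  have "closedin evaluation_space ?C"
    using f by (intro closedin_continuous_map_preimage[where Y=euclideanreal])
      (auto intro!: continuous_map_sum continuous_map_real_mult continuous_map_evaluation_space)
  moreover have "evaluation ` probs \<subseteq> ?C"
    using f le evaluation_in_space by (auto simp: evaluation_def cong: sum.cong)
  ultimately have "evaluation_space closure_of (evaluation ` probs) \<subseteq> ?C"
    by (rule closure_of_minimal[rotated])
  then show ?thesis using y by auto
qed

section \<open>Limit points of the evaluations that are probability measures\<close>

lemma indicator_bounded_measurable: "A \<in> sets borel \<Longrightarrow> indicator A \<in> bounded_measurable"
  using bounded_measurable_indicator[of A 1] by simp

lemma evaluation_closure_eq:
  assumes y: "y \<in> evaluation_space closure_of (evaluation ` probs)"
    and f: "finite I" "\<And>i. i \<in> I \<Longrightarrow> f i \<in> bounded_measurable"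
    and eq: "\<And>\<mu>. \<mu> \<in> probs \<Longrightarrow> (\<Sum>i\<in>I. c i * (\<integral>x. f i x \<partial>\<mu>)) = a"
  shows "(\<Sum>i\<in>I. c i * y (f i)) = a"
proof (rule antisym)
  have "(\<Sum>i\<in>I. - c i * (\<integral>x. f i x \<partial>\<mu>)) = - a" if "\<mu> \<in> probs" for \<mu>
    using eq[OF that] by (simp add: sum_negf)
  then have "- a \<le> (\<Sum>i\<in>I. - c i * y (f i))"
    by (intro evaluation_closure_linear[OF y f]) auto
  then show "(\<Sum>i\<in>I. c i * y (f i)) \<le> a" by (simp add: sum_negf)
  show "a \<le> (\<Sum>i\<in>I. c i * y (f i))"
    by (rule evaluation_closure_linear[OF y f]) (use eq in auto)
qed

text \<open>Rounding down to multiples of \<open>d\<close>; boundedness leaves finitely many level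
  sets. It reduces the identification of a limit point with an integral to its values on
  indicators.\<close>

lemma step_approximation:
  fixes f :: "real \<Rightarrow> real"
  assumes f: "bounded_by B f" and d: "0 < d"
  obtains N :: int and A :: "int \<Rightarrow> real set" where "\<And>k. A k \<in> sets borel"
    "\<And>x. (\<Sum>k\<in>{-N..N}. d * real_of_int k * indicator (A k) x) \<le> f x"
    "\<And>x. f x \<le> (\<Sum>k\<in>{-N..N}. d * real_of_int k * indicator (A k) x) + d"
proof -
  note [measurable] = bounded_byD(1)[OF f]
  define N where "N = \<lceil>B / d\<rceil> + 1"
  define A where "A k = {x. \<lfloor>f x / d\<rfloor> = k}" for k :: int
  have "A k \<in> sets borel" for k
    unfolding A_def by measurable
  moreover have "(\<Sum>k\<in>{-N..N}. d * real_of_int k * indicator (A k) x) = d * real_of_int \<lfloor>f x / d\<rfloor>" for x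
  proof -
    have "\<bar>f x / d\<bar> \<le> B / d" using bounded_byD(2)[OF f, of x] d by (simp add: abs_divide divide_right_mono)
    then have "\<lfloor>f x / d\<rfloor> \<in> {-N..N}" unfolding N_def atLeastAtMost_iff by linarith
    moreover have "(\<Sum>k\<in>{-N..N}. d * real_of_int k * indicator (A k) x) =
        (\<Sum>k\<in>{-N..N}. if \<lfloor>f x / d\<rfloor> = k then d * real_of_int k else 0)"
      by (intro sum.cong) (auto simp: A_def)
    ultimately show ?thesis by (simp add: sum.delta')
  qed
  moreover have "d * real_of_int \<lfloor>f x / d\<rfloor> \<le> f x" "f x \<le> d * real_of_int \<lfloor>f x / d\<rfloor> + d" for x
  proof -
    have "d * real_of_int \<lfloor>f x / d\<rfloor> \<le> d * (f x / d)" "d * (f x / d) \<le> d * (real_of_int \<lfloor>f x / d\<rfloor> + 1)"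
      by (rule mult_left_mono; use d in linarith)+
    then show "d * real_of_int \<lfloor>f x / d\<rfloor> \<le> f x" "f x \<le> d * real_of_int \<lfloor>f x / d\<rfloor> + d"
      using d by (simp_all add: distrib_left)
  qed
  ultimately show ?thesis by (intro that[of A N]) auto
qed

text \<open>The bound on \<open>y (K * indicator (A n))\<close> for large \<open>K\<close> is what makes the finitely additive
  set function \<open>A \<mapsto> y (indicator A)\<close> continuous at the empty set.\<close>

lemma evaluation_closure_point:
  fixes L :: "(real \<Rightarrow> real) \<Rightarrow> real"
  assumes L: "\<And>K A. decseq A \<Longrightarrow> range A \<subseteq> sets borel \<Longrightarrow> (\<Inter>i. A i) = {} \<Longrightarrow>
      (\<lambda>n. L (\<lambda>x. K * indicator (A n) x)) \<longlonglongrightarrow> 0"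
    and y: "y \<in> evaluation_space closure_of (evaluation ` probs)"
    and le: "\<And>f. f \<in> bounded_measurable \<Longrightarrow> y f \<le> c + L f"
  shows "y \<in> evaluation ` probs"
proof -
  define p where "p A = y (indicator A)" for A
  note bm = indicator_bounded_measurable bounded_measurable_indicator
  have nonneg: "0 \<le> p A" if "A \<in> sets borel" for A
    using evaluation_closure_linear[OF y, of "{0::nat}" "\<lambda>_. indicator A" 0 "\<lambda>_. 1"] bm(1)[OF that]
    by (simp add: p_def integral_nonneg_AE)
  have top: "p UNIV = 1"
    using evaluation_closure_eq[OF y, of "{0::nat}" "\<lambda>_. indicator UNIV" "\<lambda>_. 1" 1] bm(1)[of UNIV]
      prob_space.prob_space[OF probsD(1)] probsD(4)
    by (fastforce simp: p_def)
  have add: "p (A \<union> B) = p A + p B" if AB: "A \<in> sets borel" "B \<in> sets borel" "A \<inter> B = {}" for A B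
  proof -
    \<comment> \<open>Additivity is a linear relation with coefficients 1, -1 and -1. The three
      functions are indexed by numbers so that they count separately even if some of them coincide,
      as happens for empty sets.\<close>
    let ?f = "\<lambda>i::nat. if i = 0 then indicator (A \<union> B) else if i = 1 then indicator A else indicator B :: real \<Rightarrow> real"
    have "(\<Sum>i\<in>{0,1,2}. (if i = 0 then 1 else -1) * y (?f i)) = 0"
    proof (rule evaluation_closure_eq[OF y])
      fix \<mu> assume \<mu>: "\<mu> \<in> probs"
      interpret finite_measure \<mu> by (rule probsD(2)[OF \<mu>])
      show "(\<Sum>i\<in>{0,1,2}. (if i = 0 then 1 else -1) * (\<integral>x. ?f i x \<partial>\<mu>)) = 0"
        using AB integral_indicator_probs[OF \<mu>] finite_measure_Union[of A B] probsD(3)[OF \<mu>] by simp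
    qed (use AB bm in auto)
    then show ?thesis by (simp add: p_def)
  qed
  have scale: "y (\<lambda>x. K * indicator A x) = K * p A" if "A \<in> sets borel" for K A
  proof -
    have "(\<Sum>i\<in>{0,1::nat}. (if i = 0 then 1 else - K) * y (if i = 0 then (\<lambda>x. K * indicator A x) else indicator A)) = 0"
      by (rule evaluation_closure_eq[OF y]) (use bm that in auto)
    then show ?thesis by (simp add: p_def)
  qed
  have mono: "p A \<le> p B" if "A \<subseteq> B" "A \<in> sets borel" "B \<in> sets borel" for A B
    using add[of A "B - A"] nonneg[of "B - A"] that by (simp add: Un_absorb1)
  have empty: "(\<lambda>n. ennreal (p (A n))) \<longlonglongrightarrow> 0"
    if A: "range A \<subseteq> sets borel" "decseq A" "(\<Inter>i. A i) = {}" for A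
  proof -
    have A': "A n \<in> sets borel" for n using A(1) by auto
    have "(\<lambda>n. p (A n)) \<longlonglongrightarrow> 0"
    proof (rule LIMSEQ_I)
      fix e :: real assume e: "0 < e"
      \<comment> \<open>Chosen so that \<open>K * p (A n) < \<bar>c\<bar> + 1\<close> becomes
        \<open>p (A n) < e\<close>.\<close>
      define K where "K = (\<bar>c\<bar> + 1) / e"
      have K: "0 < K" using e by (simp add: K_def)
      have "eventually (\<lambda>n. L (\<lambda>x. K * indicator (A n) x) < 1) sequentially"
        using order_tendstoD(2)[OF L[OF A(2,1,3)], of 1] by simp
      then obtain n0 where n0: "\<And>n. n0 \<le> n \<Longrightarrow> L (\<lambda>x. K * indicator (A n) x) < 1"
        unfolding eventually_sequentially by blast
      have "norm (p (A n) - 0) < e" if "n0 \<le> n" for n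
      proof -
        have "K * p (A n) \<le> c + L (\<lambda>x. K * indicator (A n) x)"
          using le[OF bm(2)[OF A']] scale[OF A'] by metis
        also have "\<dots> < \<bar>c\<bar> + 1" using n0[OF that] by linarith
        also have "\<dots> = K * e" using e by (simp add: K_def)
        finally show ?thesis using nonneg[OF A', of n] K by simp
      qed
      then show "\<exists>n0. \<forall>n\<ge>n0. norm (p (A n) - 0) < e" by blast
    qed
    from tendsto_ennrealI[OF this] show ?thesis by simp
  qed
  define \<mu> where "\<mu> = measure_of (space borel) (sets borel) (\<lambda>A. ennreal (p A))"
  have sets\<mu>: "sets \<mu> = sets borel" unfolding \<mu>_def by (rule sets.sets_measure_of_eq)
  have space\<mu>: "space \<mu> = UNIV" unfolding \<mu>_def by (rule trans[OF sets.space_measure_of_eq space_borel])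
  have "p ({} \<union> {}) = p {} + p {}" by (rule add) auto
  then have "p {} = 0" unfolding Un_empty_left by linarith
  then have pos: "positive (sets borel) (\<lambda>A. ennreal (p A))" by (simp add: positive_def)
  have "countably_additive (sets borel) (\<lambda>A. ennreal (p A))"
  proof (rule sets.empty_continuous_imp_countably_additive[OF pos])
    show "additive (sets borel) (\<lambda>A. ennreal (p A))"
      using add nonneg by (auto simp: additive_def)
  qed (use empty in auto)
  then have em: "emeasure \<mu> A = ennreal (p A)" if "A \<in> sets borel" for A
    unfolding \<mu>_def using that by (intro emeasure_measure_of_sigma[OF sets.sigma_algebra_axioms pos])
  have prob: "prob_space \<mu>" by (rule prob_spaceI) (simp add: space\<mu> em top)
  then have \<mu>: "\<mu> \<in> probs" by (simp add: space_prob_algebra sets\<mu>)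
  have measure\<mu>: "measure \<mu> A = p A" if "A \<in> sets borel" for A
    using em[OF that] nonneg[OF that] by (simp add: measure_def)
  have "y f = (\<integral>x. f x \<partial>\<mu>)" if fbm: "f \<in> bounded_measurable" for f
  proof -
    note f = bounded_by_bound_of[OF fbm]
    have approx: "\<bar>y f - (\<integral>x. f x \<partial>\<mu>)\<bar> \<le> d" if d: "0 < d" for d
    proof -
      obtain N :: int and A where A: "\<And>k. A k \<in> sets borel"
        and lower: "\<And>x. (\<Sum>k\<in>{-N..N}. d * real_of_int k * indicator (A k) x) \<le> f x"
        and upper: "\<And>x. f x \<le> (\<Sum>k\<in>{-N..N}. d * real_of_int k * indicator (A k) x) + d"
        by (rule step_approximation[OF f d]) (rule that)
      let ?s = "\<lambda>x. \<Sum>k\<in>{-N..N}. d * real_of_int k * indicator (A k) x"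
      have int: "(\<Sum>k\<in>{-N..N}. d * real_of_int k * measure \<nu> (A k)) \<le> (\<integral>x. f x \<partial>\<nu>)"
          "(\<integral>x. f x \<partial>\<nu>) \<le> (\<Sum>k\<in>{-N..N}. d * real_of_int k * measure \<nu> (A k)) + d"
        if \<nu>: "\<nu> \<in> probs" for \<nu>
      proof -
        interpret prob_space \<nu> by (rule probsD(1)[OF \<nu>])
        have ind: "integrable \<nu> (\<lambda>x. d * real_of_int k * indicator (A k) x)" for k
          by (rule integrable_probs[OF \<nu> bounded_by_indicator[OF A]])
        then have s: "integrable \<nu> ?s" by (intro Bochner_Integration.integrable_sum)
        have "(\<integral>x. ?s x \<partial>\<nu>) = (\<Sum>k\<in>{-N..N}. \<integral>x. d * real_of_int k * indicator (A k) x \<partial>\<nu>)"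
          using ind by (intro Bochner_Integration.integral_sum)
        then have eq: "(\<integral>x. ?s x \<partial>\<nu>) = (\<Sum>k\<in>{-N..N}. d * real_of_int k * measure \<nu> (A k))"
          using integral_indicator_probs[OF \<nu> A] by simp
        show "(\<Sum>k\<in>{-N..N}. d * real_of_int k * measure \<nu> (A k)) \<le> (\<integral>x. f x \<partial>\<nu>)"
          unfolding eq[symmetric] by (intro integral_mono s integrable_probs[OF \<nu> f] lower)
        have "(\<integral>x. f x \<partial>\<nu>) \<le> (\<integral>x. ?s x + d \<partial>\<nu>)"
          by (intro integral_mono integrable_probs[OF \<nu> f] upper Bochner_Integration.integrable_add s) simp
        also have "\<dots> = (\<integral>x. ?s x \<partial>\<nu>) + d"
          using s by (subst Bochner_Integration.integral_add) (auto simp: prob_space)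
        finally show "(\<integral>x. f x \<partial>\<nu>) \<le> (\<Sum>k\<in>{-N..N}. d * real_of_int k * measure \<nu> (A k)) + d"
          unfolding eq .
      qed
      \<comment> \<open>The index \<open>N + 1\<close>, outside the range of the level sets, stands
        for \<open>f\<close> itself. Both halves of the step approximation then become linear
        inequalities between finitely many coordinates and extend to \<open>y\<close>.\<close>
      define g where "g k = (if k = N + 1 then f else indicator (A k))" for k
      define a where "a k = (if k = N + 1 then 1 else - d * real_of_int k)" for k
      have g: "g k \<in> bounded_measurable" for k using \<open>f \<in> bounded_measurable\<close> bm(1)[OF A] by (simp add: g_def)
      have sum: "(\<Sum>k\<in>insert (N+1) {-N..N}. a k * \<phi> (g k)) = \<phi> f - (\<Sum>k\<in>{-N..N}. d * real_of_int k * \<phi> (indicator (A k)))"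
        for \<phi> :: "(real \<Rightarrow> real) \<Rightarrow> real"
      proof -
        have "(\<Sum>k\<in>{-N..N}. a k * \<phi> (g k)) = (\<Sum>k\<in>{-N..N}. - (d * real_of_int k * \<phi> (indicator (A k))))"
          by (intro sum.cong) (auto simp: a_def g_def)
        then show ?thesis by (simp add: sum_negf a_def g_def)
      qed
      have sum\<nu>: "(\<Sum>k\<in>insert (N+1) {-N..N}. a k * (\<integral>x. g k x \<partial>\<nu>)) =
          (\<integral>x. f x \<partial>\<nu>) - (\<Sum>k\<in>{-N..N}. d * real_of_int k * measure \<nu> (A k))" if "\<nu> \<in> probs" for \<nu>
        using sum[of "integral\<^sup>L \<nu>"] by (simp only: integral_indicator_probs[OF that A])
      have "0 \<le> (\<Sum>k\<in>insert (N+1) {-N..N}. a k * y (g k))"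
      proof (rule evaluation_closure_linear[OF y _ g])
        show "0 \<le> (\<Sum>k\<in>insert (N+1) {-N..N}. a k * (\<integral>x. g k x \<partial>\<nu>))" if "\<nu> \<in> probs" for \<nu>
          unfolding sum\<nu>[OF that] using int(1)[OF that] by linarith
      qed simp
      moreover have "- d \<le> (\<Sum>k\<in>insert (N+1) {-N..N}. - a k * y (g k))"
      proof (rule evaluation_closure_linear[OF y _ g])
        show "- d \<le> (\<Sum>k\<in>insert (N+1) {-N..N}. - a k * (\<integral>x. g k x \<partial>\<nu>))" if "\<nu> \<in> probs" for \<nu>
          unfolding minus_mult_left[symmetric] sum_negf sum\<nu>[OF that] using int(2)[OF that] by linarith
      qed simp
      ultimately have "(\<Sum>k\<in>{-N..N}. d * real_of_int k * p (A k)) \<le> y f"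
          "y f \<le> (\<Sum>k\<in>{-N..N}. d * real_of_int k * p (A k)) + d"
        unfolding minus_mult_left[symmetric] sum_negf sum[of y] by (simp_all add: p_def)
      then show ?thesis using int[OF \<mu>] by (simp add: measure\<mu>[OF A] abs_le_iff)
    qed
    then have "\<bar>y f - (\<integral>x. f x \<partial>\<mu>)\<bar> \<le> 0" by (rule field_le_epsilon) auto
    then show ?thesis by simp
  qed
  \<comment> \<open>Elements of the product are undefined outside \<open>bounded_measurable\<close>,
    as evaluations are, so agreement on the index set gives equality.\<close>
  moreover have "y \<in> extensional bounded_measurable"
    using subsetD[OF closure_of_subset_topspace y] by (simp add: evaluation_space_def PiE_iff)
  ultimately have "y = evaluation \<mu>"
    by (auto simp: evaluation_def extensional_def)
  then show ?thesis using \<mu> by blast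
qed

lemma evaluation_closure_tau:
  assumes \<Gamma>: "\<Gamma> \<subseteq> probs" and \<mu>: "\<mu> \<in> probs" "evaluation \<mu> \<in> evaluation_space closure_of (evaluation ` \<Gamma>)"
  shows "\<mu> \<in> tau_topology closure_of \<Gamma>"
proof -
  let ?X = "subtopology evaluation_space (evaluation ` probs)"
  have "evaluation ` probs \<inter> evaluation ` \<Gamma> = evaluation ` \<Gamma>" using \<Gamma> by blast
  then have "evaluation \<mu> \<in> ?X closure_of (evaluation ` \<Gamma>)"
    using \<mu> by (simp add: closure_of_subtopology)
  then have "inv_into probs evaluation (evaluation \<mu>) \<in>
      tau_topology closure_of (inv_into probs evaluation ` (evaluation ` \<Gamma>))"
    using continuous_map_image_closure_subset[OF continuous_map_inv_evaluation] by blast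
  moreover have "inv_into probs evaluation ` (evaluation ` \<Gamma>) = \<Gamma>"
    using \<Gamma> by (rule inv_into_image_cancel[OF inj_on_evaluation])
  ultimately show ?thesis using \<mu>(1) by (simp add: inv_into_f_f[OF inj_on_evaluation])
qed

text \<open>A point in the product closure of \<Gamma> is either a measure, hence in the
  \<tau>-closure of \<Gamma> and covered by \<open>gt\<close>, or not a measure, and then the
  preceding criterion supplies a coordinate exceeding its bound. The open conditions thus cover a
  compact set. This finite cover takes the place of exponential tightness in the upper
  bound.\<close>

lemma tau_finite_cover:
  fixes L :: "(real \<Rightarrow> real) \<Rightarrow> real"
  assumes L: "\<And>K A. decseq A \<Longrightarrow> range A \<subseteq> sets borel \<Longrightarrow> (\<Inter>i. A i) = {} \<Longrightarrow>
      (\<lambda>n. L (\<lambda>x. K * indicator (A n) x)) \<longlonglongrightarrow> 0"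
    and \<Gamma>: "\<Gamma> \<subseteq> probs"
    and gt: "\<And>\<mu>. \<mu> \<in> tau_topology closure_of \<Gamma> \<Longrightarrow> \<exists>f\<in>bounded_measurable. c + L f < (\<integral>x. f x \<partial>\<mu>)"
  shows "\<exists>F. finite F \<and> F \<subseteq> bounded_measurable \<and> (\<forall>\<mu>\<in>\<Gamma>. \<exists>f\<in>F. c + L f < (\<integral>x. f x \<partial>\<mu>))"
proof -
  let ?C = "evaluation_space closure_of (evaluation ` \<Gamma>)"
  let ?V = "\<lambda>f. {y \<in> topspace evaluation_space. y f \<in> {c + L f<..}}"
  have comp: "compactin evaluation_space ?C"
    by (rule closedin_compact_space[OF compact_space_evaluation closedin_closure_of])
  have op: "openin evaluation_space (?V f)" if "f \<in> bounded_measurable" for f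
    by (rule openin_continuous_map_preimage[OF continuous_map_evaluation_space[OF that]]) simp
  have sub: "?C \<subseteq> \<Union> (?V ` bounded_measurable)"
  proof
    fix y assume y: "y \<in> ?C"
    then have y': "y \<in> evaluation_space closure_of (evaluation ` probs)" "y \<in> topspace evaluation_space"
      using subsetD[OF closure_of_mono[OF image_mono[OF \<Gamma>]]] subsetD[OF closure_of_subset_topspace] by metis+
    show "y \<in> \<Union> (?V ` bounded_measurable)"
    proof (rule ccontr)
      assume no: "\<not> ?thesis"
      have le: "y f \<le> c + L f" if "f \<in> bounded_measurable" for f
      proof (rule ccontr)
        assume "\<not> y f \<le> c + L f"
        then have "y \<in> ?V f" using y'(2) by simp
        with no that show False by blast
      qed
      have "y \<in> evaluation ` probs"
        by (rule evaluation_closure_point[where L=L, OF L y'(1) le])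
      then obtain \<mu> where \<mu>: "\<mu> \<in> probs" "y = evaluation \<mu>" by blast
      then obtain f where "f \<in> bounded_measurable" "c + L f < (\<integral>x. f x \<partial>\<mu>)"
        using gt[OF evaluation_closure_tau[OF \<Gamma>]] y by blast
      then show False using le[of f] \<mu>(2) by (simp add: evaluation_def)
    qed
  qed
  have "\<exists>\<F>. finite \<F> \<and> \<F> \<subseteq> ?V ` bounded_measurable \<and> ?C \<subseteq> \<Union> \<F>"
    by (rule compactinD[OF comp _ sub]) (use op in blast)
  then obtain \<F> where \<F>: "finite \<F>" "\<F> \<subseteq> ?V ` bounded_measurable" "?C \<subseteq> \<Union> \<F>"
    by blast
  then obtain F where F: "finite F" "F \<subseteq> bounded_measurable" "\<F> = ?V ` F"
    using finite_subset_image[OF \<F>(1,2)] by blast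
  show ?thesis
  proof (intro exI[of _ F] conjI ballI F(1,2))
    fix \<mu> assume \<mu>: "\<mu> \<in> \<Gamma>"
    then have "evaluation \<mu> \<in> ?C"
      using evaluation_in_space \<Gamma> by (intro subsetD[OF closure_of_subset]) auto
    then obtain f where "f \<in> F" "c + L f < evaluation \<mu> f" using \<F>(3) F(3) by auto
    then show "\<exists>f\<in>F. c + L f < (\<integral>x. f x \<partial>\<mu>)" using F(2) by (auto simp: evaluation_def intro!: bexI[of _ f])
  qed
qed

text \<open>The bounds cut out a closed subset of the closure of all evaluations, hence a compact
  one. It contains no finitely additive limit that fails to be a measure, so it can be pulled back
  to the space of measures.\<close>

lemma tau_compact_level_set:
  fixes L :: "(real \<Rightarrow> real) \<Rightarrow> real"
  assumes L: "\<And>K A. decseq A \<Longrightarrow> range A \<subseteq> sets borel \<Longrightarrow> (\<Inter>i. A i) = {} \<Longrightarrow>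
      (\<lambda>n. L (\<lambda>x. K * indicator (A n) x)) \<longlonglongrightarrow> 0"
  shows "compactin tau_topology {\<mu> \<in> probs. \<forall>f\<in>bounded_measurable. (\<integral>x. f x \<partial>\<mu>) \<le> c + L f}" (is "compactin _ ?K")
proof -
  let ?C = "evaluation_space closure_of (evaluation ` probs)"
  let ?V = "\<lambda>f. {y \<in> topspace evaluation_space. y f \<in> {..c + L f}}"
  let ?D = "?C \<inter> {y \<in> topspace evaluation_space. \<forall>f\<in>bounded_measurable. y f \<in> {..c + L f}}"
  have "closedin evaluation_space (?V f)" if "f \<in> bounded_measurable" for f
    by (rule closedin_continuous_map_preimage[OF continuous_map_evaluation_space[OF that]]) simp
  then have "closedin evaluation_space (\<Inter>f\<in>bounded_measurable. ?V f)"
    \<comment> \<open>The indicator of the whole line witnesses that the family being intersected is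
      nonempty.\<close>
    using indicator_bounded_measurable[of UNIV] by (intro closedin_Inter) auto
  also have "(\<Inter>f\<in>bounded_measurable. ?V f) =
      {y \<in> topspace evaluation_space. \<forall>f\<in>bounded_measurable. y f \<in> {..c + L f}}"
    using indicator_bounded_measurable[of UNIV] by auto
  finally have "closedin evaluation_space ?D" by (intro closedin_Int closedin_closure_of)
  then have "compactin evaluation_space ?D" by (rule closedin_compact_space[OF compact_space_evaluation])
  moreover have sub: "?D \<subseteq> evaluation ` probs"
  proof
    fix y assume "y \<in> ?D"
    then show "y \<in> evaluation ` probs"
      by (intro evaluation_closure_point[where L=L and c=c, OF L]) simp_all
  qed
  ultimately have "compactin (subtopology evaluation_space (evaluation ` probs)) ?D"
    by (simp add: compactin_subtopology)
  then have "compactin tau_topology (inv_into probs evaluation ` ?D)"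
    by (rule image_compactin[OF _ continuous_map_inv_evaluation])
  also have "?D = evaluation ` ?K"
  proof -
    have "evaluation ` probs \<subseteq> ?C" using evaluation_in_space by (intro closure_of_subset) auto
    moreover have "evaluation \<mu> f = (\<integral>x. f x \<partial>\<mu>)" if "f \<in> bounded_measurable" for \<mu> f
      using that by (simp add: evaluation_def)
    ultimately have "evaluation ` ?K \<subseteq> ?D" using evaluation_in_space by auto
    moreover have "y \<in> evaluation ` ?K" if y: "y \<in> ?D" for y
    proof -
      obtain \<mu> where "\<mu> \<in> probs" "y = evaluation \<mu>" using sub y by blast
      then show ?thesis using y by (auto simp: evaluation_def)
    qed
    ultimately show ?thesis by blast
  qed
  also have "inv_into probs evaluation ` (evaluation ` ?K) = ?K"
    by (rule inv_into_image_cancel[OF inj_on_evaluation]) auto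
  finally show ?thesis .
qed

section \<open>Continuity of the limiting logarithmic moment generating function\<close>

lemma indicator_abs_diff:
  "\<bar>indicator A t *\<^sub>R a - indicator A t *\<^sub>R b\<bar> = indicator A t *\<^sub>R \<bar>a - b :: real\<bar>"
  by (cases "t \<in> A") simp_all

context block_process
begin

definition occupation :: "real \<Rightarrow> 'a \<Rightarrow> real measure" where
  "occupation T \<omega> = occupation_measure (\<lambda>t. Z (t * T) \<omega>)"

lemma occupation_measurable: "occupation T \<in> measurable M (prob_algebra borel)"
  unfolding occupation_def
proof (rule occupation_measure_measurable)
  show "(\<lambda>(t, \<omega>). Z (t * T) \<omega>) \<in> borel_measurable (borel \<Otimes>\<^sub>M M)"
    unfolding split_beta' by (rule Z_measurable') simp_all
qed

lemma occupation_in_probs: "\<omega> \<in> space M \<Longrightarrow> occupation T \<omega> \<in> probs"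
  by (rule measurable_space[OF occupation_measurable])

lemma integral_occupation:
  assumes f: "bounded_by B f" and w[measurable]: "\<omega> \<in> space M" and T: "0 < T"
  shows "T * (\<integral>x. f x \<partial>occupation T \<omega>) = block f T 0 \<omega>"
proof -
  note [measurable] = bounded_byD(1)[OF f]
  have "(\<lambda>t. Z (t * T) \<omega>) \<in> borel_measurable borel" by measurable
  then have m: "(\<lambda>t. Z (t * T) \<omega>) \<in> borel_measurable (restrict_space lborel {0..1})"
    by (intro measurable_restrict_space1) simp
  have "block f T 0 \<omega> = (\<integral>t. indicator {0..T} t *\<^sub>R f (Z t \<omega>) \<partial>lborel)"
    by (simp add: block_def set_lebesgue_integral_def)
  also have "\<dots> = \<bar>T\<bar> *\<^sub>R (\<integral>t. indicator {0..T} (0 + T * t) *\<^sub>R f (Z (0 + T * t) \<omega>) \<partial>lborel)"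
    by (rule lborel_integral_real_affine) (use T in simp)
  also have "\<dots> = T * (\<integral>t. indicator {0..1} t *\<^sub>R f (Z (t * T) \<omega>) \<partial>lborel)"
    using T by (simp, intro Bochner_Integration.integral_cong)
      (auto simp: mult.commute zero_le_mult_iff split: split_indicator)
  also have "(\<integral>t. indicator {0..1} t *\<^sub>R f (Z (t * T) \<omega>) \<partial>lborel) =
      (\<integral>t. f (Z (t * T) \<omega>) \<partial>restrict_space lborel {0..1})"
    by (subst integral_restrict_space) auto
  also have "\<dots> = (\<integral>x. f x \<partial>occupation T \<omega>)"
    unfolding occupation_def occupation_measure_def using m by (subst integral_distr) auto
  finally show ?thesis by simp
qed

lemma block_diff_le:
  assumes f: "bounded_by B f" and g: "bounded_by B g" and w: "\<omega> \<in> space M" and T: "0 \<le> T"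
  shows "\<bar>block f T 0 \<omega> - block g T 0 \<omega>\<bar> \<le> block (\<lambda>x. \<bar>f x - g x\<bar>) T 0 \<omega>"
proof -
  have "block f T 0 \<omega> - block g T 0 \<omega> = (\<integral>t. indicator {0..T} t *\<^sub>R f (Z (0 + t) \<omega>) - indicator {0..T} t *\<^sub>R g (Z (0 + t) \<omega>) \<partial>lborel)"
    unfolding block_def set_lebesgue_integral_def
    using block_integrable[OF f w, of 0 T 0] block_integrable[OF g w, of 0 T 0]
    by (intro Bochner_Integration.integral_diff[symmetric]) (auto simp: set_integrable_def)
  then have "\<bar>block f T 0 \<omega> - block g T 0 \<omega>\<bar> \<le> (\<integral>t. \<bar>indicator {0..T} t *\<^sub>R f (Z (0 + t) \<omega>) - indicator {0..T} t *\<^sub>R g (Z (0 + t) \<omega>)\<bar> \<partial>lborel)"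
    by (simp only: integral_abs_bound)
  also have "\<dots> = block (\<lambda>x. \<bar>f x - g x\<bar>) T 0 \<omega>"
    unfolding block_def set_lebesgue_integral_def
    by (intro Bochner_Integration.integral_cong refl) (rule indicator_abs_diff)
  finally show ?thesis .
qed

text \<open>By Fubini the image under \<open>Z\<close> of the product of \<open>M\<close> with
  Lebesgue measure on \<open>[0, T]\<close> has this property. It is not normalised: its total mass
  is \<open>T\<close>.\<close>

lemma occupation_law:
  assumes T: "0 < T"
  shows "\<exists>\<nu> :: real measure. finite_measure \<nu> \<and> sets \<nu> = sets borel \<and>
    (\<forall>B f. bounded_by B f \<longrightarrow> expectation (block f T 0) = (\<integral>x. f x \<partial>\<nu>))"
proof -
  let ?R = "restrict_space lborel {0..T}"
  let ?\<nu> = "distr (M \<Otimes>\<^sub>M ?R) borel (\<lambda>(\<omega>, t). Z t \<omega>)"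
  interpret R: finite_measure ?R
    by (intro finite_measureI) (simp add: space_restrict_space emeasure_restrict_space emeasure_lborel_Icc_eq)
  interpret P: pair_sigma_finite M ?R ..
  have [measurable]: "(\<lambda>t. t) \<in> measurable ?R (borel :: real measure)"
    by (rule measurable_restrict_space1) simp
  have m: "(\<lambda>(\<omega>, t). Z t \<omega>) \<in> borel_measurable (M \<Otimes>\<^sub>M ?R)"
  proof -
    have "(\<lambda>p. (snd p, fst p)) \<in> measurable (M \<Otimes>\<^sub>M ?R) (borel \<Otimes>\<^sub>M M)" by measurable
    from measurable_compose[OF this Z_measurable] show ?thesis by (simp add: case_prod_unfold)
  qed
  have fin: "finite_measure (M \<Otimes>\<^sub>M ?R)"
    by (rule finite_measure_pair_measure) unfold_locales
  then have fin\<nu>: "finite_measure ?\<nu>" by (rule finite_measure.finite_measure_distr) (rule m)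
  have "expectation (block f T 0) = (\<integral>x. f x \<partial>?\<nu>)" if f: "bounded_by B f" for B f
  proof -
    note [measurable] = bounded_byD(1)[OF f]
    interpret PM: finite_measure "M \<Otimes>\<^sub>M ?R" by (rule fin)
    have "integrable (M \<Otimes>\<^sub>M ?R) (\<lambda>p. f (case p of (\<omega>, t) \<Rightarrow> Z t \<omega>))"
      by (rule PM.integrable_const_bound[where B=B])
        (use bounded_byD(2)[OF f] m in \<open>auto intro: measurable_compose[OF m]\<close>)
    then have int: "integrable (M \<Otimes>\<^sub>M ?R) (\<lambda>(\<omega>, t). f (Z t \<omega>))" by (simp add: case_prod_unfold)
    have "(\<integral>x. f x \<partial>?\<nu>) = (\<integral>p. f (case p of (\<omega>, t) \<Rightarrow> Z t \<omega>) \<partial>(M \<Otimes>\<^sub>M ?R))"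
      by (rule integral_distr[OF m]) simp
    also have "\<dots> = (\<integral>\<omega>. (\<integral>t. f (Z t \<omega>) \<partial>?R) \<partial>M)"
      using P.integral_fst'[OF int] by (simp add: case_prod_unfold)
    also have "\<dots> = expectation (block f T 0)"
      by (intro Bochner_Integration.integral_cong) (simp_all add: block_def set_lebesgue_integral_def integral_restrict_space)
    finally show ?thesis by simp
  qed
  then show ?thesis using fin\<nu> by (intro exI[of _ ?\<nu>]) simp
qed

end

lemma exp_diff_le:
  fixes x y c :: real
  assumes "x \<le> c" "y \<le> c"
  shows "\<bar>exp x - exp y\<bar> \<le> exp c * \<bar>x - y\<bar>"
proof -
  have *: "exp b - exp a \<le> exp c * (b - a)" if "a \<le> b" "b \<le> c" for a b
  proof -
    have "exp b - exp a = exp b * (1 - exp (a - b))" by (simp add: algebra_simps flip: exp_add)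
    also have "\<dots> \<le> exp b * (b - a)"
      by (rule mult_left_mono) (use exp_ge_add_one_self[of "a - b"] in linarith, simp)
    also have "\<dots> \<le> exp c * (b - a)" using that by (intro mult_right_mono) auto
    finally show ?thesis .
  qed
  show ?thesis
  proof (cases "x \<le> y")
    case True
    then have "\<bar>exp x - exp y\<bar> = exp y - exp x" "\<bar>x - y\<bar> = y - x" by auto
    then show ?thesis using *[of x y] True assms by simp
  next
    case False
    then have "\<bar>exp x - exp y\<bar> = exp x - exp y" "\<bar>x - y\<bar> = x - y" by auto
    then show ?thesis using *[of y x] False assms by simp
  qed
qed

lemma abs_ln_diff_le:
  fixes x y m :: real
  assumes "0 < m" "m \<le> x" "m \<le> y"
  shows "\<bar>ln x - ln y\<bar> \<le> \<bar>x - y\<bar> / m"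
proof -
  have *: "ln b - ln a \<le> (b - a) / m" if "m \<le> a" "a \<le> b" for a b
  proof -
    have ab: "0 < a" "0 < b" using that assms(1) by auto
    have "ln b - ln a = ln (b / a)" using ab by (simp add: ln_div)
    also have "\<dots> \<le> b / a - 1" by (rule ln_le_minus_one) (use ab in simp)
    also have "\<dots> = (b - a) / a" using ab by (simp add: field_simps)
    also have "\<dots> \<le> (b - a) / m" using that assms(1) by (intro divide_left_mono) auto
    finally show ?thesis .
  qed
  show ?thesis
  proof (cases "x \<le> y")
    case True
    then have "\<bar>ln x - ln y\<bar> = ln y - ln x" "\<bar>x - y\<bar> = y - x" using assms by auto
    then show ?thesis using *[of x y] True assms by simp
  next
    case False
    then have "\<bar>ln x - ln y\<bar> = ln x - ln y" "\<bar>x - y\<bar> = x - y" using assms by auto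
    then show ?thesis using *[of y x] False assms by simp
  qed
qed

context dependent_process
begin

text \<open>One factor \<open>exp (B * T)\<close> is the Lipschitz constant of \<open>exp\<close> on
  the range of the block integrals. The other is the reciprocal of the lower bound
  \<open>exp (- (B * T))\<close> for the expectations, below which the logarithm is not
  evaluated.\<close>

lemma log_mgf_L1:
  assumes f: "bounded_by B f" and g: "bounded_by B g" and T: "0 \<le> T"
  shows "\<bar>log_mgf f T - log_mgf g T\<bar> \<le> exp (2 * B * T) * expectation (block (\<lambda>x. \<bar>f x - g x\<bar>) T 0)"
proof -
  note [measurable] = block_measurable[OF bounded_byD(1)[OF f]] block_measurable[OF bounded_byD(1)[OF g]]
  have B: "0 \<le> B" by (rule bounded_byD(3)[OF f])
  have int: "integrable M (\<lambda>\<omega>. exp (block h T 0 \<omega>))" and low: "exp (- (B * T)) \<le> expectation (\<lambda>\<omega>. exp (block h T 0 \<omega>))"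
    if h: "bounded_by B h" for h
  proof -
    have [measurable]: "block h T 0 \<in> borel_measurable M" by (rule block_measurable[OF bounded_byD(1)[OF h]])
    have bd: "\<bar>block h T 0 \<omega>\<bar> \<le> B * T" if "\<omega> \<in> space M" for \<omega> by (rule abs_block_le[OF h that T])
    show int: "integrable M (\<lambda>\<omega>. exp (block h T 0 \<omega>))"
      by (rule integrable_bounded[where c="exp (B * T)"]) (use bd in \<open>auto simp: abs_le_iff\<close>)
    have "expectation (\<lambda>\<omega>. exp (- (B * T))) \<le> expectation (\<lambda>\<omega>. exp (block h T 0 \<omega>))"
    proof (intro integral_mono int)
      show "exp (- (B * T)) \<le> exp (block h T 0 \<omega>)" if "\<omega> \<in> space M" for \<omega>
        using bd[OF that] by simp
    qed simp
    then show "exp (- (B * T)) \<le> expectation (\<lambda>\<omega>. exp (block h T 0 \<omega>))" by (simp add: prob_space)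
  qed
  have d: "bounded_by (B + B) (\<lambda>x. \<bar>f x - g x\<bar>)" by (rule bounded_by_diff[OF f g])
  have dint: "integrable M (block (\<lambda>x. \<bar>f x - g x\<bar>) T 0)"
    by (rule integrable_bounded[OF block_measurable[OF bounded_byD(1)[OF d]] abs_block_le[OF d _ T]])
  have "\<bar>expectation (\<lambda>\<omega>. exp (block f T 0 \<omega>)) - expectation (\<lambda>\<omega>. exp (block g T 0 \<omega>))\<bar>
      = \<bar>expectation (\<lambda>\<omega>. exp (block f T 0 \<omega>) - exp (block g T 0 \<omega>))\<bar>"
    using int f g by simp
  also have "\<dots> \<le> expectation (\<lambda>\<omega>. \<bar>exp (block f T 0 \<omega>) - exp (block g T 0 \<omega>)\<bar>)"
    by (rule integral_abs_bound)
  also have "\<dots> \<le> expectation (\<lambda>\<omega>. exp (B * T) * block (\<lambda>x. \<bar>f x - g x\<bar>) T 0 \<omega>)"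
  proof (intro integral_mono)
    fix \<omega> assume w: "\<omega> \<in> space M"
    have "\<bar>exp (block f T 0 \<omega>) - exp (block g T 0 \<omega>)\<bar> \<le> exp (B * T) * \<bar>block f T 0 \<omega> - block g T 0 \<omega>\<bar>"
      using abs_block_le[OF f w T, of 0] abs_block_le[OF g w T, of 0] by (intro exp_diff_le) auto
    also have "\<dots> \<le> exp (B * T) * block (\<lambda>x. \<bar>f x - g x\<bar>) T 0 \<omega>"
      by (intro mult_left_mono block_diff_le[OF f g w T]) simp
    finally show "\<bar>exp (block f T 0 \<omega>) - exp (block g T 0 \<omega>)\<bar> \<le> exp (B * T) * block (\<lambda>x. \<bar>f x - g x\<bar>) T 0 \<omega>" .
  qed (use int[OF f] int[OF g] dint in auto)
  also have "\<dots> = exp (B * T) * expectation (block (\<lambda>x. \<bar>f x - g x\<bar>) T 0)" by simp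
  finally have "\<bar>expectation (\<lambda>\<omega>. exp (block f T 0 \<omega>)) - expectation (\<lambda>\<omega>. exp (block g T 0 \<omega>))\<bar>
      \<le> exp (B * T) * expectation (block (\<lambda>x. \<bar>f x - g x\<bar>) T 0)" .
  then have "\<bar>log_mgf f T - log_mgf g T\<bar> \<le> exp (B * T) * expectation (block (\<lambda>x. \<bar>f x - g x\<bar>) T 0) / exp (- (B * T))"
    unfolding log_mgf_def
    by (intro order_trans[OF abs_ln_diff_le[OF _ low[OF f] low[OF g]]] divide_right_mono) auto
  also have "\<dots> = exp (2 * B * T) * expectation (block (\<lambda>x. \<bar>f x - g x\<bar>) T 0)"
    by (simp add: exp_minus field_simps flip: exp_add)
  finally show ?thesis .
qed


text \<open>Since \<open>log_mgf f T / T\<close> approximates \<open>Lambda\<close> uniformly over functions bounded by \<open>B\<close>, a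
  single large \<open>T\<close> controls \<open>Lambda\<close> by the mean occupation law over \<open>[0, T]\<close>.\<close>

lemma Lambda_L1_continuous:
  assumes e: "0 < e"
  shows "\<exists>(\<nu> :: real measure) d. finite_measure \<nu> \<and> sets \<nu> = sets borel \<and> 0 < d \<and>
    (\<forall>f g. bounded_by B f \<longrightarrow> bounded_by B g \<longrightarrow> (\<integral>x. \<bar>f x - g x\<bar> \<partial>\<nu>) < d \<longrightarrow>
      \<bar>Lambda M Z f - Lambda M Z g\<bar> < e)"
proof -
  define C where "C = (4 * real r + 4) * \<bar>B\<bar>"
  \<comment> \<open>The identity \<open>T * e = 2 * C + 1\<close> balances the errors:
    \<open>C\<close> for each of the two replacements of \<open>log_mgf\<close> by
    \<open>T * Lambda\<close>, and 1 for the difference of the two values of \<open>log_mgf\<close>,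
    which holds as soon as the distance in mean is below \<open>exp (- (2 * B * T))\<close>.\<close>
  define T where "T = (2 * C + 1) / e"
  have C: "0 \<le> C" by (simp add: C_def)
  then have T: "0 < T" using e by (simp add: T_def)
  obtain \<nu> :: "real measure" where \<nu>: "finite_measure \<nu>" "sets \<nu> = sets borel"
    "\<forall>B f. bounded_by B f \<longrightarrow> expectation (block f T 0) = (\<integral>x. f x \<partial>\<nu>)"
    using occupation_law[OF T] by blast
  have "\<bar>Lambda M Z f - Lambda M Z g\<bar> < e"
    if f: "bounded_by B f" and g: "bounded_by B g" and small: "(\<integral>x. \<bar>f x - g x\<bar> \<partial>\<nu>) < exp (- (2 * B * T))" for f g
  proof -
    have "\<bar>log_mgf f T - log_mgf g T\<bar> \<le> exp (2 * B * T) * (\<integral>x. \<bar>f x - g x\<bar> \<partial>\<nu>)"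
      using log_mgf_L1[OF f g, of T] T \<nu>(3) bounded_by_diff[OF f g] by simp
    also have "\<dots> < exp (2 * B * T) * exp (- (2 * B * T))"
      by (rule mult_strict_left_mono[OF small]) simp
    also have "\<dots> = 1" by (simp flip: exp_add)
    finally have "\<bar>log_mgf f T - log_mgf g T\<bar> < 1" .
    moreover have "\<bar>log_mgf f T - T * Lambda M Z f\<bar> \<le> C" "\<bar>log_mgf g T - T * Lambda M Z g\<bar> \<le> C"
      using abs_log_mgf_Lambda[OF f, of T] abs_log_mgf_Lambda[OF g, of T] T bounded_byD(3)[OF f] by (auto simp: C_def)
    ultimately have "\<bar>T * Lambda M Z f - T * Lambda M Z g\<bar> < 2 * C + 1" by linarith
    moreover have "T * e = 2 * C + 1" using e by (simp add: T_def)
    moreover have "\<bar>T * Lambda M Z f - T * Lambda M Z g\<bar> = T * \<bar>Lambda M Z f - Lambda M Z g\<bar>"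
      using T by (simp add: abs_mult flip: right_diff_distrib)
    ultimately have "T * \<bar>Lambda M Z f - Lambda M Z g\<bar> < T * e" by simp
    then show ?thesis using T by simp
  qed
  then show ?thesis using \<nu>(1,2) by (intro exI[of _ \<nu>] exI[of _ "exp (- (2 * B * T))"]) simp
qed

lemma Lambda_zero: "Lambda M Z (\<lambda>_. 0) = 0"
proof -
  have 0: "bounded_by 0 (\<lambda>_. 0)" by (simp add: bounded_by_def)
  have "block (\<lambda>_. 0) 1 0 = (\<lambda>_. 0)" by (auto simp: block_def set_lebesgue_integral_def)
  then have "log_mgf (\<lambda>_. 0) 1 = 0" by (simp add: log_mgf_def prob_space)
  then show ?thesis using abs_log_mgf_Lambda[OF 0, of 1] by simp
qed

text \<open>Continuity in mean at the zero function, combined with continuity from above of the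
  finite measure that controls it. This supplies the hypothesis \<open>L\<close> of the compactness
  results on the \<tau>-topology.\<close>

lemma Lambda_indicator_tendsto_0:
  assumes A: "decseq A" "range A \<subseteq> sets borel" "(\<Inter>i. A i) = {}"
  shows "(\<lambda>n. Lambda M Z (\<lambda>x. K * indicator (A n) x)) \<longlonglongrightarrow> 0"
proof (rule LIMSEQ_I)
  fix e :: real assume "0 < e"
  then obtain \<nu> :: "real measure" and d where \<nu>: "finite_measure \<nu>" "sets \<nu> = sets borel" "0 < d"
    and small: "\<forall>f g. bounded_by \<bar>K\<bar> f \<longrightarrow> bounded_by \<bar>K\<bar> g \<longrightarrow> (\<integral>x. \<bar>f x - g x\<bar> \<partial>\<nu>) < d \<longrightarrow>
      \<bar>Lambda M Z f - Lambda M Z g\<bar> < e"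
    using Lambda_L1_continuous[where B="\<bar>K\<bar>"] by blast
  interpret finite_measure \<nu> by fact
  have A': "A n \<in> sets borel" for n using A(2) by auto
  have "(\<lambda>n. measure \<nu> (A n)) \<longlonglongrightarrow> measure \<nu> (\<Inter>i. A i)"
    using A \<nu>(2) by (intro finite_Lim_measure_decseq) auto
  then have "(\<lambda>n. \<bar>K\<bar> * measure \<nu> (A n)) \<longlonglongrightarrow> \<bar>K\<bar> * 0"
    using A(3) by (intro tendsto_mult tendsto_const) simp
  then have "eventually (\<lambda>n. \<bar>K\<bar> * measure \<nu> (A n) < d) sequentially"
    using \<nu>(3) by (intro order_tendstoD(2)) auto
  then obtain n0 where n0: "\<And>n. n0 \<le> n \<Longrightarrow> \<bar>K\<bar> * measure \<nu> (A n) < d"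
    unfolding eventually_sequentially by blast
  have "norm (Lambda M Z (\<lambda>x. K * indicator (A n) x) - 0) < e" if "n0 \<le> n" for n
  proof -
    have "(\<integral>x. \<bar>K * indicator (A n) x - 0\<bar> \<partial>\<nu>) = (\<integral>x. \<bar>K\<bar> * indicator (A n) x \<partial>\<nu>)"
      by (intro Bochner_Integration.integral_cong) (auto simp: abs_mult split: split_indicator)
    also have "\<dots> = \<bar>K\<bar> * measure \<nu> (A n)" using A' \<nu>(2) by simp
    finally have "(\<integral>x. \<bar>K * indicator (A n) x - 0\<bar> \<partial>\<nu>) < d" using n0[OF that] by simp
    then show ?thesis
      using small[rule_format, OF bounded_by_indicator[OF A'], of "\<lambda>_. 0"] by (simp add: Lambda_zero bounded_by_def)
  qed
  then show "\<exists>n0. \<forall>n\<ge>n0. norm (Lambda M Z (\<lambda>x. K * indicator (A n) x) - 0) < e" by blast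
qed

text \<open>The rate is a supremum over continuous functions, whereas the \<tau>-topology tests
  against measurable ones. A continuous \<open>g\<close> close to \<open>f\<close> in mean under a
  common bound of \<mu> and of the measure controlling \<open>Lambda\<close> changes the integral
  and \<open>Lambda\<close> by at most \<open>e / 2\<close> each.\<close>

lemma Lambda_bound_continuous_to_measurable:
  assumes \<mu>: "\<mu> \<in> probs" and le: "\<And>g. g \<in> bcontfun \<Longrightarrow> (\<integral>x. g x \<partial>\<mu>) - Lambda M Z g \<le> c"
    and f: "bounded_by B f"
  shows "(\<integral>x. f x \<partial>\<mu>) - Lambda M Z f \<le> c"
proof (rule field_le_epsilon)
  fix e :: real assume e: "0 < e"
  then have "0 < e / 2" by simp
  then obtain \<nu> :: "real measure" and d where \<nu>: "finite_measure \<nu>" "sets \<nu> = sets borel" "0 < d"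
    and small: "\<forall>f g. bounded_by B f \<longrightarrow> bounded_by B g \<longrightarrow> (\<integral>x. \<bar>f x - g x\<bar> \<partial>\<nu>) < d \<longrightarrow>
      \<bar>Lambda M Z f - Lambda M Z g\<bar> < e / 2"
    using Lambda_L1_continuous[where B="B"] by blast
  have "sets \<nu> = sets \<mu>" using \<nu>(2) probsD(3)[OF \<mu>] by simp
  then obtain \<rho> where \<rho>: "finite_measure \<rho>" "sets \<rho> = sets \<mu>"
    and dom: "\<forall>h :: real \<Rightarrow> real. integrable \<rho> h \<longrightarrow> (\<forall>x. 0 \<le> h x) \<longrightarrow>
      integral\<^sup>L \<mu> h \<le> integral\<^sup>L \<rho> h \<and> integral\<^sup>L \<nu> h \<le> integral\<^sup>L \<rho> h"
    using finite_measure_common_bound[OF probsD(2)[OF \<mu>] \<nu>(1)] by blast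
  have \<rho>b: "sets \<rho> = sets borel" using \<rho>(2) probsD(3)[OF \<mu>] by simp
  have "0 < min d (e / 2)" using e \<nu>(3) by simp
  then obtain g where g: "continuous_on UNIV g" "bounded_by B g" "(\<integral>x. \<bar>f x - g x\<bar> \<partial>\<rho>) < min d (e / 2)"
    by (rule L1_continuous_approx[OF \<rho>(1) \<rho>b f]) (rule that)
  note fg = bounded_by_diff[OF f g(2)]
  have "integrable \<rho> (\<lambda>x. \<bar>f x - g x\<bar>)" by (rule integrable_bounded_by[OF \<rho>(1) \<rho>b fg])
  from dom[rule_format, OF this] have "(\<integral>x. \<bar>f x - g x\<bar> \<partial>\<mu>) < e / 2" "(\<integral>x. \<bar>f x - g x\<bar> \<partial>\<nu>) < d"
    using g(3) by auto
  note small = this(1) small[rule_format, OF f g(2) this(2)]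
  have "(\<integral>x. f x \<partial>\<mu>) - (\<integral>x. g x \<partial>\<mu>) = (\<integral>x. f x - g x \<partial>\<mu>)"
    using integrable_probs[OF \<mu> f] integrable_probs[OF \<mu> g(2)] by simp
  also have "\<dots> \<le> (\<integral>x. \<bar>f x - g x\<bar> \<partial>\<mu>)"
    using integral_abs_bound[of \<mu> "\<lambda>x. f x - g x"] by linarith
  finally have "(\<integral>x. f x \<partial>\<mu>) - (\<integral>x. g x \<partial>\<mu>) < e / 2" using small(1) by linarith
  moreover have "g \<in> bcontfun"
    using g(1) bounded_byD(2)[OF g(2)] by (auto simp: bcontfun_def bounded_iff)
  from le[OF this] have "(\<integral>x. g x \<partial>\<mu>) - Lambda M Z g \<le> c" .
  ultimately show "(\<integral>x. f x \<partial>\<mu>) - Lambda M Z f \<le> c + e" using small(2) by linarith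
qed

section \<open>Goodness of the rate function and the upper bound\<close>

lemma bcontfun_bounded_measurable: "g \<in> bcontfun \<Longrightarrow> g \<in> bounded_measurable"
  unfolding bounded_measurable_def mem_Collect_eq bounded_by_iff_range
  by (simp add: bcontfun_def borel_measurable_continuous_onI)

lemma Lambda_star_le_iff:
  assumes \<mu>: "\<mu> \<in> probs"
  shows "Lambda_star M Z \<mu> \<le> ereal c \<longleftrightarrow> (\<forall>f\<in>bounded_measurable. (\<integral>x. f x \<partial>\<mu>) \<le> c + Lambda M Z f)"
proof
  assume "Lambda_star M Z \<mu> \<le> ereal c"
  then have "(\<integral>x. g x \<partial>\<mu>) - Lambda M Z g \<le> c" if "g \<in> bcontfun" for g
    unfolding Lambda_star_def SUP_le_iff using that by auto
  then show "\<forall>f\<in>bounded_measurable. (\<integral>x. f x \<partial>\<mu>) \<le> c + Lambda M Z f"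
    using Lambda_bound_continuous_to_measurable[OF \<mu>] bounded_by_bound_of by (metis add.commute diff_le_eq)
next
  assume *: "\<forall>f\<in>bounded_measurable. (\<integral>x. f x \<partial>\<mu>) \<le> c + Lambda M Z f"
  have "(\<integral>x. g x \<partial>\<mu>) - Lambda M Z g \<le> c" if g: "g \<in> bcontfun" for g
    using bspec[OF * bcontfun_bounded_measurable[OF g]] by simp
  then show "Lambda_star M Z \<mu> \<le> ereal c"
    unfolding Lambda_star_def SUP_le_iff by auto
qed

lemma Lambda_star_good: "compactin tau_topology {\<mu> \<in> topspace tau_topology. Lambda_star M Z \<mu> \<le> ereal c}"
proof -
  have eq: "{\<mu> \<in> topspace tau_topology. Lambda_star M Z \<mu> \<le> ereal c} =
      {\<mu> \<in> probs. \<forall>f\<in>bounded_measurable. (\<integral>x. f x \<partial>\<mu>) \<le> c + Lambda M Z f}"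
    using Lambda_star_le_iff by (auto simp: topspace_tau)
  show ?thesis
    unfolding eq by (rule tau_compact_level_set[where L="Lambda M Z"]) (fact Lambda_indicator_tendsto_0)
qed

text \<open>Exponential Markov inequality for the block integral. The first factor comes from
  replacing \<open>log_mgf f T\<close> by \<open>T * Lambda M Z f\<close>; it does not depend on
  \<open>T\<close> and so vanishes in the large deviation scale.\<close>

lemma prob_integral_occupation_ge:
  assumes f: "bounded_by B f" and T: "0 < T"
  shows "prob {\<omega> \<in> space M. a + Lambda M Z f < (\<integral>x. f x \<partial>occupation T \<omega>)} \<le>
    exp ((4 * real r + 4) * B) * exp (- (T * a))"
proof -
  let ?b = "block f T 0"
  have [measurable]: "?b \<in> borel_measurable M" by (rule block_measurable[OF bounded_byD(1)[OF f]])
  have bd: "\<bar>?b \<omega>\<bar> \<le> B * T" if "\<omega> \<in> space M" for \<omega> by (rule abs_block_le[OF f that]) (use T in simp)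
  have int: "integrable M (\<lambda>\<omega>. exp (?b \<omega>))"
    by (rule integrable_bounded[where c="exp (B * T)"]) (use bd in \<open>auto simp: abs_le_iff\<close>)
  let ?E = "{\<omega> \<in> space M. T * (a + Lambda M Z f) < ?b \<omega>}"
  have eq: "{\<omega> \<in> space M. a + Lambda M Z f < (\<integral>x. f x \<partial>occupation T \<omega>)} = ?E"
    using T integral_occupation[OF f _ T] by (auto simp flip: integral_occupation[OF f _ T])
  have "exp (T * (a + Lambda M Z f)) * prob ?E = expectation (\<lambda>\<omega>. exp (T * (a + Lambda M Z f)) * indicator ?E \<omega>)"
    by simp
  also have "\<dots> \<le> expectation (\<lambda>\<omega>. exp (?b \<omega>))"
  proof (intro integral_mono int)
    show "integrable M (\<lambda>\<omega>. exp (T * (a + Lambda M Z f)) * indicator ?E \<omega>)"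
      by (rule integrable_bounded[where c="exp (T * (a + Lambda M Z f))"]) (auto split: split_indicator)
    show "exp (T * (a + Lambda M Z f)) * indicator ?E \<omega> \<le> exp (?b \<omega>)" for \<omega>
      by (auto split: split_indicator)
  qed
  also have "\<dots> = exp (log_mgf f T)"
    unfolding log_mgf_def using expectation_exp_pos[of ?b "B * T"] bd by (subst exp_ln) auto
  also have "\<dots> \<le> exp (T * Lambda M Z f + (4 * real r + 4) * B)"
    using abs_log_mgf_Lambda[OF f, of T] T by simp
  finally have "exp (T * (a + Lambda M Z f)) * prob ?E \<le> exp (T * Lambda M Z f + (4 * real r + 4) * B)" .
  then have "prob ?E \<le> exp (T * Lambda M Z f + (4 * real r + 4) * B) / exp (T * (a + Lambda M Z f))"
    by (simp add: pos_le_divide_eq mult.commute)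
  also have "\<dots> = exp ((4 * real r + 4) * B) * exp (- (T * a))"
    by (simp add: algebra_simps flip: exp_diff exp_add)
  finally show ?thesis unfolding eq .
qed

lemma occupation_upper_bound:
  assumes \<Gamma>: "\<Gamma> \<in> sets (prob_algebra borel)"
    and I: "\<And>\<mu>. \<mu> \<in> tau_topology closure_of \<Gamma> \<Longrightarrow> ereal c < Lambda_star M Z \<mu>"
  obtains C where "0 < C" "\<And>T. 0 < T \<Longrightarrow> prob {\<omega> \<in> space M. occupation T \<omega> \<in> \<Gamma>} \<le> C * exp (- (T * c))"
proof -
  have \<Gamma>p: "\<Gamma> \<subseteq> probs" using sets.sets_into_space[OF \<Gamma>] .
  have gt: "\<exists>f\<in>bounded_measurable. c + Lambda M Z f < (\<integral>x. f x \<partial>\<mu>)" if "\<mu> \<in> tau_topology closure_of \<Gamma>" for \<mu>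
  proof -
    have "\<mu> \<in> probs" using subsetD[OF closure_of_subset_topspace that] by (simp only: topspace_tau)
    moreover have "\<not> Lambda_star M Z \<mu> \<le> ereal c" using I[OF that] by simp
    ultimately show ?thesis using Lambda_star_le_iff by (simp add: not_le)
  qed
  have "\<exists>F. finite F \<and> F \<subseteq> bounded_measurable \<and> (\<forall>\<mu>\<in>\<Gamma>. \<exists>f\<in>F. c + Lambda M Z f < (\<integral>x. f x \<partial>\<mu>))"
    by (rule tau_finite_cover[where L="Lambda M Z"]) (fact Lambda_indicator_tendsto_0 \<Gamma>p gt)+
  then obtain F where F: "finite F" "F \<subseteq> bounded_measurable"
    and cover: "\<forall>\<mu>\<in>\<Gamma>. \<exists>f\<in>F. c + Lambda M Z f < (\<integral>x. f x \<partial>\<mu>)"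
    by blast
  let ?C = "\<lambda>f. exp ((4 * real r + 4) * bound_of f)"
  \<comment> \<open>The summand 1 in the constant keeps it positive when the cover \<open>F\<close>
    is empty.\<close>
  have "prob {\<omega> \<in> space M. occupation T \<omega> \<in> \<Gamma>} \<le> (1 + sum ?C F) * exp (- (T * c))" if T: "0 < T" for T
  proof -
    let ?E = "\<lambda>f. {\<omega> \<in> space M. c + Lambda M Z f < (\<integral>x. f x \<partial>occupation T \<omega>)}"
    have E: "?E f \<in> events" if "f \<in> F" for f
    proof -
      have f: "bounded_by (bound_of f) f" using that F(2) by (intro bounded_by_bound_of) auto
      have [measurable]: "block f T 0 \<in> borel_measurable M" by (rule block_measurable[OF bounded_byD(1)[OF f]])
      have "?E f = {\<omega> \<in> space M. c + Lambda M Z f < block f T 0 \<omega> / T}"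
        using T by (auto simp flip: integral_occupation[OF f _ T])
      then show ?thesis by simp
    qed
    have "prob {\<omega> \<in> space M. occupation T \<omega> \<in> \<Gamma>} \<le> prob (\<Union>f\<in>F. ?E f)"
      using cover E F(1) by (intro finite_measure_mono) (auto intro!: sets.finite_UN)
    also have "\<dots> \<le> (\<Sum>f\<in>F. prob (?E f))"
      using F(1) E by (intro finite_measure_subadditive_finite) auto
    also have "\<dots> \<le> (\<Sum>f\<in>F. ?C f * exp (- (T * c)))"
      using F(2) by (intro sum_mono prob_integral_occupation_ge[OF bounded_by_bound_of T]) auto
    also have "\<dots> \<le> (1 + sum ?C F) * exp (- (T * c))"
      by (simp add: sum_distrib_right distrib_right)
    finally show ?thesis .
  qed
  moreover have "0 < 1 + sum ?C F" by (intro add_pos_nonneg sum_nonneg) auto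
  ultimately show ?thesis by (intro that) auto
qed

end

section \<open>The lower bound by regularised tilting\<close>

lemma young_real:
  fixes K \<eta> x :: real
  assumes "0 < \<eta>"
  shows "K * \<bar>x\<bar> - \<eta> * x\<^sup>2 \<le> K\<^sup>2 / (4 * \<eta>)"
proof -
  have "0 \<le> (K - 2 * \<eta> * \<bar>x\<bar>)\<^sup>2" by simp
  then have "4 * \<eta> * (K * \<bar>x\<bar> - \<eta> * x\<^sup>2) \<le> K\<^sup>2"
    by (simp add: power2_eq_square algebra_simps)
  then show ?thesis using assms by (simp add: pos_le_divide_eq mult.commute)
qed

text \<open>The quadratic penalty makes the supremum in the Legendre transform finite and nearly attained at
  a point where the gradient of \<open>\<phi>\<close> is \<open>y\<close> up to a small error. This replaces differentiability and steepness of the limit.\<close>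

lemma regularised_near_maximiser:
  fixes \<phi> :: "('i \<Rightarrow> real) \<Rightarrow> real"
  assumes F: "finite F" and \<eta>: "0 < \<eta>" and \<zeta>: "0 < \<zeta>" and Q: "0 < Q" and t0: "0 < t0"
    and zero: "\<phi> (\<lambda>_. 0) = 0"
    and le: "\<And>\<theta>. (\<Sum>i\<in>F. \<theta> i * y i) - \<phi> \<theta> \<le> c + K * (\<Sum>i\<in>F. \<bar>\<theta> i\<bar>)"
    and grad: "\<And>\<theta> i t. i \<in> F \<Longrightarrow> \<bar>t\<bar> \<le> t0 \<Longrightarrow> \<phi> (\<theta>(i := \<theta> i + t)) \<le> \<phi> \<theta> + t * m \<theta> i + Q * t\<^sup>2"
  shows "\<exists>\<theta>. (\<forall>i\<in>F. \<bar>y i - m \<theta> i - \<eta> * \<theta> i\<bar> \<le> \<zeta>) \<and>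
    - \<zeta> \<le> (\<Sum>i\<in>F. \<theta> i * y i) - \<phi> \<theta> - \<eta> / 2 * (\<Sum>i\<in>F. (\<theta> i)\<^sup>2)"
proof -
  define \<Phi> where "\<Phi> \<theta> = (\<Sum>i\<in>F. \<theta> i * y i) - \<phi> \<theta> - \<eta> / 2 * (\<Sum>i\<in>F. (\<theta> i)\<^sup>2)" for \<theta>
  \<comment> \<open>\<open>R\<close> collects the quadratic terms of a step in one coordinate:
    \<open>Q\<close> from \<open>grad\<close> and \<open>\<eta> / 2\<close> from the penalty. The
    step \<open>t\<close> and the tolerance \<zeta>' are chosen such that
    \<open>\<zeta>' + R * t\<^sup>2\<close> is at most \<open>t * \<zeta>\<close>; moreover \<zeta>'
    is at most \<zeta>, for the comparison with the zero vector at the end.\<close>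
  define R where "R = Q + \<eta> / 2"
  define t where "t = min t0 (\<zeta> / (2 * R))"
  define \<zeta>' where "\<zeta>' = min \<zeta> (\<zeta> / 2 * t)"
  have R: "0 < R" using Q \<eta> by (simp add: R_def)
  have t: "0 < t" "t \<le> t0" "R * t \<le> \<zeta> / 2" "\<bar>t\<bar> \<le> t0"
  proof -
    show "0 < t" "t \<le> t0" using t0 \<zeta> R by (simp_all add: t_def)
    then show "\<bar>t\<bar> \<le> t0" by simp
    have "R * t \<le> R * (\<zeta> / (2 * R))" using R by (intro mult_left_mono) (simp_all add: t_def)
    then show "R * t \<le> \<zeta> / 2" using R by simp
  qed
  have \<zeta>': "0 < \<zeta>'" "\<zeta>' \<le> \<zeta>" "\<zeta>' \<le> \<zeta> / 2 * t" using \<zeta> t by (simp_all add: \<zeta>'_def)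
  \<comment> \<open>Here the quadratic penalty absorbs the linear term
    \<open>K * \<bar>\<theta> i\<bar>\<close> in each coordinate.\<close>
  have bdd: "bdd_above (range \<Phi>)"
  proof (rule bdd_aboveI2)
    fix \<theta>
    have "\<Phi> \<theta> \<le> c + (\<Sum>i\<in>F. K * \<bar>\<theta> i\<bar> - \<eta> / 2 * (\<theta> i)\<^sup>2)"
      using le[of \<theta>] by (simp add: \<Phi>_def sum_subtractf sum_distrib_left)
    also have "\<dots> \<le> c + (\<Sum>i\<in>F. K\<^sup>2 / (4 * (\<eta> / 2)))"
      using \<eta> by (intro add_left_mono sum_mono young_real) simp
    finally show "\<Phi> \<theta> \<le> c + (\<Sum>i\<in>F. K\<^sup>2 / (4 * (\<eta> / 2)))" .
  qed
  obtain \<theta> where \<theta>: "Sup (range \<Phi>) - \<zeta>' < \<Phi> \<theta>"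
    using less_cSup_iff[of "range \<Phi>" "Sup (range \<Phi>) - \<zeta>'"] bdd \<zeta>'(1) by auto
  have near: "\<Phi> \<theta>' < \<Phi> \<theta> + \<zeta>'" for \<theta>'
    using cSup_upper[OF _ bdd, of "\<Phi> \<theta>'"] \<theta> by simp
  have "\<bar>y i - m \<theta> i - \<eta> * \<theta> i\<bar> \<le> \<zeta>" if i: "i \<in> F" for i
  proof -
    let ?g = "y i - m \<theta> i - \<eta> * \<theta> i"
    \<comment> \<open>First-order condition: from a point within \<zeta>' of the supremum, a move by
      \<open>u\<close> along coordinate \<open>i\<close> gains less than \<zeta>'. Applied with both
      signs of the step, it bounds the absolute value of the gradient.\<close>
    have key: "u * ?g \<le> \<zeta>' + R * u\<^sup>2" if u: "\<bar>u\<bar> \<le> t0" for u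
    proof -
      let ?\<theta> = "\<theta>(i := \<theta> i + u)"
      have lin: "(\<Sum>j\<in>F. ?\<theta> j * y j) = (\<Sum>j\<in>F. \<theta> j * y j) + u * y i"
      proof -
        have "(\<Sum>j\<in>F. ?\<theta> j * y j) = (\<Sum>j\<in>F. \<theta> j * y j + (if j = i then u * y i else 0))"
          by (intro sum.cong) (auto simp: algebra_simps)
        then show ?thesis using F i by (simp add: sum.distrib)
      qed
      have sq: "(\<Sum>j\<in>F. (?\<theta> j)\<^sup>2) = (\<Sum>j\<in>F. (\<theta> j)\<^sup>2) + 2 * u * \<theta> i + u\<^sup>2"
      proof -
        have "(\<Sum>j\<in>F. (?\<theta> j)\<^sup>2) = (\<Sum>j\<in>F. (\<theta> j)\<^sup>2 + (if j = i then 2 * u * \<theta> i + u\<^sup>2 else 0))"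
          by (intro sum.cong) (auto simp: power2_eq_square algebra_simps)
        then show ?thesis using F i by (simp add: sum.distrib)
      qed
      have "\<Phi> \<theta> + u * ?g - R * u\<^sup>2 \<le> \<Phi> ?\<theta>"
        using grad[OF i u, of \<theta>] unfolding \<Phi>_def lin sq R_def by (simp add: algebra_simps)
      with near[of ?\<theta>] show ?thesis by linarith
    qed
    have "t * ?g \<le> \<zeta>' + R * t\<^sup>2" "(- t) * ?g \<le> \<zeta>' + R * (- t)\<^sup>2"
      using key[of t] key[of "- t"] t(4) by (simp_all only: abs_minus_cancel)
    then have "\<bar>t * ?g\<bar> \<le> \<zeta>' + R * t\<^sup>2" by (simp only: abs_le_iff minus_mult_left power2_minus)
    then have "t * \<bar>?g\<bar> \<le> \<zeta>' + R * t\<^sup>2" using t(1) by (simp only: abs_mult abs_of_pos)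
    also have "\<dots> \<le> \<zeta> / 2 * t + \<zeta> / 2 * t"
    proof -
      have "R * t * t \<le> \<zeta> / 2 * t" using t(1) by (intro mult_right_mono t(3)) simp
      then show ?thesis using \<zeta>'(3) by (simp add: power2_eq_square mult.assoc)
    qed
    finally have "t * \<bar>?g\<bar> \<le> t * \<zeta>" by (simp add: algebra_simps)
    then show ?thesis using t(1) by simp
  qed
  moreover have "- \<zeta> \<le> \<Phi> \<theta>"
  proof -
    have "\<Phi> (\<lambda>_. 0) = 0" by (simp add: \<Phi>_def zero)
    then show ?thesis using near[of "\<lambda>_. 0"] \<zeta>' by linarith
  qed
  ultimately show ?thesis unfolding \<Phi>_def by blast
qed

section \<open>Exponential change of measure on blocks\<close>

lemma exp_le_quadratic:
  fixes x :: real
  assumes "\<bar>x\<bar> \<le> 1"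
  shows "exp x \<le> 1 + x + x\<^sup>2"
proof (cases "0 \<le> x")
  case True
  then show ?thesis using exp_bound[of x] assms by simp
next
  case False
  have "1 - x \<le> exp (- x)" using exp_ge_add_one_self[of "- x"] by simp
  have "1 \<le> (1 - x) * (1 + x + x\<^sup>2)"
  proof -
    have "(1 - x) * (1 + x + x\<^sup>2) = 1 - x ^ 3" by (simp add: power2_eq_square power3_eq_cube algebra_simps)
    moreover have "x ^ 3 \<le> 0" using False by (simp add: power3_eq_cube mult_nonneg_nonpos mult_nonpos_nonpos)
    ultimately show ?thesis by simp
  qed
  also have "\<dots> \<le> exp (- x) * (1 + x + x\<^sup>2)"
  proof (rule mult_right_mono)
    show "0 \<le> 1 + x + x\<^sup>2" using assms by (simp add: abs_le_iff add_nonneg_nonneg)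
  qed fact
  finally have "exp x * 1 \<le> exp x * (exp (- x) * (1 + x + x\<^sup>2))" by (rule mult_left_mono) simp
  also have "\<dots> = 1 + x + x\<^sup>2" by (simp add: mult.assoc[symmetric] flip: exp_add)
  finally show ?thesis by simp
qed

lemma bounded_by_mono: "bounded_by B f \<Longrightarrow> B \<le> C \<Longrightarrow> bounded_by C f"
  unfolding bounded_by_def by (meson order_trans)

context dependent_process
begin

text \<open>The directional derivative of \<open>log_mgf\<close> at \<open>g\<close> along
  \<open>f\<close>, as the mean under the tilted law. It is the mean of the whole block integral;
  dividing by \<open>T\<close> gives the mean of the time average.\<close>

definition tilted_mean :: "(real \<Rightarrow> real) \<Rightarrow> real \<Rightarrow> (real \<Rightarrow> real) \<Rightarrow> real" where
  "tilted_mean g T f = expectation (\<lambda>\<omega>. exp (block g T 0 \<omega> - log_mgf g T) * block f T 0 \<omega>)"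

lemma expectation_tilt:
  assumes g: "bounded_by A g" and T: "0 \<le> T"
  shows "expectation (\<lambda>\<omega>. exp (block g T 0 \<omega> - log_mgf g T)) = 1"
    and "integrable M (\<lambda>\<omega>. exp (block g T 0 \<omega> - log_mgf g T))"
proof -
  have [measurable]: "block g T 0 \<in> borel_measurable M" by (rule block_measurable[OF bounded_byD(1)[OF g]])
  have bd: "\<bar>block g T 0 \<omega>\<bar> \<le> A * T" if "\<omega> \<in> space M" for \<omega> by (rule abs_block_le[OF g that T])
  have int: "integrable M (\<lambda>\<omega>. exp (block g T 0 \<omega>))"
    by (rule integrable_bounded[where c="exp (A * T)"]) (use bd in \<open>auto simp: abs_le_iff\<close>)
  have pos: "0 < expectation (\<lambda>\<omega>. exp (block g T 0 \<omega>))"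
    by (rule expectation_exp_pos[where c="A * T"]) (use bd in auto)
  show "integrable M (\<lambda>\<omega>. exp (block g T 0 \<omega> - log_mgf g T))"
    using int by (simp add: exp_diff)
  show "expectation (\<lambda>\<omega>. exp (block g T 0 \<omega> - log_mgf g T)) = 1"
    using pos by (simp add: exp_diff log_mgf_def)
qed

lemma integrable_tilt_mult:
  assumes g: "bounded_by A g" and T: "0 \<le> T" and h[measurable]: "h \<in> borel_measurable M"
    and bd: "\<And>\<omega>. \<omega> \<in> space M \<Longrightarrow> \<bar>h \<omega>\<bar> \<le> c"
  shows "integrable M (\<lambda>\<omega>. exp (block g T 0 \<omega> - log_mgf g T) * h \<omega>)"
    and "\<bar>expectation (\<lambda>\<omega>. exp (block g T 0 \<omega> - log_mgf g T) * h \<omega>)\<bar> \<le> c"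
proof -
  let ?w = "\<lambda>\<omega>. exp (block g T 0 \<omega> - log_mgf g T)"
  note w = expectation_tilt[OF g T]
  have [measurable]: "block g T 0 \<in> borel_measurable M" by (rule block_measurable[OF bounded_byD(1)[OF g]])
  have bd': "\<bar>?w \<omega> * h \<omega>\<bar> \<le> ?w \<omega> * c" if "\<omega> \<in> space M" for \<omega>
    using bd[OF that] by (simp add: abs_mult)
  have intc: "integrable M (\<lambda>\<omega>. ?w \<omega> * c)" using w(2) by simp
  show int: "integrable M (\<lambda>\<omega>. ?w \<omega> * h \<omega>)"
    by (rule Bochner_Integration.integrable_bound[OF intc]) (measurable, use bd' in \<open>force intro!: AE_I2\<close>)
  have "\<bar>expectation (\<lambda>\<omega>. ?w \<omega> * h \<omega>)\<bar> \<le> expectation (\<lambda>\<omega>. \<bar>?w \<omega> * h \<omega>\<bar>)" by (rule integral_abs_bound)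
  also have "\<dots> \<le> expectation (\<lambda>\<omega>. ?w \<omega> * c)" using int bd' intc by (intro integral_mono) auto
  also have "\<dots> = c" using w(1) by simp
  finally show "\<bar>expectation (\<lambda>\<omega>. ?w \<omega> * h \<omega>)\<bar> \<le> c" .
qed

text \<open>Under the tilted law the exponential of the perturbation is bounded by its quadratic
  expansion, valid since \<open>t\<close> keeps the exponent in \<open>[-1, 1]\<close>; then
  \<open>ln x \<le> x - 1\<close>. An upper bound is the direction that suits a near maximiser of a
  linear function minus \<open>log_mgf\<close>.\<close>

lemma log_mgf_perturb:
  assumes g: "bounded_by A g" and f: "bounded_by B f" and T: "0 \<le> T" and t: "\<bar>t\<bar> * (B * T) \<le> 1"
  shows "log_mgf (\<lambda>x. g x + t * f x) T \<le> log_mgf g T + t * tilted_mean g T f + (B * T)\<^sup>2 * t\<^sup>2"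
proof -
  let ?w = "\<lambda>\<omega>. exp (block g T 0 \<omega> - log_mgf g T)"
  let ?f = "block f T 0" and ?g = "block g T 0"
  have [measurable]: "?g \<in> borel_measurable M" "?f \<in> borel_measurable M"
    by (rule block_measurable[OF bounded_byD(1)[OF g]] block_measurable[OF bounded_byD(1)[OF f]])+
  have bf: "\<bar>?f \<omega>\<bar> \<le> B * T" if "\<omega> \<in> space M" for \<omega> by (rule abs_block_le[OF f that T])
  have AB: "bounded_by (max A B) g" "bounded_by (max A B) f"
    using bounded_by_mono[OF g] bounded_by_mono[OF f] by auto
  have split: "block (\<lambda>x. g x + t * f x) T 0 \<omega> = ?g \<omega> + t * ?f \<omega>" if "\<omega> \<in> space M" for \<omega>
    using block_sum[of "{True, False}" "max A B" "\<lambda>b. if b then g else f" \<omega> "\<lambda>b. if b then 1 else t" T 0] AB that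
    by simp
  note w = expectation_tilt[OF g T]
  have int1: "integrable M (\<lambda>\<omega>. ?w \<omega> * ?f \<omega>)" by (rule integrable_tilt_mult[OF g T _ bf]) simp
  have bf2: "\<bar>(?f \<omega>)\<^sup>2\<bar> \<le> (B * T)\<^sup>2" if "\<omega> \<in> space M" for \<omega>
    using power_mono[OF bf[OF that] abs_ge_zero, of 2] by simp
  note int2 = integrable_tilt_mult[OF g T _ bf2]
  have e: "exp (t * ?f \<omega>) \<le> 1 + t * ?f \<omega> + (t * ?f \<omega>)\<^sup>2" if "\<omega> \<in> space M" for \<omega>
  proof (rule exp_le_quadratic)
    have "\<bar>t * ?f \<omega>\<bar> \<le> \<bar>t\<bar> * (B * T)" using bf[OF that] by (simp add: abs_mult mult_left_mono)
    then show "\<bar>t * ?f \<omega>\<bar> \<le> 1" using t by simp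
  qed
  have int3: "integrable M (\<lambda>\<omega>. ?w \<omega> * exp (t * ?f \<omega>))"
  proof (rule integrable_tilt_mult(1)[OF g T, where c=3])
    fix \<omega> assume w: "\<omega> \<in> space M"
    have "\<bar>t * ?f \<omega>\<bar> \<le> \<bar>t\<bar> * (B * T)" using bf[OF w] by (simp add: abs_mult mult_left_mono)
    then have 1: "\<bar>t * ?f \<omega>\<bar> \<le> 1" using t by simp
    then have "(t * ?f \<omega>)\<^sup>2 \<le> 1" by (simp add: abs_square_le_1)
    then show "\<bar>exp (t * ?f \<omega>)\<bar> \<le> 3" using e[OF w] 1 by simp
  qed simp
  let ?m = "tilted_mean g T f"
  have "expectation (\<lambda>\<omega>. ?w \<omega> * exp (t * ?f \<omega>)) \<le> expectation (\<lambda>\<omega>. ?w \<omega> + t * (?w \<omega> * ?f \<omega>) + t\<^sup>2 * (?w \<omega> * (?f \<omega>)\<^sup>2))"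
  proof (intro integral_mono)
    show "?w \<omega> * exp (t * ?f \<omega>) \<le> ?w \<omega> + t * (?w \<omega> * ?f \<omega>) + t\<^sup>2 * (?w \<omega> * (?f \<omega>)\<^sup>2)" if "\<omega> \<in> space M" for \<omega>
      using mult_left_mono[OF e[OF that], of "?w \<omega>"] by (simp add: algebra_simps power_mult_distrib)
  qed (use int1 int2(1) int3 w(2) in auto)
  also have "\<dots> = 1 + t * ?m + t\<^sup>2 * expectation (\<lambda>\<omega>. ?w \<omega> * (?f \<omega>)\<^sup>2)"
    using int1 int2(1) w by (simp add: tilted_mean_def)
  also have "\<dots> \<le> 1 + t * ?m + t\<^sup>2 * (B * T)\<^sup>2"
    using int2(2) by (intro add_left_mono mult_left_mono) auto
  finally have le: "expectation (\<lambda>\<omega>. ?w \<omega> * exp (t * ?f \<omega>)) \<le> 1 + t * ?m + t\<^sup>2 * (B * T)\<^sup>2" .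
  have eq: "expectation (\<lambda>\<omega>. exp (block (\<lambda>x. g x + t * f x) T 0 \<omega>)) = exp (log_mgf g T) * expectation (\<lambda>\<omega>. ?w \<omega> * exp (t * ?f \<omega>))"
  proof -
    have "expectation (\<lambda>\<omega>. exp (block (\<lambda>x. g x + t * f x) T 0 \<omega>)) = expectation (\<lambda>\<omega>. exp (log_mgf g T) * (?w \<omega> * exp (t * ?f \<omega>)))"
      by (intro Bochner_Integration.integral_cong) (simp_all add: split flip: exp_add)
    then show ?thesis by simp
  qed
  have gf: "bounded_by (A + \<bar>t\<bar> * B) (\<lambda>x. g x + t * f x)"
    using g f unfolding bounded_by_def
    by (auto simp: abs_mult intro!: order_trans[OF abs_triangle_ineq] add_mono mult_left_mono)
  have "0 < expectation (\<lambda>\<omega>. exp (block (\<lambda>x. g x + t * f x) T 0 \<omega>))"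
    by (rule expectation_exp_pos[OF block_measurable[OF bounded_byD(1)[OF gf]] abs_block_le[OF gf _ T]])
  then have pos: "0 < expectation (\<lambda>\<omega>. ?w \<omega> * exp (t * ?f \<omega>))" unfolding eq by (simp add: zero_less_mult_iff)
  have "log_mgf (\<lambda>x. g x + t * f x) T = log_mgf g T + ln (expectation (\<lambda>\<omega>. ?w \<omega> * exp (t * ?f \<omega>)))"
    using pos unfolding log_mgf_def[of "\<lambda>x. g x + t * f x"] eq by (simp add: ln_mult)
  also have "\<dots> \<le> log_mgf g T + (expectation (\<lambda>\<omega>. ?w \<omega> * exp (t * ?f \<omega>)) - 1)"
    using ln_le_minus_one[OF pos] by simp
  finally show ?thesis using le by (simp add: mult.commute)
qed

text \<open>The Chebyshev bound for the block average under the law with density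
  \<open>\<Prod>k<n. exp (block g T (k * (T + r)) - log_mgf g T)\<close>.\<close>

lemma tilted_second_moment:
  fixes T :: nat
  assumes g: "bounded_by A g" and f: "bounded_by B f"
  defines "W \<equiv> \<lambda>n \<omega>. \<Prod>k<n. exp (block g (real T) (real (k * (T + r))) \<omega> - log_mgf g (real T))"
    and "D \<equiv> \<lambda>k \<omega>. block f (real T) (real (k * (T + r))) \<omega> - tilted_mean g (real T) f"
  shows "expectation (\<lambda>\<omega>. W n \<omega> * (\<Sum>k<n. D k \<omega>)\<^sup>2) \<le> real n * (2 * B * real T)\<^sup>2"
    and "integrable M (\<lambda>\<omega>. W n \<omega> * (\<Sum>k<n. D k \<omega>)\<^sup>2)"
    and "expectation (W n) = 1" and "integrable M (W n)"
proof -
  let ?a = "log_mgf g (real T)" and ?c = "tilted_mean g (real T) f"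
  have AB: "bounded_by (max A B) g" "bounded_by (max A B) f"
    using bounded_by_mono[OF g] bounded_by_mono[OF f] by auto
  let ?AT = "max A B * real T"
  have AT: "0 \<le> ?AT" using bounded_byD(3)[OF AB(1)] by simp
  \<comment> \<open>The factor of block \<open>k\<close> in
    \<open>W n \<omega> * (D j \<omega> * D l \<omega>)\<close>: the centred block integral enters
    at \<open>j\<close> and at \<open>l\<close>, squared if they agree. Choosing
    \<open>j = l = n\<close> selects no block below \<open>n\<close> and leaves the density
    alone.\<close>
  define h where "h j l k p = exp (fst p - ?a) * ((if k = j then snd p - ?c else 1) * (if k = l then snd p - ?c else 1))"
    for j l k :: nat and p :: "real \<times> real"
  have h_meas: "h j l k \<in> borel_measurable borel" for j l k
    unfolding h_def borel_prod[symmetric] by measurable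
  have h_bd: "\<bar>h j l k (x, y)\<bar> \<le> exp (?AT + \<bar>?a\<bar>) * ((?AT + \<bar>?c\<bar> + 1) * (?AT + \<bar>?c\<bar> + 1))"
    if "\<bar>x\<bar> \<le> ?AT" "\<bar>y\<bar> \<le> ?AT" for j l k x y
  proof -
    have 1: "\<bar>if b then y - ?c else 1\<bar> \<le> ?AT + \<bar>?c\<bar> + 1" for b
      using that AT by auto
    have "exp (x - ?a) \<le> exp (?AT + \<bar>?a\<bar>)" using that by (simp add: abs_le_iff) linarith
    then show ?thesis
      unfolding h_def abs_mult fst_conv snd_conv abs_exp_cancel
      by (intro mult_mono 1) (auto intro!: add_nonneg_nonneg AT)
  qed
  have prod_h: "(\<Prod>k<n. h j l k (block g (real T) (real (k * (T + r))) \<omega>, block f (real T) (real (k * (T + r))) \<omega>)) =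
      W n \<omega> * (D j \<omega> * D l \<omega>)" if "j < n" "l < n" for j l \<omega>
    using that unfolding h_def W_def D_def by (simp add: prod.distrib prod.delta')
  let ?w = "\<lambda>\<omega>. exp (block g (real T) 0 \<omega> - ?a)"
  have tilt1: "expectation ?w = 1" by (rule expectation_tilt[OF g]) simp
  have [measurable]: "block f (real T) 0 \<in> borel_measurable M" by (rule block_measurable[OF bounded_byD(1)[OF f]])
  have bf: "\<bar>block f (real T) 0 \<omega>\<bar> \<le> B * real T" if "\<omega> \<in> space M" for \<omega> by (rule abs_block_le[OF f that]) simp
  have c: "\<bar>?c\<bar> \<le> B * real T"
    unfolding tilted_mean_def by (rule integrable_tilt_mult(2)[OF g _ _ bf]) simp_all
  have bD: "\<bar>block f (real T) 0 \<omega> - ?c\<bar> \<le> 2 * B * real T" if "\<omega> \<in> space M" for \<omega>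
    using bf[OF that] c by (simp add: abs_le_iff)
  have tilt0: "expectation (\<lambda>\<omega>. ?w \<omega> * (block f (real T) 0 \<omega> - ?c)) = 0"
  proof -
    have int: "integrable M (\<lambda>\<omega>. ?w \<omega> * block f (real T) 0 \<omega>)"
      by (rule integrable_tilt_mult(1)[OF g _ _ bf]) simp_all
    have "expectation (\<lambda>\<omega>. ?w \<omega> * (block f (real T) 0 \<omega> - ?c)) =
        expectation (\<lambda>\<omega>. ?w \<omega> * block f (real T) 0 \<omega> - ?c * ?w \<omega>)"
      by (simp add: algebra_simps)
    also have "\<dots> = ?c - ?c * 1"
      using int expectation_tilt[OF g, of "real T"] by (simp add: tilted_mean_def)
    finally show ?thesis by simp
  qed
  have tilt2: "expectation (\<lambda>\<omega>. ?w \<omega> * (block f (real T) 0 \<omega> - ?c)\<^sup>2) \<le> (2 * B * real T)\<^sup>2"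
  proof -
    have "\<bar>(block f (real T) 0 \<omega> - ?c)\<^sup>2\<bar> \<le> (2 * B * real T)\<^sup>2" if "\<omega> \<in> space M" for \<omega>
      using power_mono[OF bD[OF that] abs_ge_zero, of 2] by simp
    from integrable_tilt_mult(2)[OF g _ _ this] show ?thesis by (simp add: abs_le_iff)
  qed
  have int_jl: "integrable M (\<lambda>\<omega>. W n \<omega> * (D j \<omega> * D l \<omega>))" if "j < n" "l < n" for j l
    using expectation_prod_blocks(2)[where h="h j l" and T=T and n=n, OF AB h_meas h_bd] by (simp only: prod_h[OF that])
  have exp_jl: "expectation (\<lambda>\<omega>. W n \<omega> * (D j \<omega> * D l \<omega>)) \<le> (if j = l then (2 * B * real T)\<^sup>2 else 0)"
    if "j < n" "l < n" for j l
  proof -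
    have eq: "expectation (\<lambda>\<omega>. W n \<omega> * (D j \<omega> * D l \<omega>)) =
        (\<Prod>k<n. expectation (\<lambda>\<omega>. h j l k (block g (real T) 0 \<omega>, block f (real T) 0 \<omega>)))"
      using expectation_prod_blocks(1)[where h="h j l" and T=T and n=n, OF AB h_meas h_bd] by (simp only: prod_h[OF that])
    show ?thesis
    proof (cases "j = l")
      case True
      have "(\<Prod>k<n. expectation (\<lambda>\<omega>. h j l k (block g (real T) 0 \<omega>, block f (real T) 0 \<omega>))) =
          (\<Prod>k<n. if k = j then expectation (\<lambda>\<omega>. ?w \<omega> * (block f (real T) 0 \<omega> - ?c)\<^sup>2) else 1)"
        using True tilt1 by (intro prod.cong) (simp_all add: h_def power2_eq_square)
      then show ?thesis using tilt2 that True unfolding eq by (simp add: prod.delta)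
    next
      case False
      \<comment> \<open>For distinct blocks the factor at \<open>j\<close> has mean zero under the
        tilted law, so the covariance vanishes.\<close>
      have "expectation (\<lambda>\<omega>. h j l j (block g (real T) 0 \<omega>, block f (real T) 0 \<omega>)) = 0"
        using False tilt0 by (simp add: h_def)
      then show ?thesis using that(1) False unfolding eq by (subst prod_zero) auto
    qed
  qed
  have sq: "W n \<omega> * (\<Sum>k<n. D k \<omega>)\<^sup>2 = (\<Sum>j<n. \<Sum>l<n. W n \<omega> * (D j \<omega> * D l \<omega>))" for \<omega>
    unfolding power2_eq_square sum_product by (simp only: sum_distrib_left)
  show "integrable M (\<lambda>\<omega>. W n \<omega> * (\<Sum>k<n. D k \<omega>)\<^sup>2)"
    unfolding sq using int_jl by (intro Bochner_Integration.integrable_sum) auto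
  have "expectation (\<lambda>\<omega>. W n \<omega> * (\<Sum>k<n. D k \<omega>)\<^sup>2) = (\<Sum>j<n. \<Sum>l<n. expectation (\<lambda>\<omega>. W n \<omega> * (D j \<omega> * D l \<omega>)))"
    unfolding sq using int_jl by (subst Bochner_Integration.integral_sum; force intro!: sum.cong Bochner_Integration.integral_sum Bochner_Integration.integrable_sum)
  also have "\<dots> \<le> (\<Sum>j<n. \<Sum>l<n. if j = l then (2 * B * real T)\<^sup>2 else 0)"
    using exp_jl by (intro sum_mono) auto
  also have "\<dots> = real n * (2 * B * real T)\<^sup>2" by simp
  finally show "expectation (\<lambda>\<omega>. W n \<omega> * (\<Sum>k<n. D k \<omega>)\<^sup>2) \<le> real n * (2 * B * real T)\<^sup>2" .
  have prod_1: "(\<Prod>k<n. h n n k (block g (real T) (real (k * (T + r))) \<omega>, block f (real T) (real (k * (T + r))) \<omega>)) = W n \<omega>" for \<omega>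
    unfolding W_def by (intro prod.cong) (auto simp: h_def)
  show "integrable M (W n)" using expectation_prod_blocks(2)[where h="h n n" and T=T and n=n, OF AB h_meas h_bd] by (simp only: prod_1)
  have "expectation (W n) = (\<Prod>k<n. expectation (\<lambda>\<omega>. h n n k (block g (real T) 0 \<omega>, block f (real T) 0 \<omega>)))"
    using expectation_prod_blocks(1)[where h="h n n" and T=T and n=n, OF AB h_meas h_bd] by (simp only: prod_1)
  also have "\<dots> = (\<Prod>k<n. 1)" by (intro prod.cong) (auto simp: h_def tilt1)
  finally show "expectation (W n) = 1" by simp
qed

text \<open>The density \<open>W\<close> integrates to one. Off the good event its mass is small by
  Chebyshev and a sum over \<open>F\<close>: the second moment
  \<open>n * (2 * B * T)\<^sup>2\<close> divided by \<open>(n * T * d)\<^sup>2\<close>. On the good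
  event \<open>W\<close> is a function of the block averages, which are within \<open>d\<close> of
  their tilted means, so it is at most the exponential factor of the statement.\<close>

lemma tilted_block_average_lower_bound:
  fixes F :: "(real \<Rightarrow> real) set" and T n :: nat and \<theta> :: "(real \<Rightarrow> real) \<Rightarrow> real"
  assumes F: "finite F" "\<And>f. f \<in> F \<Longrightarrow> bounded_by B f" and T: "0 < T" and n: "0 < n" and d: "0 < d"
  defines "g \<equiv> \<lambda>x. \<Sum>f\<in>F. \<theta> f * f x"
    and "S \<equiv> \<lambda>f \<omega>. \<Sum>k<n. block f (real T) (real (k * (T + r))) \<omega>"
  shows "1 - real (card F) * (4 * B\<^sup>2) / (real n * d\<^sup>2) \<le>
    exp (real n * (real T * ((\<Sum>f\<in>F. \<theta> f * (tilted_mean g (real T) f / real T)) - log_mgf g (real T) / real T + d * (\<Sum>f\<in>F. \<bar>\<theta> f\<bar>)))) *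
    prob {\<omega> \<in> space M. \<forall>f\<in>F. \<bar>S f \<omega> / (real n * real T) - tilted_mean g (real T) f / real T\<bar> < d}"
proof -
  let ?a = "log_mgf g (real T)" and ?c = "\<lambda>f. tilted_mean g (real T) f"
  let ?N = "real n * real T"
  let ?G = "{\<omega> \<in> space M. \<forall>f\<in>F. \<bar>S f \<omega> / ?N - ?c f / real T\<bar> < d}"
  define W where "W \<omega> = (\<Prod>k<n. exp (block g (real T) (real (k * (T + r))) \<omega> - ?a))" for \<omega>
  define D where "D f k \<omega> = block f (real T) (real (k * (T + r))) \<omega> - ?c f" for f k \<omega>
  have N: "0 < ?N" using T n by simp
  obtain A where g: "bounded_by A g" using bounded_by_sum[of F B "\<lambda>f. f" \<theta>] F(2) unfolding g_def by blast
  have [measurable]: "S f \<in> borel_measurable M" if "f \<in> F" for f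
    unfolding S_def using block_measurable[OF bounded_byD(1)[OF F(2)[OF that]]] by measurable
  have G: "?G \<in> events" using F(1) by measurable
  have W_int: "integrable M W" "expectation W = 1"
    using tilted_second_moment(3,4)[OF g g, where T=T and n=n, folded W_def] by (auto simp: W_def[abs_def])
  have W_pos: "0 \<le> W \<omega>" for \<omega> by (simp add: W_def prod_nonneg)
  have SD: "S f \<omega> - real n * ?c f = (\<Sum>k<n. D f k \<omega>)" for f \<omega>
    by (simp add: S_def D_def sum_subtractf)
  have sum_c: "?c f / real T = real n * ?c f / ?N" for f using n by simp
  have bad: "W \<omega> * indicator (space M - ?G) \<omega> \<le> (\<Sum>f\<in>F. W \<omega> * (\<Sum>k<n. D f k \<omega>)\<^sup>2 / (?N * d)\<^sup>2)"
    if w: "\<omega> \<in> space M" for \<omega>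
  proof (cases "\<omega> \<in> ?G")
    case True
    then show ?thesis using W_pos by (auto intro!: sum_nonneg divide_nonneg_nonneg)
  next
    case False
    then obtain f where f: "f \<in> F" "d \<le> \<bar>S f \<omega> / ?N - ?c f / real T\<bar>" using w by (auto simp: not_less)
    have "S f \<omega> / ?N - ?c f / real T = (\<Sum>k<n. D f k \<omega>) / ?N"
      unfolding sum_c SD[symmetric] by (simp add: diff_divide_distrib)
    then have "d \<le> \<bar>\<Sum>k<n. D f k \<omega>\<bar> / ?N" using f(2) N by (simp add: abs_divide)
    then have "?N * d \<le> \<bar>\<Sum>k<n. D f k \<omega>\<bar>" using N by (simp add: pos_le_divide_eq mult.commute)
    then have "(?N * d)\<^sup>2 \<le> \<bar>\<Sum>k<n. D f k \<omega>\<bar>\<^sup>2" using N d by (intro power_mono) auto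
    moreover have pos: "0 < (?N * d)\<^sup>2" by (intro zero_less_power mult_pos_pos N d)
    ultimately have "1 \<le> (\<Sum>k<n. D f k \<omega>)\<^sup>2 / (?N * d)\<^sup>2"
      by (simp only: pos_le_divide_eq[OF pos] mult_1 power2_abs)
    then have "W \<omega> * 1 \<le> W \<omega> * ((\<Sum>k<n. D f k \<omega>)\<^sup>2 / (?N * d)\<^sup>2)" by (intro mult_left_mono W_pos)
    also have "\<dots> \<le> (\<Sum>f\<in>F. W \<omega> * (\<Sum>k<n. D f k \<omega>)\<^sup>2 / (?N * d)\<^sup>2)"
      unfolding times_divide_eq_right using F(1) f(1) W_pos
      by (intro member_le_sum[of f F "\<lambda>f. W \<omega> * (\<Sum>k<n. D f k \<omega>)\<^sup>2 / (?N * d)\<^sup>2"] divide_nonneg_nonneg mult_nonneg_nonneg) auto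
    finally show ?thesis using False w by simp
  qed
  have int_ind: "integrable M (\<lambda>\<omega>. W \<omega> * indicator A \<omega>)" if "A \<in> events" for A
    using integrable_mult_indicator[OF that W_int(1)] by (simp add: mult.commute)
  have momf: "expectation (\<lambda>\<omega>. W \<omega> * (\<Sum>k<n. D f k \<omega>)\<^sup>2) \<le> real n * (2 * B * real T)\<^sup>2"
      "integrable M (\<lambda>\<omega>. W \<omega> * (\<Sum>k<n. D f k \<omega>)\<^sup>2)" if "f \<in> F" for f
    using tilted_second_moment(1,2)[OF g F(2)[OF that], where T=T and n=n, folded W_def D_def] .
  have "expectation (\<lambda>\<omega>. W \<omega> * indicator (space M - ?G) \<omega>) \<le> expectation (\<lambda>\<omega>. \<Sum>f\<in>F. W \<omega> * (\<Sum>k<n. D f k \<omega>)\<^sup>2 / (?N * d)\<^sup>2)"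
    using momf(2) G by (intro integral_mono bad int_ind Bochner_Integration.integrable_sum integrable_divide) auto
  also have "\<dots> = (\<Sum>f\<in>F. expectation (\<lambda>\<omega>. W \<omega> * (\<Sum>k<n. D f k \<omega>)\<^sup>2) / (?N * d)\<^sup>2)"
    using momf(2) by (subst Bochner_Integration.integral_sum) auto
  also have "\<dots> \<le> (\<Sum>f\<in>F. real n * (2 * B * real T)\<^sup>2 / (?N * d)\<^sup>2)"
    using momf(1) by (intro sum_mono divide_right_mono) auto
  also have "\<dots> = real (card F) * (4 * B\<^sup>2) / (real n * d\<^sup>2)"
    using T n d by (simp add: power2_eq_square field_simps)
  finally have bad_le: "expectation (\<lambda>\<omega>. W \<omega> * indicator (space M - ?G) \<omega>) \<le> real (card F) * (4 * B\<^sup>2) / (real n * d\<^sup>2)" .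
  let ?R = "real n * (real T * ((\<Sum>f\<in>F. \<theta> f * (?c f / real T)) - ?a / real T + d * (\<Sum>f\<in>F. \<bar>\<theta> f\<bar>)))"
  have good: "W \<omega> * indicator ?G \<omega> \<le> exp ?R * indicator ?G \<omega>" if w: "\<omega> \<in> space M" for \<omega>
  proof (cases "\<omega> \<in> ?G")
    case True
    have "block g (real T) h \<omega> = (\<Sum>f\<in>F. \<theta> f * block f (real T) h \<omega>)" for h
      unfolding g_def using F(2) w by (rule block_sum[where f="\<lambda>f. f"])
    then have "(\<Sum>k<n. block g (real T) (real (k * (T + r))) \<omega>) = (\<Sum>f\<in>F. \<theta> f * S f \<omega>)"
      unfolding S_def sum_distrib_left by (simp only:) (rule sum.swap)
    then have Weq: "W \<omega> = exp ((\<Sum>f\<in>F. \<theta> f * S f \<omega>) - real n * ?a)"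
      unfolding W_def exp_sum[symmetric, OF finite_lessThan] by (simp add: sum_subtractf)
    have "\<theta> f * S f \<omega> \<le> ?N * (\<theta> f * (?c f / real T) + d * \<bar>\<theta> f\<bar>)" if "f \<in> F" for f
    proof -
      have "\<bar>S f \<omega> / ?N - ?c f / real T\<bar> \<le> d" using True that by (simp add: less_imp_le)
      then have "\<bar>\<theta> f\<bar> * \<bar>S f \<omega> / ?N - ?c f / real T\<bar> \<le> \<bar>\<theta> f\<bar> * d" by (rule mult_left_mono) simp
      then have "\<theta> f * (S f \<omega> / ?N - ?c f / real T) \<le> d * \<bar>\<theta> f\<bar>"
        by (simp add: abs_le_iff mult.commute flip: abs_mult)
      then have "?N * (\<theta> f * (S f \<omega> / ?N)) \<le> ?N * (\<theta> f * (?c f / real T) + d * \<bar>\<theta> f\<bar>)"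
        using N by (intro mult_left_mono) (simp_all add: algebra_simps)
      then show ?thesis using T n by simp
    qed
    then have "(\<Sum>f\<in>F. \<theta> f * S f \<omega>) \<le> (\<Sum>f\<in>F. ?N * (\<theta> f * (?c f / real T) + d * \<bar>\<theta> f\<bar>))"
      by (rule sum_mono)
    also have "\<dots> = ?R + real n * ?a"
      using T by (simp add: sum.distrib sum_distrib_left distrib_left right_diff_distrib mult.assoc)
    finally show ?thesis using True by (simp add: Weq)
  qed simp
  have "expectation W = expectation (\<lambda>\<omega>. W \<omega> * indicator ?G \<omega> + W \<omega> * indicator (space M - ?G) \<omega>)"
    by (intro Bochner_Integration.integral_cong) (auto split: split_indicator)
  also have "\<dots> = expectation (\<lambda>\<omega>. W \<omega> * indicator ?G \<omega>) + expectation (\<lambda>\<omega>. W \<omega> * indicator (space M - ?G) \<omega>)"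
    using G by (intro Bochner_Integration.integral_add int_ind) auto
  finally have "1 = expectation (\<lambda>\<omega>. W \<omega> * indicator ?G \<omega>) + expectation (\<lambda>\<omega>. W \<omega> * indicator (space M - ?G) \<omega>)"
    by (simp only: W_int(2))
  moreover have "expectation (\<lambda>\<omega>. W \<omega> * indicator ?G \<omega>) \<le> expectation (\<lambda>\<omega>. exp ?R * indicator ?G \<omega>)"
    using G by (intro integral_mono good int_ind) (auto intro!: integrable_mult_right integrable_real_indicator simp: emeasure_eq_measure)
  moreover have "expectation (\<lambda>\<omega>. exp ?R * indicator ?G \<omega>) = exp ?R * prob ?G" using G by simp
  ultimately show ?thesis using bad_le by linarith
qed

text \<open>A stretch of length \<open>T\<close> contains \<open>n = \<lfloor>T / (s + r)\<rfloor>\<close> blocks of length \<open>s\<close>; the gaps and the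
  remainder contribute a fraction \<open>r / s + (s + r) / T\<close>.\<close>

lemma block_average_close:
  fixes s :: nat
  assumes f: "bounded_by B f" and w: "\<omega> \<in> space M" and s: "0 < s" and T: "real (s + r) \<le> T"
  defines "n \<equiv> nat \<lfloor>T / real (s + r)\<rfloor>"
  shows "\<bar>block f T 0 \<omega> / T - (\<Sum>k<n. block f (real s) (real (k * (s + r))) \<omega>) / (real n * real s)\<bar>
      \<le> 2 * B * (real r / real s + real (s + r) / T)"
    and "0 < n" and "real n * real s \<le> T" and "T < (real n + 1) * real (s + r)"
proof -
  let ?S = "\<Sum>k<n. block f (real s) (real (k * (s + r))) \<omega>"
  have B: "0 \<le> B" by (rule bounded_byD(3)[OF f])
  have T0: "0 < T" using s T by linarith
  have sr: "0 < real (s + r)" using s by simp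
  have nr: "real n = real_of_int \<lfloor>T / real (s + r)\<rfloor>"
    using T0 sr by (simp add: n_def)
  have "1 \<le> T / real (s + r)" using T sr by simp
  then have "1 \<le> \<lfloor>T / real (s + r)\<rfloor>" by simp
  then show n: "0 < n" by (simp add: n_def)
  have "real n \<le> T / real (s + r)" unfolding nr by linarith
  then have nT: "real (n * (s + r)) \<le> T" using sr by (simp add: pos_le_divide_eq)
  have "T / real (s + r) < real n + 1" unfolding nr by linarith
  then show nT': "T < (real n + 1) * real (s + r)" using sr by (simp only: pos_divide_less_eq)
  let ?U = "T - real (n * (s + r))"
  have U: "0 \<le> ?U" "?U \<le> real (s + r)" using nT nT' by (simp_all add: algebra_simps)
  have ns: "real n * real s \<le> real (n * (s + r))" by (simp add: distrib_left)
  then show ns': "real n * real s \<le> T" using nT by linarith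
  have "block f T 0 \<omega> = block f (real (n * (s + r)) + ?U) 0 \<omega>" by simp
  also have "\<dots> = block f (real (n * (s + r))) 0 \<omega> + block f ?U (real (n * (s + r))) \<omega>"
    using block_split[OF f w _ U(1), of "real (n * (s + r))" 0] by simp
  also have "block f (real (n * (s + r))) 0 \<omega> = ?S + (\<Sum>k<n. block f (real r) (real (k * (s + r) + s)) \<omega>)"
    unfolding block_multiple[OF f w] sum.distrib by simp
  finally have eq: "block f T 0 \<omega> - ?S = (\<Sum>k<n. block f (real r) (real (k * (s + r) + s)) \<omega>) + block f ?U (real (n * (s + r))) \<omega>"
    by simp
  have gaps: "\<bar>\<Sum>k<n. block f (real r) (real (k * (s + r) + s)) \<omega>\<bar> \<le> real n * (B * real r)"
    by (rule order_trans[OF sum_abs], rule order_trans[OF sum_mono[where g="\<lambda>_. B * real r"]])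
      (auto intro!: abs_block_le[OF f w])
  have rest: "\<bar>block f ?U (real (n * (s + r))) \<omega>\<bar> \<le> B * ?U" by (rule abs_block_le[OF f w U(1)])
  have S_le: "\<bar>?S\<bar> \<le> real n * (B * real s)"
    by (rule order_trans[OF sum_abs], rule order_trans[OF sum_mono[where g="\<lambda>_. B * real s"]])
      (auto intro!: abs_block_le[OF f w])
  let ?E = "T - real n * real s"
  have E: "?E = real n * real r + ?U" by (simp add: algebra_simps)
  have E0: "0 \<le> ?E" using ns' by simp
  have diff: "\<bar>block f T 0 \<omega> - ?S\<bar> \<le> B * ?E"
  proof -
    have "\<bar>block f T 0 \<omega> - ?S\<bar> \<le> real n * (B * real r) + B * ?U"
      unfolding eq by (rule order_trans[OF abs_triangle_ineq add_mono[OF gaps rest]])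
    also have "\<dots> = B * ?E" unfolding E by (simp only: distrib_left mult.commute mult.left_commute)
    finally show ?thesis .
  qed
  \<comment> \<open>The two averages differ in their integrals and in their normalisations. Each
    contributes at most \<open>B * ?E / T\<close>, where \<open>?E\<close> is the time not covered
    by blocks; hence the factor 2.\<close>
  have "block f T 0 \<omega> / T - ?S / (real n * real s) = (block f T 0 \<omega> - ?S) / T - ?S * ?E / (T * (real n * real s))"
    using T0 n s by (simp add: field_simps)
  then have 1: "\<bar>block f T 0 \<omega> / T - ?S / (real n * real s)\<bar> \<le> \<bar>(block f T 0 \<omega> - ?S) / T\<bar> + \<bar>?S * ?E / (T * (real n * real s))\<bar>"
    by (simp only: abs_triangle_ineq4)
  have 2: "\<bar>(block f T 0 \<omega> - ?S) / T\<bar> \<le> B * ?E / T"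
    using diff T0 by (simp add: abs_divide divide_right_mono)
  have 3: "\<bar>?S * ?E / (T * (real n * real s))\<bar> \<le> B * ?E / T"
  proof -
    have "\<bar>?S * ?E\<bar> \<le> (real n * (B * real s)) * ?E"
      using S_le E0 by (simp add: abs_mult mult_right_mono)
    then have 1: "\<bar>?S * ?E\<bar> / (T * (real n * real s)) \<le> ((real n * (B * real s)) * ?E) / (T * (real n * real s))"
      using T0 by (intro divide_right_mono) auto
    also have "\<dots> = B * ?E / T" using n s by simp
    finally show ?thesis using T0 by (simp add: abs_mult)
  qed
  have "\<bar>block f T 0 \<omega> / T - ?S / (real n * real s)\<bar> \<le> B * ?E / T + B * ?E / T"
    using 1 2 3 by linarith
  also have "B * ?E / T + B * ?E / T = 2 * B * (?E / T)" by simp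
  also have "\<dots> \<le> 2 * B * (real r / real s + real (s + r) / T)"
  proof (rule mult_left_mono)
    have "real n * real r / T \<le> real r / real s"
      using mult_left_mono[OF ns', of "real r"] T0 s by (simp add: field_simps)
    moreover have "?U / T \<le> real (s + r) / T" using U(2) T0 by (intro divide_right_mono) auto
    ultimately show "?E / T \<le> real r / real s + real (s + r) / T"
      unfolding E add_divide_distrib by linarith
  qed (use B in simp)
  finally show "\<bar>block f T 0 \<omega> / T - ?S / (real n * real s)\<bar> \<le> 2 * B * (real r / real s + real (s + r) / T)"
    by simp
qed

text \<open>The function \<phi> is the finite-length surrogate of \<open>Lambda\<close> on
  combinations of \<open>F\<close>. Its error \<open>K\<close> per unit of \<theta> is the general
  constant \<open>(4 * real r + 4) * B\<close> divided by the block length. The curvature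
  \<open>B\<^sup>2 * real s\<close> and the step bound \<open>1 / (B * real s)\<close> are those of
  \<open>log_mgf_perturb\<close> after division by \<open>s\<close>.\<close>

lemma regularised_tilt:
  fixes F :: "(real \<Rightarrow> real) set" and s :: nat
  assumes \<mu>: "\<mu> \<in> probs" and I: "Lambda_star M Z \<mu> \<le> ereal c"
    and F: "finite F" "\<And>f. f \<in> F \<Longrightarrow> bounded_by B f" and B: "0 < B" and s: "0 < s" and \<eta>: "0 < \<eta>" and \<zeta>: "0 < \<zeta>"
  defines "K \<equiv> (4 * real r + 4) * B / real s"
    and "g \<equiv> \<lambda>\<theta> x. \<Sum>f\<in>F. \<theta> f * f x"
  shows "\<exists>\<theta>. (\<forall>f\<in>F. \<bar>(\<integral>x. f x \<partial>\<mu>) - tilted_mean (g \<theta>) (real s) f / real s - \<eta> * \<theta> f\<bar> \<le> \<zeta>) \<and>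
    (\<Sum>f\<in>F. \<theta> f * (\<integral>x. f x \<partial>\<mu>)) - log_mgf (g \<theta>) (real s) / real s \<le> c + K * (\<Sum>f\<in>F. \<bar>\<theta> f\<bar>) \<and>
    - \<zeta> \<le> (\<Sum>f\<in>F. \<theta> f * (\<integral>x. f x \<partial>\<mu>)) - log_mgf (g \<theta>) (real s) / real s - \<eta> / 2 * (\<Sum>f\<in>F. (\<theta> f)\<^sup>2)"
proof -
  define y where "y f = (\<integral>x. f x \<partial>\<mu>)" for f :: "real \<Rightarrow> real"
  define \<phi> where "\<phi> \<theta> = log_mgf (g \<theta>) (real s) / real s" for \<theta>
  have gb: "bounded_by ((\<Sum>f\<in>F. \<bar>\<theta> f\<bar>) * B) (g \<theta>)" for \<theta>
    unfolding g_def by (rule bounded_by_sum[of F B "\<lambda>f. f" \<theta>]) (rule F(2))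
  have le: "(\<Sum>f\<in>F. \<theta> f * y f) - \<phi> \<theta> \<le> c + K * (\<Sum>f\<in>F. \<bar>\<theta> f\<bar>)" for \<theta>
  proof -
    have "g \<theta> \<in> bounded_measurable" using gb by (auto simp: bounded_measurable_def)
    then have 1: "(\<integral>x. g \<theta> x \<partial>\<mu>) \<le> c + Lambda M Z (g \<theta>)"
      using I Lambda_star_le_iff[OF \<mu>] by blast
    have 2: "(\<integral>x. g \<theta> x \<partial>\<mu>) = (\<Sum>f\<in>F. \<theta> f * y f)"
      unfolding g_def y_def using integrable_probs[OF \<mu> F(2)]
      by (subst Bochner_Integration.integral_sum) auto
    have "real s * Lambda M Z (g \<theta>) \<le> log_mgf (g \<theta>) (real s) + (4 * real r + 4) * ((\<Sum>f\<in>F. \<bar>\<theta> f\<bar>) * B)"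
      using abs_log_mgf_Lambda[OF gb, of "real s" \<theta>] by (simp add: abs_le_iff)
    then have "Lambda M Z (g \<theta>) \<le> (log_mgf (g \<theta>) (real s) + (4 * real r + 4) * ((\<Sum>f\<in>F. \<bar>\<theta> f\<bar>) * B)) / real s"
      using s by (simp add: pos_le_divide_eq mult.commute)
    also have "\<dots> = \<phi> \<theta> + K * (\<Sum>f\<in>F. \<bar>\<theta> f\<bar>)"
      by (simp add: \<phi>_def K_def add_divide_distrib mult.commute mult.left_commute)
    finally show ?thesis using 1 2 by linarith
  qed
  have grad: "\<phi> (\<theta>(f := \<theta> f + t)) \<le> \<phi> \<theta> + t * (tilted_mean (g \<theta>) (real s) f / real s) + B\<^sup>2 * real s * t\<^sup>2"
    if f: "f \<in> F" and t: "\<bar>t\<bar> \<le> 1 / (B * real s)" for \<theta> f t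
  proof -
    have "g (\<theta>(f := \<theta> f + t)) = (\<lambda>x. g \<theta> x + t * f x)"
    proof
      fix x
      have "g (\<theta>(f := \<theta> f + t)) x = (\<Sum>h\<in>F. \<theta> h * h x + (if h = f then t * f x else 0))"
        unfolding g_def by (intro sum.cong) (auto simp: distrib_right)
      then show "g (\<theta>(f := \<theta> f + t)) x = g \<theta> x + t * f x"
        using F(1) f by (simp add: g_def sum.distrib)
    qed
    moreover have "\<bar>t\<bar> * (B * real s) \<le> 1" using t B s by (simp add: pos_le_divide_eq)
    ultimately have "log_mgf (g (\<theta>(f := \<theta> f + t))) (real s) \<le>
        log_mgf (g \<theta>) (real s) + t * tilted_mean (g \<theta>) (real s) f + (B * real s)\<^sup>2 * t\<^sup>2"
      using log_mgf_perturb[OF gb F(2)[OF f], of "real s" t \<theta>] by simp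
    then have "\<phi> (\<theta>(f := \<theta> f + t)) \<le> (log_mgf (g \<theta>) (real s) + t * tilted_mean (g \<theta>) (real s) f + (B * real s)\<^sup>2 * t\<^sup>2) / real s"
      unfolding \<phi>_def by (rule divide_right_mono) simp
    also have "\<dots> = \<phi> \<theta> + t * (tilted_mean (g \<theta>) (real s) f / real s) + B\<^sup>2 * real s * t\<^sup>2"
      using s by (simp add: \<phi>_def add_divide_distrib power2_eq_square)
    finally show ?thesis .
  qed
  have zero: "\<phi> (\<lambda>_. 0) = 0"
  proof -
    have "block (\<lambda>_. 0) (real s) 0 = (\<lambda>_. 0)" by (auto simp: block_def set_lebesgue_integral_def)
    then show ?thesis by (simp add: \<phi>_def g_def log_mgf_def prob_space)
  qed
  have "\<exists>\<theta>. (\<forall>f\<in>F. \<bar>y f - tilted_mean (g \<theta>) (real s) f / real s - \<eta> * \<theta> f\<bar> \<le> \<zeta>) \<and>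
    - \<zeta> \<le> (\<Sum>f\<in>F. \<theta> f * y f) - \<phi> \<theta> - \<eta> / 2 * (\<Sum>f\<in>F. (\<theta> f)\<^sup>2)"
    by (rule regularised_near_maximiser[where Q="B\<^sup>2 * real s" and ?t0.0="1 / (B * real s)" and c=c and K=K])
      (use F(1) \<eta> \<zeta> B s zero le grad in auto)
  then show ?thesis using le unfolding y_def \<phi>_def by blast
qed

text \<open>Choice of constants: \<open>\<eta>\<close> makes the penalty \<open>\<eta> \<theta>\<close> small, then a long block length \<open>s\<close> makes
  the error terms of order \<open>1 / s\<close> small, and finally \<open>\<zeta>\<close> is small compared with both.\<close>

lemma tilt_with_small_error:
  fixes F :: "(real \<Rightarrow> real) set"
  assumes \<mu>: "\<mu> \<in> probs" and I: "Lambda_star M Z \<mu> \<le> ereal c" and c: "0 \<le> c"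
    and F: "finite F" "\<And>f. f \<in> F \<Longrightarrow> bounded_by B f" and B: "0 < B" and d: "0 < d" and e: "0 < e"
  defines "g \<equiv> \<lambda>\<theta> x. \<Sum>f\<in>F. \<theta> f * f x"
  shows "\<exists>(s::nat) \<theta>. 0 < s \<and> 2 * B * (real r / real s) \<le> d \<and>
    (\<forall>f\<in>F. \<bar>tilted_mean (g \<theta>) (real s) f / real s - (\<integral>x. f x \<partial>\<mu>)\<bar> \<le> 2 * d) \<and>
    (\<Sum>f\<in>F. \<theta> f * (tilted_mean (g \<theta>) (real s) f / real s)) - log_mgf (g \<theta>) (real s) / real s \<le> c + e"
proof -
  define k where "k = real (card F)"
  \<comment> \<open>With this \<eta> the term \<open>4 * \<eta> * (c + 1)\<close> is
    \<open>d\<^sup>2 / 2\<close>, half of the budget for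
    \<open>(\<eta> * \<theta> f)\<^sup>2\<close>. The next constant \<kappa> bounds both
    \<open>K\<close> and \<zeta>: its first bound fills the other half, its second controls the loss
    in the rate. The denominator \<open>k + 1\<close> also covers an empty \<open>F\<close>.\<close>
  define \<eta> where "\<eta> = d\<^sup>2 / (8 * (c + 1))"
  define \<kappa> where "\<kappa> = sqrt (min (d\<^sup>2 / 8) (\<eta> * e) / (k + 1))"
  define \<zeta> where "\<zeta> = min 1 (min d \<kappa>)"
  have k: "0 \<le> k" by (simp add: k_def)
  have \<eta>: "0 < \<eta>" using d c by (simp add: \<eta>_def)
  have \<kappa>: "0 < \<kappa>" using d \<eta> e k by (simp add: \<kappa>_def)
  have \<zeta>: "0 < \<zeta>" "\<zeta> \<le> 1" "\<zeta> \<le> d" "\<zeta> \<le> \<kappa>" using d \<kappa> by (simp_all add: \<zeta>_def)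
  have \<kappa>2: "k * \<kappa>\<^sup>2 \<le> d\<^sup>2 / 8" "k * \<kappa>\<^sup>2 \<le> \<eta> * e"
  proof -
    have "\<kappa>\<^sup>2 = min (d\<^sup>2 / 8) (\<eta> * e) / (k + 1)"
      unfolding \<kappa>_def using \<eta> e k by (intro real_sqrt_pow2) auto
    then have "(k + 1) * \<kappa>\<^sup>2 = min (d\<^sup>2 / 8) (\<eta> * e)" using k by simp
    moreover have "k * \<kappa>\<^sup>2 \<le> (k + 1) * \<kappa>\<^sup>2" by (intro mult_right_mono) auto
    ultimately show "k * \<kappa>\<^sup>2 \<le> d\<^sup>2 / 8" "k * \<kappa>\<^sup>2 \<le> \<eta> * e" by simp_all
  qed
  obtain s :: nat where s: "0 < s" "(4 * real r + 4) * B / \<kappa> \<le> real s" "2 * B * real r / d \<le> real s"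
  proof -
    obtain s1 :: nat where "(4 * real r + 4) * B / \<kappa> + 2 * B * real r / d \<le> real s1" using real_arch_simple by blast
    moreover have "0 \<le> (4 * real r + 4) * B / \<kappa>" "0 \<le> 2 * B * real r / d" using B \<kappa> d by simp_all
    ultimately show ?thesis by (intro that[of "Suc s1"]) auto
  qed
  define K where "K = (4 * real r + 4) * B / real s"
  have K: "0 \<le> K" "K \<le> \<kappa>" using s B \<kappa> by (simp_all add: K_def field_simps)
  obtain \<theta> where near: "\<And>f. f \<in> F \<Longrightarrow> \<bar>(\<integral>x. f x \<partial>\<mu>) - tilted_mean (g \<theta>) (real s) f / real s - \<eta> * \<theta> f\<bar> \<le> \<zeta>"
    and le: "(\<Sum>f\<in>F. \<theta> f * (\<integral>x. f x \<partial>\<mu>)) - log_mgf (g \<theta>) (real s) / real s \<le> c + K * (\<Sum>f\<in>F. \<bar>\<theta> f\<bar>)"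
    and ge: "- \<zeta> \<le> (\<Sum>f\<in>F. \<theta> f * (\<integral>x. f x \<partial>\<mu>)) - log_mgf (g \<theta>) (real s) / real s - \<eta> / 2 * (\<Sum>f\<in>F. (\<theta> f)\<^sup>2)"
    using regularised_tilt[OF \<mu> I F B s(1) \<eta> \<zeta>(1)] unfolding g_def K_def by blast
  let ?m = "\<lambda>f. tilted_mean (g \<theta>) (real s) f / real s"
  \<comment> \<open>Half of the penalty absorbs the linear error
    \<open>K * \<bar>\<theta> f\<bar>\<close>; the other half remains and bounds \<theta>.\<close>
  have sum_sq: "\<eta> / 4 * (\<Sum>f\<in>F. (\<theta> f)\<^sup>2) \<le> c + \<zeta> + k * (\<kappa>\<^sup>2 / \<eta>)"
  proof -
    have "(\<Sum>f\<in>F. K * \<bar>\<theta> f\<bar> - \<eta> / 4 * (\<theta> f)\<^sup>2) \<le> (\<Sum>f\<in>F. K\<^sup>2 / (4 * (\<eta> / 4)))"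
      using \<eta> by (intro sum_mono young_real) simp
    also have "\<dots> \<le> (\<Sum>f\<in>F. \<kappa>\<^sup>2 / \<eta>)"
      using \<eta> K by (intro sum_mono) (simp add: divide_right_mono power_mono)
    finally have "K * (\<Sum>f\<in>F. \<bar>\<theta> f\<bar>) - \<eta> / 4 * (\<Sum>f\<in>F. (\<theta> f)\<^sup>2) \<le> k * (\<kappa>\<^sup>2 / \<eta>)"
      by (simp add: sum_subtractf sum_distrib_left k_def)
    then show ?thesis using le ge by linarith
  qed
  have pen: "\<bar>\<eta> * \<theta> f\<bar> \<le> d" if f: "f \<in> F" for f
  proof -
    have "(\<theta> f)\<^sup>2 \<le> (\<Sum>f\<in>F. (\<theta> f)\<^sup>2)" using F(1) f by (intro member_le_sum) auto
    then have "\<eta> / 4 * (\<theta> f)\<^sup>2 \<le> \<eta> / 4 * (\<Sum>f\<in>F. (\<theta> f)\<^sup>2)" using \<eta> by (intro mult_left_mono) auto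
    also have "\<dots> \<le> c + 1 + k * (\<kappa>\<^sup>2 / \<eta>)" using sum_sq \<zeta>(2) by linarith
    finally have "4 * \<eta> * (\<eta> / 4 * (\<theta> f)\<^sup>2) \<le> 4 * \<eta> * (c + 1 + k * (\<kappa>\<^sup>2 / \<eta>))" using \<eta> by (intro mult_left_mono) auto
    then have "(\<eta> * \<theta> f)\<^sup>2 \<le> 4 * \<eta> * (c + 1) + 4 * (k * \<kappa>\<^sup>2)"
      using \<eta> by (simp add: power2_eq_square algebra_simps)
    also have "4 * \<eta> * (c + 1) = d\<^sup>2 / 2"
    proof -
      have "4 * (D / (8 * u)) * u = D / 2" if "u \<noteq> 0" for D u :: real using that by simp
      then show ?thesis unfolding \<eta>_def using c by (metis add_nonneg_pos less_irrefl zero_less_one)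
    qed
    finally have "(\<eta> * \<theta> f)\<^sup>2 \<le> d\<^sup>2" using \<kappa>2(1) by simp
    then show ?thesis using d by (simp add: abs_le_square_iff[symmetric])
  qed
  have "\<bar>?m f - (\<integral>x. f x \<partial>\<mu>)\<bar> \<le> 2 * d" if "f \<in> F" for f
    using near[OF that] pen[OF that] \<zeta>(3) by linarith
  moreover have "(\<Sum>f\<in>F. \<theta> f * ?m f) - log_mgf (g \<theta>) (real s) / real s \<le> c + e"
  proof -
    \<comment> \<open>The tilted mean misses the integral by about
      \<open>- \<eta> * \<theta> f\<close>, which lowers the rate by
      \<open>\<eta> * (\<theta> f)\<^sup>2\<close>. This gain pays for the linear errors with
      coefficients \<open>K\<close> and \<zeta>.\<close>
    have "(\<Sum>f\<in>F. \<theta> f * ?m f) \<le> (\<Sum>f\<in>F. \<theta> f * (\<integral>x. f x \<partial>\<mu>) - \<eta> * (\<theta> f)\<^sup>2 + \<zeta> * \<bar>\<theta> f\<bar>)"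
    proof (rule sum_mono)
      fix f assume "f \<in> F"
      have "\<theta> f * (?m f - (\<integral>x. f x \<partial>\<mu>) + \<eta> * \<theta> f) \<le> \<bar>\<theta> f\<bar> * \<bar>(\<integral>x. f x \<partial>\<mu>) - ?m f - \<eta> * \<theta> f\<bar>"
      proof -
        have v: "(\<integral>x. f x \<partial>\<mu>) - ?m f - \<eta> * \<theta> f = - (?m f - (\<integral>x. f x \<partial>\<mu>) + \<eta> * \<theta> f)" by simp
        show ?thesis unfolding v abs_minus_cancel abs_mult[symmetric] by (rule abs_ge_self)
      qed
      also have "\<dots> \<le> \<bar>\<theta> f\<bar> * \<zeta>" using near[OF \<open>f \<in> F\<close>] by (rule mult_left_mono) simp
      finally show "\<theta> f * ?m f \<le> \<theta> f * (\<integral>x. f x \<partial>\<mu>) - \<eta> * (\<theta> f)\<^sup>2 + \<zeta> * \<bar>\<theta> f\<bar>"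
        by (simp add: algebra_simps power2_eq_square)
    qed
    also have "\<dots> = (\<Sum>f\<in>F. \<theta> f * (\<integral>x. f x \<partial>\<mu>)) + (\<Sum>f\<in>F. \<zeta> * \<bar>\<theta> f\<bar> - \<eta> * (\<theta> f)\<^sup>2)"
      by (simp flip: sum.distrib) (intro sum.cong, auto)
    finally have "(\<Sum>f\<in>F. \<theta> f * ?m f) - log_mgf (g \<theta>) (real s) / real s \<le>
        c + (K * (\<Sum>f\<in>F. \<bar>\<theta> f\<bar>) + (\<Sum>f\<in>F. \<zeta> * \<bar>\<theta> f\<bar> - \<eta> * (\<theta> f)\<^sup>2))"
      using le by linarith
    also have "K * (\<Sum>f\<in>F. \<bar>\<theta> f\<bar>) + (\<Sum>f\<in>F. \<zeta> * \<bar>\<theta> f\<bar> - \<eta> * (\<theta> f)\<^sup>2) = (\<Sum>f\<in>F. (K + \<zeta>) * \<bar>\<theta> f\<bar> - \<eta> * (\<theta> f)\<^sup>2)"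
      by (simp add: sum_distrib_left algebra_simps flip: sum.distrib)
    also have "\<dots> \<le> (\<Sum>f\<in>F. (K + \<zeta>)\<^sup>2 / (4 * \<eta>))" by (intro sum_mono young_real \<eta>)
    also have "\<dots> \<le> (\<Sum>f\<in>F. (2 * \<kappa>)\<^sup>2 / (4 * \<eta>))"
      using K \<zeta> \<eta> by (intro sum_mono divide_right_mono power_mono) auto
    also have "\<dots> = k * \<kappa>\<^sup>2 / \<eta>" by (simp add: k_def power2_eq_square)
    also have "\<dots> \<le> e" using \<kappa>2(2) \<eta> by (simp add: pos_divide_le_eq mult.commute)
    finally show ?thesis by simp
  qed
  moreover have "2 * B * (real r / real s) \<le> d" using s d by (simp add: field_simps)
  ultimately show ?thesis using s(1) by blast
qed

lemma occupation_lower_bound: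
  assumes \<mu>: "\<mu> \<in> probs" and I: "Lambda_star M Z \<mu> \<le> ereal c" and c: "0 \<le> c"
    and F: "finite F" "F \<subseteq> bounded_measurable" and d: "0 < d" and e: "0 < e"
  shows "\<forall>\<^sub>F T in at_top. exp (- (T * (c + e))) \<le>
    prob {\<omega> \<in> space M. \<forall>f\<in>F. \<bar>(\<integral>x. f x \<partial>occupation T \<omega>) - (\<integral>x. f x \<partial>\<mu>)\<bar> < d}"
proof -
  define B where "B = 1 + (\<Sum>f\<in>F. bound_of f)"
  have bo: "0 \<le> bound_of f" if "f \<in> F" for f using bounded_byD(3)[OF bounded_by_bound_of] that F(2) by blast
  then have B: "0 < B" unfolding B_def by (intro add_pos_nonneg sum_nonneg) auto
  have Fb: "bounded_by B f" if "f \<in> F" for f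
  proof (rule bounded_by_mono[OF bounded_by_bound_of])
    show "bound_of f \<le> B" using member_le_sum[OF that _ F(1), of bound_of] bo by (auto simp: B_def)
  qed (use that F(2) in auto)
  \<comment> \<open>Of the distance \<open>d\<close>, one sixth goes to the gaps, two sixths to the
    tilted means, one sixth to the fluctuation \<delta> and one sixth to the incomplete last period.
    Of \<open>e\<close>, one quarter each goes to the tilt and to \<delta>; the remaining half
    absorbs the factor \<open>1 / 2\<close> from Chebyshev.\<close>
  have "0 < d / 6" "0 < e / 4" using d e by simp_all
  from tilt_with_small_error[OF \<mu> I c F(1) Fb B this]
  obtain s :: nat and \<theta> where s: "0 < s" "2 * B * (real r / real s) \<le> d / 6"
    and close: "\<And>f. f \<in> F \<Longrightarrow> \<bar>tilted_mean (\<lambda>x. \<Sum>f\<in>F. \<theta> f * f x) (real s) f / real s - (\<integral>x. f x \<partial>\<mu>)\<bar> \<le> 2 * (d / 6)"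
    and rate: "(\<Sum>f\<in>F. \<theta> f * (tilted_mean (\<lambda>x. \<Sum>f\<in>F. \<theta> f * f x) (real s) f / real s)) -
        log_mgf (\<lambda>x. \<Sum>f\<in>F. \<theta> f * f x) (real s) / real s \<le> c + e / 4"
    by blast
  let ?g = "\<lambda>x. \<Sum>f\<in>F. \<theta> f * f x"
  let ?m = "\<lambda>f. tilted_mean ?g (real s) f / real s"
  define \<delta> where "\<delta> = min (d / 6) (e / (4 * ((\<Sum>f\<in>F. \<bar>\<theta> f\<bar>) + 1)))"
  have sum0: "0 \<le> (\<Sum>f\<in>F. \<bar>\<theta> f\<bar>)" by (simp add: sum_nonneg)
  have "0 < e / (4 * ((\<Sum>f\<in>F. \<bar>\<theta> f\<bar>) + 1))"
    using e sum0 by (intro divide_pos_pos mult_pos_pos add_nonneg_pos) simp_all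
  then have \<delta>: "0 < \<delta>" "\<delta> \<le> d / 6"
    unfolding \<delta>_def using d by (simp_all only: min.cobounded1 min_less_iff_conj) simp
  have \<delta>sum: "\<delta> * (\<Sum>f\<in>F. \<bar>\<theta> f\<bar>) \<le> e / 4"
  proof -
    have "\<delta> * (\<Sum>f\<in>F. \<bar>\<theta> f\<bar>) \<le> e / (4 * ((\<Sum>f\<in>F. \<bar>\<theta> f\<bar>) + 1)) * ((\<Sum>f\<in>F. \<bar>\<theta> f\<bar>) + 1)"
      using e sum0 by (intro mult_mono) (simp_all add: \<delta>_def)
    also have "\<dots> = e / 4"
    proof -
      have "e / (4 * u) * u = e / 4" if "u \<noteq> 0" for u :: real using that by simp
      then show ?thesis using sum0 by (metis add_nonneg_pos less_irrefl zero_less_one)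
    qed
    finally show ?thesis .
  qed
  let ?\<tau> = "real (s + r)"
  define n where "n T = nat \<lfloor>T / ?\<tau>\<rfloor>" for T
  define Q where "Q = real (card F) * (4 * B\<^sup>2) / \<delta>\<^sup>2"
  have Q: "0 \<le> Q" by (simp add: Q_def)
  have \<tau>: "0 < ?\<tau>" using s by simp
  \<comment> \<open>The four thresholds make room for one full period, push the error of the
    incomplete period below \<open>d / 6\<close>, give more than \<open>2 * Q\<close> blocks, so
    that Chebyshev loses at most half of the mass, and ensure
    \<open>exp (- (T * (e / 2))) \<le> 1 / 2\<close>.\<close>
  have "\<forall>\<^sub>F T in at_top. max (max ?\<tau> (12 * B * ?\<tau> / d + 1)) (max (?\<tau> * (2 * Q + 1)) (2 * ln 2 / e)) \<le> T"
    by (rule eventually_ge_at_top)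
  then show ?thesis
  proof eventually_elim
    case (elim T)
    then have T: "?\<tau> \<le> T" "12 * B * ?\<tau> / d + 1 \<le> T" "?\<tau> * (2 * Q + 1) \<le> T" "2 * ln 2 / e \<le> T" by auto
    have T0: "0 < T" using T(1) \<tau> by linarith
    note bl = block_average_close[OF _ _ s(1) T(1), folded n_def]
    \<comment> \<open>The facts on \<open>n T\<close> are stated for some bounded function and some
      sample point; the zero function and an arbitrary point instantiate them.\<close>
    obtain f0 :: "real \<Rightarrow> real" where f0: "bounded_by 1 f0"
      using that[of "\<lambda>_. 0"] by (simp add: bounded_by_def)
    obtain \<omega>0 where \<omega>0: "\<omega>0 \<in> space M" using not_empty by blast
    have nT: "0 < n T" "real (n T) * real s \<le> T" "T < (real (n T) + 1) * ?\<tau>"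
      using bl(2-4)[OF f0 \<omega>0] by auto
    have "?\<tau> * (2 * Q + 1) < ?\<tau> * (real (n T) + 1)" using T(3) nT(3) by (simp add: mult.commute)
    then have nQ: "2 * Q < real (n T)" using \<tau> by simp
    let ?S = "\<lambda>f \<omega>. \<Sum>k<n T. block f (real s) (real (k * (s + r))) \<omega>"
    let ?G = "{\<omega> \<in> space M. \<forall>f\<in>F. \<bar>?S f \<omega> / (real (n T) * real s) - ?m f\<bar> < \<delta>}"
    let ?H = "{\<omega> \<in> space M. \<forall>f\<in>F. \<bar>(\<integral>x. f x \<partial>occupation T \<omega>) - (\<integral>x. f x \<partial>\<mu>)\<bar> < d}"
    have occ: "(\<integral>x. f x \<partial>occupation T \<omega>) = block f T 0 \<omega> / T" if "f \<in> F" "\<omega> \<in> space M" for f \<omega>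
      using integral_occupation[OF Fb[OF that(1)] that(2) T0] T0 by (simp add: field_simps)
    have H: "?H \<in> events"
    proof -
      have [measurable]: "block f T 0 \<in> borel_measurable M" if "f \<in> F" for f
        by (rule block_measurable[OF bounded_byD(1)[OF Fb[OF that]]])
      have "?H = {\<omega> \<in> space M. \<forall>f\<in>F. \<bar>block f T 0 \<omega> / T - (\<integral>x. f x \<partial>\<mu>)\<bar> < d}"
        by (intro Collect_cong conj_cong refl ball_cong) (simp add: occ)
      also have "\<dots> \<in> events" using F(1) by measurable
      finally show ?thesis .
    qed
    have sub: "?G \<subseteq> ?H"
    proof (intro subsetI CollectI conjI ballI)
      fix \<omega> f assume \<omega>: "\<omega> \<in> ?G" and f: "f \<in> F"
      then have w: "\<omega> \<in> space M" and lt: "\<bar>?S f \<omega> / (real (n T) * real s) - ?m f\<bar> < \<delta>" by auto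
      have "12 * B * ?\<tau> / d < T" using T(2) by linarith
      then have "2 * B * (?\<tau> / T) < d / 6" using T0 d by (simp add: field_simps)
      moreover have "\<bar>block f T 0 \<omega> / T - ?S f \<omega> / (real (n T) * real s)\<bar> \<le> 2 * B * (real r / real s) + 2 * B * (?\<tau> / T)"
        using bl(1)[OF Fb[OF f] w] by (simp only: distrib_left)
      ultimately show "\<bar>(\<integral>x. f x \<partial>occupation T \<omega>) - (\<integral>x. f x \<partial>\<mu>)\<bar> < d"
        unfolding occ[OF f w] using lt close[OF f] s(2) \<delta>(2) by linarith
    qed auto
    let ?R = "(\<Sum>f\<in>F. \<theta> f * ?m f) - log_mgf ?g (real s) / real s + \<delta> * (\<Sum>f\<in>F. \<bar>\<theta> f\<bar>)"
    have R: "?R \<le> c + e / 2" using rate \<delta>sum by linarith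
    have "1 / 2 \<le> 1 - Q / real (n T)" using nQ nT(1) by (simp add: field_simps)
    also have "Q / real (n T) = real (card F) * (4 * B\<^sup>2) / (real (n T) * \<delta>\<^sup>2)" by (simp add: Q_def mult.commute)
    also have "1 - \<dots> \<le> exp (real (n T) * (real s * ?R)) * prob ?G"
      by (rule tilted_block_average_lower_bound[OF F(1) Fb s(1) nT(1) \<delta>(1)])
    also have "\<dots> \<le> exp (T * (c + e / 2)) * prob ?H"
    proof (rule mult_mono)
      have "real (n T) * (real s * ?R) \<le> (real (n T) * real s) * (c + e / 2)"
        using R by (simp add: mult.assoc mult_left_mono)
      also have "\<dots> \<le> T * (c + e / 2)" using nT(2) c e by (intro mult_right_mono) auto
      finally show "exp (real (n T) * (real s * ?R)) \<le> exp (T * (c + e / 2))" by simp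
    qed (use finite_measure_mono[OF sub H] in auto)
    finally have half: "1 / 2 \<le> exp (T * (c + e / 2)) * prob ?H" .
    have "exp (- (T * (e / 2))) \<le> exp (- ln 2)" using T(4) e by (simp add: field_simps)
    also have "\<dots> = (1 / 2 :: real)" by (simp add: exp_minus inverse_eq_divide)
    finally have "exp (- (T * (e / 2))) \<le> exp (T * (c + e / 2)) * prob ?H" using half by linarith
    then have "exp (- (T * (c + e / 2))) * exp (- (T * (e / 2))) \<le> exp (- (T * (c + e / 2))) * (exp (T * (c + e / 2)) * prob ?H)"
      by (rule mult_left_mono) simp
    then have "exp (- (T * (c + e / 2)) - T * (e / 2)) \<le> prob ?H"
      by (simp add: mult.assoc[symmetric] flip: exp_add)
    also have "- (T * (c + e / 2)) - T * (e / 2) = - (T * (c + e))" by (simp add: algebra_simps)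
    finally show ?case .
  qed
qed

end

section \<open>Path segments of a stable Levy process\<close>

text \<open>Finitely many rational times are placed on one grid, where the independence axiom for
  increments along a monotone sequence applies.\<close>

lemma common_denominator:
  assumes "finite (J :: rat set)"
  shows "\<exists>q::nat. 0 < q \<and> (\<forall>r\<in>J. \<exists>c::int. of_rat r = real_of_int c / real q)"
  using assms
proof (induction J)
  case empty
  then show ?case by (intro exI[of _ 1]) simp
next
  case (insert r J)
  then obtain q :: nat where q: "0 < q" "\<forall>r\<in>J. \<exists>c::int. of_rat r = real_of_int c / real q" by blast
  obtain a b where ab: "quotient_of r = (a, b)" by fastforce
  then have b: "0 < b" and r: "r = of_int a / of_int b"
    by (auto intro: quotient_of_denom_pos quotient_of_div)
  have nb: "real (nat b) = real_of_int b" using b by simp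
  have "\<exists>c::int. of_rat s = real_of_int c / real (q * nat b)" if "s \<in> insert r J" for s
  proof (cases "s = r")
    case True
    have "of_rat r = real_of_int a / real_of_int b" by (simp add: r of_rat_divide)
    also have "\<dots> = real_of_int (a * int q) / real (q * nat b)" using q(1) b by (simp add: nb field_simps)
    finally show ?thesis using True by blast
  next
    case False
    then obtain c :: int where "of_rat s = real_of_int c / real q" using q(2) \<open>s \<in> insert r J\<close> by blast
    also have "\<dots> = real_of_int (c * b) / real (q * nat b)" using q(1) b by (simp add: nb field_simps)
    finally show ?thesis by blast
  qed
  then show ?case using q(1) b by (intro exI[of _ "q * nat b"]) auto
qed

context stable_levy_process
begin

definition increment :: "nat \<Rightarrow> int \<Rightarrow> 'a \<Rightarrow> real" where
  "increment q j \<omega> = S (real_of_int (j + 1) / real q) \<omega> - S (real_of_int j / real q) \<omega>"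

lemma increment_measurable: "increment q j \<in> borel_measurable M"
  unfolding increment_def[abs_def] using random_variable_S by measurable

lemma indep_increments: "indep_vars (\<lambda>_. borel) (\<lambda>i. increment q (j + int i)) {..<n}"
proof -
  have "mono (\<lambda>i::nat. real_of_int (j + int i) / real q)"
    by (intro monoI divide_right_mono) auto
  from independent_increments[OF this, of n] show ?thesis
    unfolding increment_def[abs_def] by (simp add: add.assoc add.commute add.left_commute)
qed

lemma distr_increment: "distr M borel (increment q j) = distr M borel (increment q 0)"
  using stationary_increments[of 0 "1 / real q" "real_of_int j / real q"]
  by (simp add: increment_def[abs_def] add_divide_distrib add.commute)

lemma sum_increments:
  "(\<Sum>i<m. increment q (j + int i) \<omega>) = S (real_of_int (j + int m) / real q) \<omega> - S (real_of_int j / real q) \<omega>"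
proof (induction m)
  case (Suc m)
  then show ?case by (simp add: increment_def add.assoc add.commute add.left_commute)
qed simp

definition increment_block :: "nat \<Rightarrow> nat \<Rightarrow> int \<Rightarrow> 'a \<Rightarrow> nat \<Rightarrow> real" where
  "increment_block q N j \<omega> = (\<lambda>i\<in>{..<N}. increment q (j + int i) \<omega>)"

lemma increment_block_measurable:
  "increment_block q N j \<in> measurable M (\<Pi>\<^sub>M i\<in>{..<N}. borel)"
  unfolding increment_block_def[abs_def] by (intro measurable_restrict increment_measurable)

lemma distr_increment_block:
  "distr M (\<Pi>\<^sub>M i\<in>{..<N}. borel) (increment_block q N j) = distr M (\<Pi>\<^sub>M i\<in>{..<N}. borel) (increment_block q N 0)"
proof (cases "N = 0")
  \<comment> \<open>An empty block is treated apart because the characterisation of independence by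
    a product law asks for a nonempty index set.\<close>
  case True
  have "increment_block q N j = increment_block q N 0" by (auto simp: increment_block_def True fun_eq_iff)
  then show ?thesis by simp
next
  case False
  have *: "distr M (\<Pi>\<^sub>M i\<in>{..<N}. borel) (increment_block q N j) = (\<Pi>\<^sub>M i\<in>{..<N}. distr M borel (increment q 0))" for j
  proof -
    have "{..<N} \<noteq> {}" using False by auto
    from indep_vars_iff_distr_eq_PiM'[OF this, of "\<lambda>i. increment q (j + int i)" "\<lambda>_. borel"]
    have "distr M (\<Pi>\<^sub>M i\<in>{..<N}. borel) (increment_block q N j) = (\<Pi>\<^sub>M i\<in>{..<N}. distr M borel (increment q (j + int i)))"
      using indep_increments increment_measurable by (simp add: increment_block_def[abs_def])
    then show ?thesis by (simp only: distr_increment[of q "j + int _"])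
  qed
  show ?thesis by (simp only: *)
qed

text \<open>Functions of disjoint groups of independent variables are independent. Each group is
  reindexed by \<open>{..<N}\<close> so that all blocks take values in the same space.\<close>

lemma indep_increment_blocks:
  "indep_vars (\<lambda>_. \<Pi>\<^sub>M i\<in>{..<N}. borel) (\<lambda>k. increment_block q N (j + int (k * N))) {..<n}"
proof -
  define K where "K k = {k * N..<k * N + N}" for k
  have K: "K k \<subseteq> {..<n * N}" if "k < n" for k
  proof -
    have "k * N + N = Suc k * N" by simp
    also have "\<dots> \<le> n * N" using that by (intro mult_right_mono) auto
    finally show ?thesis by (auto simp: K_def)
  qed
  have disj: "disjoint_family_on K {..<n}"
    unfolding disjoint_family_on_def
  proof (intro ballI impI)
    fix a b assume "a \<in> {..<n}" "b \<in> {..<n}" "a \<noteq> b"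
    have "K a \<inter> K b = {}" if "a < b" for a b
    proof -
      have "a * N + N = Suc a * N" by simp
      also have "\<dots> \<le> b * N" using that by (intro mult_right_mono) auto
      finally show ?thesis by (auto simp: K_def)
    qed
    then show "K a \<inter> K b = {}" using \<open>a \<noteq> b\<close> by (metis inf_commute nat_neq_iff)
  qed
  have ind: "indep_vars (\<lambda>k. \<Pi>\<^sub>M i\<in>K k. borel) (\<lambda>k \<omega>. \<lambda>i\<in>K k. increment q (j + int i) \<omega>) {..<n}"
    by (rule indep_vars_restrict[OF indep_increments _ disj]) (use K in auto)
  have m: "(\<lambda>x. \<lambda>i\<in>{..<N}. x (k * N + i)) \<in> measurable (\<Pi>\<^sub>M i\<in>K k. borel) (\<Pi>\<^sub>M i\<in>{..<N}. (borel :: real measure))" for k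
    by (intro measurable_restrict measurable_component_singleton) (auto simp: K_def)
  have "indep_vars (\<lambda>_. \<Pi>\<^sub>M i\<in>{..<N}. borel) (\<lambda>k \<omega>. \<lambda>i\<in>{..<N}. (\<lambda>i\<in>K k. increment q (j + int i) \<omega>) (k * N + i)) {..<n}"
    by (rule indep_vars_compose2[OF ind m])
  moreover have "(\<lambda>i\<in>{..<N}. (\<lambda>i\<in>K k. increment q (j + int i) \<omega>) (k * N + i)) = increment_block q N (j + int (k * N)) \<omega>" for k \<omega>
    by (auto simp: increment_block_def K_def fun_eq_iff add.assoc)
  ultimately show ?thesis by simp
qed

text \<open>The path segment that determines the moving average on \<open>[h, h + T]\<close>. One extra unit of
  time on the right leaves room for the rational approximation from above.\<close>

definition path_segment :: "nat \<Rightarrow> nat \<Rightarrow> real \<Rightarrow> 'a \<Rightarrow> rat \<Rightarrow> real" where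
  "path_segment R T h \<omega> q = S (h + max (- real R) (min (real T + real R + 1) (of_rat q))) \<omega> - S h \<omega>"

lemma path_segment_measurable: "path_segment R T h \<in> measurable M (\<Pi>\<^sub>M q\<in>UNIV. borel)"
  unfolding path_segment_def[abs_def] using random_variable_S
  by (intro measurable_PiM_single') (auto intro!: borel_measurable_diff)

text \<open>The period \<open>T + (2 * R + 1)\<close> is exactly \<open>N\<close> grid steps, and
  block \<open>k\<close> of increments starts \<open>R\<close> to the left of its reference time, at
  index \<open>- int (R * q) + int (k * N)\<close>. It therefore ends \<open>T + R + 1\<close> to
  the right, where the next block starts. The first \<open>R * q\<close> increments lead to the
  reference time, the first \<open>m r\<close> to the clamped time of \<open>r\<close>. The numbers
  \<open>q\<close>, \<open>N\<close> and \<open>m\<close> are the same for all \<open>k\<close>, so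
  that laws can be compared across blocks.\<close>

lemma path_segment_grid:
  assumes J: "finite J"
  shows "\<exists>(q :: nat) (N :: nat) (m :: rat \<Rightarrow> nat). R * q \<le> N \<and> (\<forall>r\<in>J. m r \<le> N) \<and>
    (\<forall>k \<omega>. \<forall>r\<in>J. path_segment R T (real (k * (T + (2 * R + 1)))) \<omega> r =
      (\<Sum>i<m r. increment_block q N (- int (R * q) + int (k * N)) \<omega> i) -
      (\<Sum>i<R * q. increment_block q N (- int (R * q) + int (k * N)) \<omega> i))"
proof -
  obtain q :: nat where q: "0 < q" and "\<forall>r\<in>J. \<exists>c::int. of_rat r = real_of_int c / real q"
    using common_denominator[OF J] by blast
  then obtain c :: "rat \<Rightarrow> int" where c: "\<And>r. r \<in> J \<Longrightarrow> of_rat r = real_of_int (c r) / real q" by metis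
  define N where "N = (T + (2 * R + 1)) * q"
  \<comment> \<open>The clamped time in grid units; shifted by \<open>R * q\<close> it counts the
    increments from the left end of the block.\<close>
  define c' where "c' r = max (- int (R * q)) (min (int ((T + R + 1) * q)) (c r))" for r
  define m where "m r = nat (c' r + int (R * q))" for r
  have c'_le: "- int (R * q) \<le> c' r" "c' r \<le> int ((T + R + 1) * q)" for r
    unfolding c'_def by (auto intro: order_trans[of _ 0])
  have m_int: "int (m r) = c' r + int (R * q)" for r using c'_le(1)[of r] by (simp add: m_def)
  have RN: "R * q \<le> N" by (simp add: N_def distrib_right)
  have mN: "m r \<le> N" for r
  proof -
    have "int (m r) \<le> int ((T + R + 1) * q) + int (R * q)" using c'_le(2)[of r] by (simp only: m_int add_right_mono)
    also have "\<dots> = int N" by (simp add: N_def algebra_simps)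
    finally show ?thesis by simp
  qed
  have sum_block: "(\<Sum>i<l. increment_block q N j \<omega> i) = S (real_of_int (j + int l) / real q) \<omega> - S (real_of_int j / real q) \<omega>"
    if "l \<le> N" for l j \<omega>
  proof -
    have "(\<Sum>i<l. increment_block q N j \<omega> i) = (\<Sum>i<l. increment q (j + int i) \<omega>)"
      using that by (intro sum.cong) (auto simp: increment_block_def)
    then show ?thesis by (simp only: sum_increments)
  qed
  have "path_segment R T (real (k * (T + (2 * R + 1)))) \<omega> r =
      (\<Sum>i<m r. increment_block q N (- int (R * q) + int (k * N)) \<omega> i) -
      (\<Sum>i<R * q. increment_block q N (- int (R * q) + int (k * N)) \<omega> i)" if r: "r \<in> J" for k \<omega> r
  proof -
    let ?h = "real (k * (T + (2 * R + 1)))"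
    have "real_of_int (c' r) / real q = max (real_of_int (- int (R * q)) / real q)
        (min (real_of_int (int ((T + R + 1) * q)) / real q) (real_of_int (c r) / real q))"
      unfolding c'_def of_int_max of_int_min using q by (simp only: max_divide_distrib_right min_divide_distrib_right of_nat_0_le_iff if_True)
    also have "real_of_int (- int (R * q)) / real q = - real R" using q by simp
    also have "real_of_int (int ((T + R + 1) * q)) / real q = real T + real R + 1"
    proof -
      have "real_of_int (int ((T + R + 1) * q)) = (real T + real R + 1) * real q" by (simp add: algebra_simps)
      then show ?thesis using q by (simp only: nonzero_mult_div_cancel_right of_nat_eq_0_iff)
    qed
    also note c[OF r, symmetric]
    finally have clamp: "max (- real R) (min (real T + real R + 1) (of_rat r)) = real_of_int (c' r) / real q" by simp
    have kN: "real (k * N) = ?h * real q" by (simp add: N_def algebra_simps)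
    have kNq: "real (k * N) / real q = ?h"
      unfolding kN using q by (intro nonzero_mult_div_cancel_right) simp
    have "real_of_int (- int (R * q) + int (k * N) + int (R * q)) = real (k * N)" by simp
    then have h: "real_of_int (- int (R * q) + int (k * N) + int (R * q)) / real q = ?h"
      by (simp only: kNq)
    have "real_of_int (- int (R * q) + int (k * N) + int (m r)) = real (k * N) + real_of_int (c' r)"
      unfolding m_int by simp
    then have hm: "real_of_int (- int (R * q) + int (k * N) + int (m r)) / real q = ?h + real_of_int (c' r) / real q"
      by (simp only: add_divide_distrib kNq)
    show ?thesis
      unfolding sum_block[OF mN] sum_block[OF RN] h hm path_segment_def clamp by simp
  qed
  then show ?thesis using RN mN by (intro exI[of _ q] exI[of _ N] exI[of _ m]) blast
qed

lemma grid_event_measurable: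
  assumes J: "finite J" "\<And>r. r \<in> J \<Longrightarrow> E r \<in> sets borel" and m: "\<And>r. r \<in> J \<Longrightarrow> m r \<le> N" "l \<le> N"
  shows "{x \<in> space (\<Pi>\<^sub>M i\<in>{..<N::nat}. borel). \<forall>r\<in>J. (\<Sum>i<m r. x i) - (\<Sum>i<l. x i) \<in> (E r :: real set)} \<in> sets (\<Pi>\<^sub>M i\<in>{..<N}. borel)"
proof -
  have "(\<lambda>x. (\<Sum>i<m r. x i) - (\<Sum>i<l. x i)) \<in> borel_measurable (\<Pi>\<^sub>M i\<in>{..<N}. (borel :: real measure))" if "r \<in> J" for r
    using m(1)[OF that] m(2) by (intro borel_measurable_diff borel_measurable_sum measurable_component_singleton) auto
  then have "(\<lambda>x. (\<Sum>i<m r. x i) - (\<Sum>i<l. x i)) -` E r \<inter> space (\<Pi>\<^sub>M i\<in>{..<N}. borel) \<in> sets (\<Pi>\<^sub>M i\<in>{..<N}. borel)" if "r \<in> J" for r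
    using J(2)[OF that] that by (intro measurable_sets)
  then have "{x \<in> space (\<Pi>\<^sub>M i\<in>{..<N}. borel). (\<Sum>i<m r. x i) - (\<Sum>i<l. x i) \<in> E r} \<in> sets (\<Pi>\<^sub>M i\<in>{..<N}. borel)" if "r \<in> J" for r
    using that by (simp add: vimage_def Int_def conj_commute)
  then show ?thesis using J(1) by (intro sets.sets_Collect_finite_All)
qed

text \<open>Cylinder sets form an intersection-stable generator, and each involves finitely many
  rational times. On such sets the segments are functions of disjoint blocks of increments.\<close>

lemma indep_path_segments:
  "indep_vars (\<lambda>_. \<Pi>\<^sub>M q\<in>UNIV. borel) (\<lambda>k. path_segment R T (real (k * (T + (2 * R + 1))))) {..<n}"
proof (cases "n = 0")
  case True
  then show ?thesis by (simp add: indep_vars_def indep_sets_def)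
next
  case False
  let ?P = "\<lambda>k. path_segment R T (real (k * (T + (2 * R + 1))))"
  let ?E = "prod_algebra (UNIV :: rat set) (\<lambda>_. borel :: real measure)"
  have "indep_vars (\<lambda>_. \<Pi>\<^sub>M q\<in>UNIV. borel) ?P {..<n} \<longleftrightarrow>
      (\<forall>A\<in>(\<Pi> i\<in>{..<n}. ?E). prob (\<Inter>j\<in>{..<n}. ?P j -` A j \<inter> space M) = (\<Prod>j\<in>{..<n}. prob (?P j -` A j \<inter> space M)))"
  proof (rule indep_vars_finite)
    show "sets (\<Pi>\<^sub>M q\<in>(UNIV :: rat set). (borel :: real measure)) = sigma_sets (space (\<Pi>\<^sub>M q\<in>UNIV. borel)) ?E"
      by (simp add: sets_PiM space_PiM)
    show "Int_stable ?E" by (rule Int_stable_prod_algebra)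
    show "space (\<Pi>\<^sub>M q\<in>(UNIV :: rat set). (borel :: real measure)) \<in> ?E"
      unfolding space_PiM by (rule space_in_prod_algebra)
    show "?E \<subseteq> Pow (space (\<Pi>\<^sub>M q\<in>(UNIV :: rat set). (borel :: real measure)))"
      unfolding space_PiM by (rule prod_algebra_sets_into_space)
  qed (use False path_segment_measurable in auto)
  moreover have "prob (\<Inter>j\<in>{..<n}. ?P j -` A j \<inter> space M) = (\<Prod>j\<in>{..<n}. prob (?P j -` A j \<inter> space M))"
    if A: "A \<in> (\<Pi> i\<in>{..<n}. ?E)" for A
  proof -
    have "\<exists>J E. A k = prod_emb UNIV (\<lambda>_. borel) J (\<Pi>\<^sub>E j\<in>J. E j) \<and> finite J \<and> (\<forall>r\<in>J. E r \<in> sets (borel :: real measure))" if "k < n" for k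
      using prod_algebraE[of "A k" UNIV "\<lambda>_. borel"] A that by (metis PiE Pi_mem lessThan_iff)
    then obtain J E where JE: "\<And>k. k < n \<Longrightarrow> A k = prod_emb UNIV (\<lambda>_. borel) (J k) (\<Pi>\<^sub>E j\<in>J k. E k j)"
      "\<And>k. k < n \<Longrightarrow> finite (J k)" "\<And>k r. k < n \<Longrightarrow> r \<in> J k \<Longrightarrow> E k r \<in> sets (borel :: real measure)" by metis
    \<comment> \<open>The times of all \<open>n\<close> cylinder sets are collected first, so that
      one grid serves every segment.\<close>
    have fin: "finite (\<Union>k<n. J k)" using JE(2) by auto
    obtain q N :: nat and m :: "rat \<Rightarrow> nat" where RN: "R * q \<le> N" and m: "\<forall>r\<in>(\<Union>k<n. J k). m r \<le> N"
      and grid: "\<forall>k \<omega>. \<forall>r\<in>(\<Union>k<n. J k). ?P k \<omega> r =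
        (\<Sum>i<m r. increment_block q N (- int (R * q) + int (k * N)) \<omega> i) -
        (\<Sum>i<R * q. increment_block q N (- int (R * q) + int (k * N)) \<omega> i)"
      using path_segment_grid[OF fin, where R=R and T=T] by (elim exE conjE) (rule that)
    let ?X = "\<lambda>k. increment_block q N (- int (R * q) + int (k * N))"
    define A' where "A' k = {x \<in> space (\<Pi>\<^sub>M i\<in>{..<N}. borel). \<forall>r\<in>J k. (\<Sum>i<m r. x i) - (\<Sum>i<R * q. x i) \<in> E k r}" for k
    have A': "A' k \<in> sets (\<Pi>\<^sub>M i\<in>{..<N}. borel)" if "k < n" for k
      unfolding A'_def using JE(2,3)[OF that] RN m that by (intro grid_event_measurable) auto
    have X_space: "?X k \<omega> \<in> space (\<Pi>\<^sub>M i\<in>{..<N}. (borel :: real measure))" if "\<omega> \<in> space M" for k \<omega>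
      by (rule measurable_space[OF increment_block_measurable that])
    have eq: "?P k -` A k \<inter> space M = ?X k -` A' k \<inter> space M" if k: "k < n" for k
    proof -
      have "?P k \<omega> \<in> A k \<longleftrightarrow> (\<forall>r\<in>J k. ?P k \<omega> r \<in> E k r)" for \<omega>
        unfolding JE(1)[OF k] by (auto simp: prod_emb_def PiE_iff restrict_def extensional_def)
      moreover have "?P k \<omega> r = (\<Sum>i<m r. ?X k \<omega> i) - (\<Sum>i<R * q. ?X k \<omega> i)" if "r \<in> J k" for r \<omega>
        using grid that k by auto
      ultimately show ?thesis using X_space by (auto simp: A'_def)
    qed
    have "prob (\<Inter>j\<in>{..<n}. ?X j -` A' j \<inter> space M) = (\<Prod>j\<in>{..<n}. prob (?X j -` A' j \<inter> space M))"
      by (rule indep_varsD_finite[OF indep_increment_blocks]) (use False A' in auto)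
    moreover have "(\<Inter>j\<in>{..<n}. ?P j -` A j \<inter> space M) = (\<Inter>j\<in>{..<n}. ?X j -` A' j \<inter> space M)"
      using eq by (intro INF_cong) auto
    moreover have "(\<Prod>j\<in>{..<n}. prob (?P j -` A j \<inter> space M)) = (\<Prod>j\<in>{..<n}. prob (?X j -` A' j \<inter> space M))"
      using eq by (intro prod.cong) auto
    ultimately show ?thesis by simp
  qed
  ultimately show ?thesis by blast
qed

text \<open>Laws on the product agree once they agree on cylinder sets. There both segments are the
  same functional of increment blocks, whose law does not depend on the starting index.\<close>

lemma distr_path_segment:
  "distr M (\<Pi>\<^sub>M q\<in>UNIV. borel) (path_segment R T (real (k * (T + (2 * R + 1))))) =
   distr M (\<Pi>\<^sub>M q\<in>UNIV. borel) (path_segment R T 0)"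
proof -
  let ?P = "\<lambda>k. path_segment R T (real (k * (T + (2 * R + 1))))"
  let ?B = "\<Pi>\<^sub>M q\<in>(UNIV :: rat set). (borel :: real measure)"
  have "distr M ?B (?P k) = distr M ?B (?P 0)"
  proof (rule measure_eqI_PiM_infinite)
    interpret D: prob_space "distr M ?B (?P k)" by (rule prob_space_distr[OF path_segment_measurable])
    show "finite_measure (distr M ?B (?P k))" by unfold_locales
    fix E and J :: "rat set" assume J: "finite J" and E: "\<And>i. i \<in> J \<Longrightarrow> E i \<in> sets (borel :: real measure)"
    obtain q N :: nat and m :: "rat \<Rightarrow> nat" where RN: "R * q \<le> N" and m: "\<forall>r\<in>J. m r \<le> N"
      and grid: "\<forall>k \<omega>. \<forall>r\<in>J. ?P k \<omega> r =
        (\<Sum>i<m r. increment_block q N (- int (R * q) + int (k * N)) \<omega> i) -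
        (\<Sum>i<R * q. increment_block q N (- int (R * q) + int (k * N)) \<omega> i)"
      using path_segment_grid[OF J, where R=R and T=T] by (elim exE conjE) (rule that)
    let ?X = "\<lambda>k. increment_block q N (- int (R * q) + int (k * N))"
    let ?N = "\<Pi>\<^sub>M i\<in>{..<N}. (borel :: real measure)"
    define A' where "A' = {x \<in> space ?N. \<forall>r\<in>J. (\<Sum>i<m r. x i) - (\<Sum>i<R * q. x i) \<in> E r}"
    let ?A = "prod_emb UNIV (\<lambda>_. borel) J (\<Pi>\<^sub>E j\<in>J. E j)"
    have A: "?A \<in> sets ?B" using J E by (intro sets_PiM_I) auto
    have A': "A' \<in> sets ?N" unfolding A'_def using J E RN m by (intro grid_event_measurable) auto
    have em: "emeasure (distr M ?B (?P k)) ?A = emeasure (distr M ?N (?X k)) A'" for k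
    proof -
      have "?P k -` ?A \<inter> space M = ?X k -` A' \<inter> space M"
      proof -
        have "?P k \<omega> \<in> ?A \<longleftrightarrow> (\<forall>r\<in>J. ?P k \<omega> r \<in> E r)" for \<omega>
          by (auto simp: prod_emb_def PiE_iff restrict_def extensional_def)
        moreover have "?X k \<omega> \<in> space ?N" if "\<omega> \<in> space M" for \<omega>
          by (rule measurable_space[OF increment_block_measurable that])
        moreover have "?P k \<omega> r = (\<Sum>i<m r. ?X k \<omega> i) - (\<Sum>i<R * q. ?X k \<omega> i)" if "r \<in> J" for r \<omega>
          using grid that by blast
        ultimately show ?thesis by (auto simp: A'_def)
      qed
      then show ?thesis
        using A A' path_segment_measurable increment_block_measurable by (simp add: emeasure_distr)
    qed
    show "emeasure (distr M ?B (?P k)) ?A = emeasure (distr M ?B (?P 0)) ?A"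
      unfolding em using distr_increment_block by metis
  qed simp_all
  then show ?thesis by simp
qed

end

section \<open>The large deviation principle\<close>

lemma (in prob_space) indep_vars_cong_space:
  assumes eq: "\<And>i \<omega>. i \<in> I \<Longrightarrow> \<omega> \<in> space M \<Longrightarrow> X i \<omega> = Y i \<omega>"
  shows "indep_vars N X I \<longleftrightarrow> indep_vars N Y I"
proof -
  have "X i -` A \<inter> space M = Y i -` A \<inter> space M" if "i \<in> I" for i A using eq that by auto
  then show ?thesis
    unfolding indep_vars_def2 using eq by (intro conj_cong ball_cong indep_sets_cong measurable_cong) auto
qed

context stable_levy_process
begin

lemma rational_path_measurable:
  "(\<lambda>\<omega> q. c * S (a * of_rat q) \<omega>) \<in> measurable M (\<Pi>\<^sub>M q\<in>(UNIV :: rat set). borel)"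
  using random_variable_S by (intro measurable_PiM_single') auto

text \<open>The equality in law of the whole processes is projected to rational times, the
  coordinates that \<open>smoothing\<close> reads.\<close>

lemma rational_path_self_similar:
  assumes a: "0 < a"
  shows "distr M (\<Pi>\<^sub>M q\<in>(UNIV :: rat set). borel) (\<lambda>\<omega> q. a powr (- 1 / \<alpha>) * S (a * of_rat q) \<omega>) =
    distr M (\<Pi>\<^sub>M q\<in>(UNIV :: rat set). borel) (\<lambda>\<omega> q. S (of_rat q) \<omega>)"
proof -
  let ?P = "\<Pi>\<^sub>M t\<in>(UNIV :: real set). (borel :: real measure)" and ?Q = "\<Pi>\<^sub>M q\<in>(UNIV :: rat set). (borel :: real measure)"
  define h where "h g q = a powr (- 1 / \<alpha>) * g (of_rat q)" for g :: "real \<Rightarrow> real" and q :: rat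
  have h: "h \<in> measurable ?P ?Q"
    unfolding h_def[abs_def]
    by (intro measurable_PiM_single' borel_measurable_times borel_measurable_const measurable_component_singleton) auto
  have m1: "(\<lambda>\<omega> t. S (a * t) \<omega>) \<in> measurable M ?P" and m2: "(\<lambda>\<omega> t. a powr (1 / \<alpha>) * S t \<omega>) \<in> measurable M ?P"
    using random_variable_S by (auto intro!: measurable_PiM_single')
  have "distr M ?Q (\<lambda>\<omega> q. a powr (- 1 / \<alpha>) * S (a * of_rat q) \<omega>) = distr (distr M ?P (\<lambda>\<omega> t. S (a * t) \<omega>)) ?Q h"
    by (subst distr_distr[OF h m1]) (simp add: h_def[abs_def] comp_def)
  also have "\<dots> = distr (distr M ?P (\<lambda>\<omega> t. a powr (1 / \<alpha>) * S t \<omega>)) ?Q h"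
    unfolding self_similar[OF a] ..
  also have "\<dots> = distr M ?Q (\<lambda>\<omega> q. S (of_rat q) \<omega>)"
  proof -
    have cancel: "a powr (- 1 / \<alpha>) * (a powr (1 / \<alpha>) * x) = x" for x
      using a by (simp add: powr_add[symmetric] mult.assoc[symmetric])
    show ?thesis unfolding distr_distr[OF h m2] by (simp only: h_def[abs_def] comp_def cancel)
  qed
  finally show ?thesis .
qed

end

locale levy_moving_average =
  stable_levy_process M \<alpha> S +
  compact_signed_measure "interval_measure (pos_variation \<psi>)" "interval_measure (neg_variation \<psi>)" R
  for M :: "'a measure" and \<alpha> :: real and S :: "real \<Rightarrow> 'a \<Rightarrow> real" and \<psi> :: "real \<Rightarrow> real" and R :: nat
begin

lemma signed_integral_stieltjes: "signed_integral h = stieltjes_integral h \<psi>"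
  by (simp add: signed_integral_def stieltjes_integral_def)

text \<open>The scale \<epsilon> is moved into the path and the time variable; the averaging
  functional stays the same for all scales.\<close>

lemma moving_average_smoothing:
  assumes e: "0 < \<epsilon>" and w: "\<omega> \<in> space M"
  shows "moving_average \<alpha> S \<psi> \<epsilon> t \<omega> = smoothing (\<lambda>q. \<epsilon> powr (- 1 / \<alpha>) * S (\<epsilon> * of_rat q) \<omega>) (t / \<epsilon>)"
proof -
  have "cadlag (\<lambda>x. \<epsilon> powr (- 1 / \<alpha>) * S (0 + \<epsilon> * x) \<omega> - 0)"
    by (rule cadlag_affine[OF cadlag_paths[OF w] e])
  then have "smoothing (\<lambda>q. \<epsilon> powr (- 1 / \<alpha>) * S (\<epsilon> * of_rat q) \<omega>) (t / \<epsilon>) =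
      signed_integral (\<lambda>u. \<epsilon> powr (- 1 / \<alpha>) * S (\<epsilon> * (t / \<epsilon> - u)) \<omega>)"
    using smoothing_cadlag by simp
  also have "\<dots> = \<epsilon> powr (- 1 / \<alpha>) * signed_integral (\<lambda>u. S (t - \<epsilon> * u) \<omega>)"
    unfolding signed_integral_cmult using e by (simp add: right_diff_distrib)
  finally show ?thesis by (simp add: moving_average_def signed_integral_stieltjes)
qed

lemma moving_average_measurable:
  assumes e: "0 < \<epsilon>"
  shows "(\<lambda>(t, \<omega>). moving_average \<alpha> S \<psi> \<epsilon> t \<omega>) \<in> borel_measurable (borel \<Otimes>\<^sub>M M)"
proof -
  have "(\<lambda>x. (fst x / \<epsilon>, \<lambda>q. \<epsilon> powr (- 1 / \<alpha>) * S (\<epsilon> * of_rat q) (snd x)))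
      \<in> measurable (borel \<Otimes>\<^sub>M M) (borel \<Otimes>\<^sub>M (\<Pi>\<^sub>M q\<in>(UNIV :: rat set). borel))"
    by (intro measurable_Pair measurable_compose[OF measurable_snd rational_path_measurable]) measurable
  from measurable_compose[OF this smoothing_measurable]
  have "(\<lambda>x. smoothing (\<lambda>q. \<epsilon> powr (- 1 / \<alpha>) * S (\<epsilon> * of_rat q) (snd x)) (fst x / \<epsilon>)) \<in> borel_measurable (borel \<Otimes>\<^sub>M M)"
    by simp
  also have "?this \<longleftrightarrow> (\<lambda>x. moving_average \<alpha> S \<psi> \<epsilon> (fst x) (snd x)) \<in> borel_measurable (borel \<Otimes>\<^sub>M M)"
    by (intro measurable_cong) (auto simp: moving_average_smoothing[OF e] space_pair_measure)
  finally show ?thesis by (simp add: case_prod_unfold)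
qed

text \<open>Subtracting \<open>S h\<close> is harmless because the signed measure has mass zero, and
  clamping the path is harmless because \<open>smoothing\<close> at times in \<open>[0, T]\<close>
  does not look beyond the segment.\<close>

lemma moving_average_path_segment:
  assumes w: "\<omega> \<in> space M" and t: "0 \<le> t" "t \<le> real T"
  shows "moving_average \<alpha> S \<psi> 1 (h + t) \<omega> = smoothing (path_segment R T h \<omega>) t"
proof -
  let ?s = "\<lambda>x. S x \<omega>"
  note s = cadlag_paths[OF w]
  have [measurable]: "?s \<in> borel_measurable borel" by (rule cadlag_measurable[OF s])
  have "\<exists>C. \<forall>x\<in>{h + t - real R..h + t + real R}. \<bar>?s x\<bar> \<le> C" by (rule cadlag_bounded[OF s]) simp
  then obtain C where C: "\<And>x. x \<in> {h + t - real R..h + t + real R} \<Longrightarrow> \<bar>?s x\<bar> \<le> C" by blast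
  have "cadlag (\<lambda>x. 1 * ?s (h + 1 * x) - ?s h)" by (rule cadlag_affine[OF s]) simp
  then have "smoothing (\<lambda>q. ?s (h + of_rat q) - ?s h) t = signed_integral (\<lambda>u. ?s (h + (t - u)) - ?s h)"
    using smoothing_cadlag by simp
  also have "\<dots> = signed_integral (\<lambda>u. ?s (h + (t - u)))"
    by (rule signed_integral_diff_const[where C=C]) (auto intro!: C)
  also have "\<dots> = moving_average \<alpha> S \<psi> 1 (h + t) \<omega>"
    by (simp add: moving_average_def signed_integral_stieltjes algebra_simps)
  finally have "moving_average \<alpha> S \<psi> 1 (h + t) \<omega> = smoothing (\<lambda>q. ?s (h + of_rat q) - ?s h) t" by simp
  also have "\<dots> = smoothing (path_segment R T h \<omega>) t"
    by (rule smoothing_cong[OF _ t]) (simp add: path_segment_def)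
  finally show ?thesis .
qed

sublocale block_process M "moving_average \<alpha> S \<psi> 1" "2 * R + 1"
  by unfold_locales (rule moving_average_measurable[OF zero_less_one])

definition segment_integral :: "(real \<Rightarrow> real) \<Rightarrow> nat \<Rightarrow> (rat \<Rightarrow> real) \<Rightarrow> real" where
  "segment_integral f T g = (LINT t:{0..real T}|lborel. f (smoothing g t))"

lemma segment_integral_measurable:
  assumes [measurable]: "f \<in> borel_measurable borel"
  shows "segment_integral f T \<in> borel_measurable (\<Pi>\<^sub>M q\<in>UNIV. borel)"
proof -
  let ?Q = "\<Pi>\<^sub>M q\<in>(UNIV :: rat set). (borel :: real measure)"
  have "(\<lambda>x. (snd x, fst x)) \<in> measurable (?Q \<Otimes>\<^sub>M borel) (borel \<Otimes>\<^sub>M ?Q)" by measurable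
  from measurable_compose[OF this smoothing_measurable]
  have [measurable]: "(\<lambda>x. smoothing (fst x) (snd x)) \<in> borel_measurable (?Q \<Otimes>\<^sub>M borel)" by simp
  have "(\<lambda>(g, t). indicator {0..real T} t *\<^sub>R f (smoothing g t)) \<in> borel_measurable (?Q \<Otimes>\<^sub>M lborel)"
    unfolding case_prod_unfold by measurable
  then show ?thesis
    unfolding segment_integral_def[abs_def] set_lebesgue_integral_def
    by (rule lborel.borel_measurable_lebesgue_integral)
qed

lemma block_segment_integral:
  assumes "\<omega> \<in> space M"
  shows "block f (real T) h \<omega> = segment_integral f T (path_segment R T h \<omega>)"
  unfolding block_def segment_integral_def set_lebesgue_integral_def
  by (intro Bochner_Integration.integral_cong)
    (auto simp: moving_average_path_segment[OF assms] split: split_indicator)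

sublocale dependent_process M "moving_average \<alpha> S \<psi> 1" "2 * R + 1"
proof unfold_locales
  let ?Q = "\<Pi>\<^sub>M q\<in>(UNIV :: rat set). (borel :: real measure)"
  fix B f g and T n k :: nat
  assume f: "bounded_by B f" and g: "bounded_by B g"
  \<comment> \<open>Both block integrals are one measurable functional of the path segment, so
    independence and equality in law are inherited from the segments.\<close>
  let ?\<Psi> = "\<lambda>p. (segment_integral f T p, segment_integral g T p)"
  have \<Psi>: "?\<Psi> \<in> measurable ?Q borel"
    unfolding borel_prod[symmetric]
    by (intro measurable_Pair segment_integral_measurable bounded_byD(1)[OF f] bounded_byD(1)[OF g])
  let ?h = "\<lambda>k. real (k * (T + (2 * R + 1)))"
  have "indep_vars (\<lambda>_. borel) (\<lambda>k \<omega>. ?\<Psi> (path_segment R T (?h k) \<omega>)) {..<n}"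
    by (rule indep_vars_compose2[OF indep_path_segments \<Psi>])
  also have "?this \<longleftrightarrow> indep_vars (\<lambda>_. borel) (\<lambda>k \<omega>. (block f (real T) (?h k) \<omega>, block g (real T) (?h k) \<omega>)) {..<n}"
    by (intro indep_vars_cong_space) (simp only: block_segment_integral)
  finally show "indep_vars (\<lambda>_. borel) (\<lambda>k \<omega>. (block f (real T) (?h k) \<omega>, block g (real T) (?h k) \<omega>)) {..<n}" .
  have law: "distr M borel (\<lambda>\<omega>. (block f (real T) h \<omega>, block g (real T) h \<omega>)) = distr (distr M ?Q (path_segment R T h)) borel ?\<Psi>" for h
  proof -
    have "distr (distr M ?Q (path_segment R T h)) borel ?\<Psi> = distr M borel (\<lambda>\<omega>. ?\<Psi> (path_segment R T h \<omega>))"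
      by (subst distr_distr[OF \<Psi> path_segment_measurable]) (simp add: comp_def)
    also have "\<dots> = distr M borel (\<lambda>\<omega>. (block f (real T) h \<omega>, block g (real T) h \<omega>))"
      by (intro distr_cong) (auto simp: block_segment_integral)
    finally show ?thesis by simp
  qed
  show "distr M borel (\<lambda>\<omega>. (block f (real T) (?h k) \<omega>, block g (real T) (?h k) \<omega>)) =
      distr M borel (\<lambda>\<omega>. (block f (real T) 0 \<omega>, block g (real T) 0 \<omega>))"
    unfolding law distr_path_segment ..
qed

text \<open>Both events say that the same measurable functional of a rational path lies in \<Gamma>.
  The two paths, rescaled by \<epsilon> and unscaled, have the same law by self-similarity; time
  \<open>t / \<epsilon>\<close> runs through \<open>[0, 1 / \<epsilon>]\<close>.\<close>

lemma occupation_scaling: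
  assumes e: "0 < \<epsilon>" and \<Gamma>: "\<Gamma> \<in> sets (prob_algebra borel)"
  shows "prob {\<omega> \<in> space M. occupation_measure (\<lambda>t. moving_average \<alpha> S \<psi> \<epsilon> t \<omega>) \<in> \<Gamma>} =
    prob {\<omega> \<in> space M. occupation (1 / \<epsilon>) \<omega> \<in> \<Gamma>}"
proof -
  let ?Q = "\<Pi>\<^sub>M q\<in>(UNIV :: rat set). (borel :: real measure)"
  define O' where "O' g = occupation_measure (\<lambda>t. smoothing g (t / \<epsilon>))" for g
  have O': "O' \<in> measurable ?Q (prob_algebra borel)"
    unfolding O'_def[abs_def]
  proof (rule occupation_measure_measurable)
    have "(\<lambda>x. (fst x / \<epsilon>, snd x)) \<in> measurable (borel \<Otimes>\<^sub>M ?Q) (borel \<Otimes>\<^sub>M ?Q)" by measurable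
    from measurable_compose[OF this smoothing_measurable]
    show "(\<lambda>(t, g). smoothing g (t / \<epsilon>)) \<in> borel_measurable (borel \<Otimes>\<^sub>M ?Q)" by (simp add: case_prod_unfold)
  qed
  have prob_O': "measure (distr M ?Q X) (O' -` \<Gamma> \<inter> space ?Q) = prob {\<omega> \<in> space M. O' (X \<omega>) \<in> \<Gamma>}"
    if X: "X \<in> measurable M ?Q" for X
  proof -
    have "measure (distr M ?Q X) (O' -` \<Gamma> \<inter> space ?Q) = prob (X -` (O' -` \<Gamma> \<inter> space ?Q) \<inter> space M)"
      by (rule measure_distr[OF X measurable_sets[OF O' \<Gamma>]])
    also have "X -` (O' -` \<Gamma> \<inter> space ?Q) \<inter> space M = {\<omega> \<in> space M. O' (X \<omega>) \<in> \<Gamma>}"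
      using measurable_space[OF X] by auto
    finally show ?thesis .
  qed
  have "{\<omega> \<in> space M. occupation_measure (\<lambda>t. moving_average \<alpha> S \<psi> \<epsilon> t \<omega>) \<in> \<Gamma>} =
      {\<omega> \<in> space M. O' (\<lambda>q. \<epsilon> powr (- 1 / \<alpha>) * S (\<epsilon> * of_rat q) \<omega>) \<in> \<Gamma>}"
    by (intro Collect_cong conj_cong refl) (simp only: O'_def moving_average_smoothing[OF e])
  moreover have "{\<omega> \<in> space M. occupation (1 / \<epsilon>) \<omega> \<in> \<Gamma>} = {\<omega> \<in> space M. O' (\<lambda>q. S (of_rat q) \<omega>) \<in> \<Gamma>}"
    by (intro Collect_cong conj_cong refl) (simp add: O'_def occupation_def moving_average_smoothing)
  moreover have "(\<lambda>\<omega> q. S (of_rat q) \<omega>) \<in> measurable M ?Q" using rational_path_measurable[of 1 1] by simp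
  ultimately show ?thesis
    using prob_O'[OF rational_path_measurable[of "\<epsilon> powr (- 1 / \<alpha>)" \<epsilon>]] prob_O'[of "\<lambda>\<omega> q. S (of_rat q) \<omega>"]
      rational_path_self_similar[OF e] by simp
qed

end

section \<open>Upper and lower bounds in logarithmic form\<close>

context dependent_process
begin

lemma Lambda_star_nonneg: "0 \<le> Lambda_star M Z \<mu>"
proof -
  have "(\<lambda>_. 0 :: real) \<in> bcontfun" by (simp add: bcontfun_def)
  then show ?thesis unfolding Lambda_star_def
    by (rule SUP_upper2) (simp add: Lambda_zero)
qed

text \<open>Every real \<open>c\<close> below the infimum gives an exponential bound with a constant
  \<open>C\<close> whose contribution \<open>\<epsilon> * ln C\<close> vanishes. Letting
  \<open>c\<close> increase also covers an infinite infimum, in particular an empty closure.\<close>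

lemma occupation_Limsup:
  assumes \<Gamma>: "\<Gamma> \<in> sets (prob_algebra borel)"
  shows "Limsup (at_right 0) (\<lambda>\<epsilon>. ereal \<epsilon> * log_prob (prob {\<omega> \<in> space M. occupation (1 / \<epsilon>) \<omega> \<in> \<Gamma>})) \<le>
    - (INF \<mu> \<in> tau_topology closure_of \<Gamma>. Lambda_star M Z \<mu>)" (is "Limsup _ ?L \<le> - ?J")
proof -
  have "?J \<le> - Limsup (at_right 0) ?L"
  proof (rule dense_le)
    fix x assume x: "x < ?J"
    show "x \<le> - Limsup (at_right 0) ?L"
    proof (cases x)
      case (real c)
      have "ereal c < Lambda_star M Z \<mu>" if "\<mu> \<in> tau_topology closure_of \<Gamma>" for \<mu>
        using x real INF_lower[OF that, of "Lambda_star M Z"] by simp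
      then have "\<exists>C>0. \<forall>T>0. prob {\<omega> \<in> space M. occupation T \<omega> \<in> \<Gamma>} \<le> C * exp (- (T * c))"
        using occupation_upper_bound[OF \<Gamma>, of c] by metis
      then obtain C where C: "0 < C" "\<And>T. 0 < T \<Longrightarrow> prob {\<omega> \<in> space M. occupation T \<omega> \<in> \<Gamma>} \<le> C * exp (- (T * c))"
        by blast
      have bound: "?L \<epsilon> \<le> ereal (\<epsilon> * ln C - c)" if e: "0 < \<epsilon>" for \<epsilon>
      proof (cases "prob {\<omega> \<in> space M. occupation (1 / \<epsilon>) \<omega> \<in> \<Gamma>} = 0")
        case True
        then show ?thesis using e by (simp add: log_prob_def)
      next
        case False
        let ?p = "prob {\<omega> \<in> space M. occupation (1 / \<epsilon>) \<omega> \<in> \<Gamma>}"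
        have p: "0 < ?p" using False by (simp add: zero_less_measure_iff)
        have "ln ?p \<le> ln (C * exp (- (1 / \<epsilon> * c)))" using p C(2)[of "1 / \<epsilon>"] e by (intro ln_mono) auto
        also have "\<dots> = ln C - c / \<epsilon>" using C(1) by (simp add: ln_mult)
        finally have "\<epsilon> * ln ?p \<le> \<epsilon> * (ln C - c / \<epsilon>)" using e by (intro mult_left_mono) auto
        also have "\<dots> = \<epsilon> * ln C - c" using e by (simp add: right_diff_distrib)
        finally show ?thesis using False by (simp add: log_prob_def)
      qed
      have "Limsup (at_right 0) ?L \<le> Limsup (at_right 0) (\<lambda>\<epsilon>. ereal (\<epsilon> * ln C - c))"
        by (rule Limsup_mono) (auto simp: eventually_at_right_field intro!: exI[of _ 1] bound)
      also have "\<dots> = ereal (- c)"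
      proof (rule lim_imp_Limsup)
        have "((\<lambda>\<epsilon>. \<epsilon> * ln C - c) \<longlongrightarrow> 0 * ln C - c) (at_right 0)" by (intro tendsto_intros)
        then show "((\<lambda>\<epsilon>. ereal (\<epsilon> * ln C - c)) \<longlongrightarrow> ereal (- c)) (at_right 0)" by simp
      qed simp
      finally have "- ereal (- c) \<le> - Limsup (at_right 0) ?L" by (simp only: ereal_minus_le_minus)
      then show ?thesis using real by simp
    qed (use x in auto)
  qed
  then have "- (- Limsup (at_right 0) ?L) \<le> - ?J" by (simp only: ereal_minus_le_minus)
  then show ?thesis by simp
qed

lemma occupation_Liminf:
  assumes \<Gamma>: "\<Gamma> \<in> sets (prob_algebra borel)"
  shows "- (INF \<mu> \<in> tau_topology interior_of \<Gamma>. Lambda_star M Z \<mu>) \<le>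
    Liminf (at_right 0) (\<lambda>\<epsilon>. ereal \<epsilon> * log_prob (prob {\<omega> \<in> space M. occupation (1 / \<epsilon>) \<omega> \<in> \<Gamma>}))" (is "- ?J \<le> Liminf _ ?L")
proof -
  have "- Liminf (at_right 0) ?L \<le> Lambda_star M Z \<mu>" if \<mu>: "\<mu> \<in> tau_topology interior_of \<Gamma>" for \<mu>
  proof (cases "Lambda_star M Z \<mu>")
    case (real c)
    have c: "0 \<le> c" using Lambda_star_nonneg[of \<mu>] real by simp
    have \<mu>p: "\<mu> \<in> probs"
      using subsetD[OF interior_of_subset_topspace \<mu>] by (simp only: topspace_tau)
    obtain F d where F: "finite F" "F \<subseteq> bounded_measurable" "0 < d"
      and nbhd: "\<forall>\<nu>\<in>probs. (\<forall>f\<in>F. \<bar>(\<integral>x. f x \<partial>\<nu>) - (\<integral>x. f x \<partial>\<mu>)\<bar> < d) \<longrightarrow> \<nu> \<in> tau_topology interior_of \<Gamma>"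
      using tau_neighbourhood[OF openin_interior_of \<mu>] by (elim exE conjE) (rule that)
    have bound: "ereal (- (c + e)) \<le> Liminf (at_right 0) ?L" if e: "0 < e" for e
    proof (rule Liminf_bounded)
      have "\<forall>\<^sub>F T in at_top. exp (- (T * (c + e))) \<le>
          prob {\<omega> \<in> space M. \<forall>f\<in>F. \<bar>(\<integral>x. f x \<partial>occupation T \<omega>) - (\<integral>x. f x \<partial>\<mu>)\<bar> < d}"
        by (rule occupation_lower_bound[OF \<mu>p _ c F e]) (simp add: real)
      then have "\<forall>\<^sub>F \<epsilon> in at_right 0. exp (- (inverse \<epsilon> * (c + e))) \<le>
          prob {\<omega> \<in> space M. \<forall>f\<in>F. \<bar>(\<integral>x. f x \<partial>occupation (inverse \<epsilon>) \<omega>) - (\<integral>x. f x \<partial>\<mu>)\<bar> < d}"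
        using filterlim_inverse_at_top_right unfolding filterlim_iff by blast
      moreover have "\<forall>\<^sub>F \<epsilon> :: real in at_right 0. 0 < \<epsilon>" by (simp add: eventually_at_right_less)
      ultimately show "\<forall>\<^sub>F \<epsilon> in at_right 0. ereal (- (c + e)) \<le> ?L \<epsilon>"
      proof eventually_elim
        case (elim \<epsilon>)
        let ?p = "prob {\<omega> \<in> space M. occupation (1 / \<epsilon>) \<omega> \<in> \<Gamma>}"
        have "{\<omega> \<in> space M. occupation (1 / \<epsilon>) \<omega> \<in> \<Gamma>} = occupation (1 / \<epsilon>) -` \<Gamma> \<inter> space M" by auto
        then have ev: "{\<omega> \<in> space M. occupation (1 / \<epsilon>) \<omega> \<in> \<Gamma>} \<in> events"
          using measurable_sets[OF occupation_measurable \<Gamma>] by simp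
        have sub: "{\<omega> \<in> space M. \<forall>f\<in>F. \<bar>(\<integral>x. f x \<partial>occupation (inverse \<epsilon>) \<omega>) - (\<integral>x. f x \<partial>\<mu>)\<bar> < d} \<subseteq>
            {\<omega> \<in> space M. occupation (1 / \<epsilon>) \<omega> \<in> \<Gamma>}"
        proof
          fix \<omega> assume "\<omega> \<in> {\<omega> \<in> space M. \<forall>f\<in>F. \<bar>(\<integral>x. f x \<partial>occupation (inverse \<epsilon>) \<omega>) - (\<integral>x. f x \<partial>\<mu>)\<bar> < d}"
          then have w: "\<omega> \<in> space M" and "\<forall>f\<in>F. \<bar>(\<integral>x. f x \<partial>occupation (1 / \<epsilon>) \<omega>) - (\<integral>x. f x \<partial>\<mu>)\<bar> < d"
            by (simp_all add: inverse_eq_divide)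
          then have "occupation (1 / \<epsilon>) \<omega> \<in> tau_topology interior_of \<Gamma>"
            using nbhd occupation_in_probs[OF w] by blast
          then have "occupation (1 / \<epsilon>) \<omega> \<in> \<Gamma>" by (rule subsetD[OF interior_of_subset])
          then show "\<omega> \<in> {\<omega> \<in> space M. occupation (1 / \<epsilon>) \<omega> \<in> \<Gamma>}" using w by simp
        qed
        have p: "exp (- (inverse \<epsilon> * (c + e))) \<le> ?p"
          by (rule order_trans[OF elim(1) finite_measure_mono[OF sub ev]])
        then have p0: "0 < ?p" by (meson exp_gt_zero less_le_trans)
        have "- (inverse \<epsilon> * (c + e)) \<le> ln ?p" using p p0 by (simp add: ln_ge_iff)
        then have "\<epsilon> * - (inverse \<epsilon> * (c + e)) \<le> \<epsilon> * ln ?p" using elim(2) by (intro mult_left_mono) auto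
        also have "\<epsilon> * - (inverse \<epsilon> * (c + e)) = - (c + e)"
          using elim(2) by (simp add: mult.assoc[symmetric])
        finally show ?case using p0 by (simp add: log_prob_def)
      qed
    qed
    have le: "- Liminf (at_right 0) ?L \<le> ereal c + ereal e" if "0 < e" for e
    proof -
      have "- Liminf (at_right 0) ?L \<le> - ereal (- (c + e))"
        unfolding ereal_minus_le_minus by (rule bound[OF that])
      then show ?thesis by (simp add: add.commute)
    qed
    have "- Liminf (at_right 0) ?L \<le> ereal c" by (rule ereal_le_epsilon2[OF le])
    then show ?thesis by (simp add: real)
  \<comment> \<open>Points of infinite rate impose nothing, and the value minus infinity is excluded
    by nonnegativity.\<close>
  qed (use Lambda_star_nonneg[of \<mu>] in auto)
  then have "- Liminf (at_right 0) ?L \<le> ?J" by (rule INF_greatest)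
  then have "- ?J \<le> - (- Liminf (at_right 0) ?L)" by (simp only: ereal_minus_le_minus)
  then show ?thesis by simp
qed

end

theorem proposition3p1:
  fixes M :: "'a measure" and \<alpha> :: real and S :: "real \<Rightarrow> 'a \<Rightarrow> real" and \<psi> :: "real \<Rightarrow> real"
  assumes "0 < \<alpha>" and "\<alpha> \<le> 2"
    and "stable_levy_process M \<alpha> S"
    and "bounded_variation \<psi>"
    and "compact (closure {x. \<psi> x \<noteq> 0})"
  shows "(\<forall>f\<in>bcontfun. \<exists>l. (scaled_log_mgf M (moving_average \<alpha> S \<psi> 1) f \<longlongrightarrow> l) at_top) \<and>
    large_deviation_principle M (prob_algebra borel) tau_topology
      (\<lambda>\<epsilon> \<omega>. occupation_measure (\<lambda>t. moving_average \<alpha> S \<psi> \<epsilon> t \<omega>))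
      (Lambda_star M (moving_average \<alpha> S \<psi> 1))"
proof -
  obtain R :: nat and c where "finite_measure (interval_measure (pos_variation \<psi>))"
    "measure (interval_measure (pos_variation \<psi>)) UNIV = c"
    "AE u in interval_measure (pos_variation \<psi>). \<bar>u\<bar> \<le> real R"
    "finite_measure (interval_measure (neg_variation \<psi>))"
    "measure (interval_measure (neg_variation \<psi>)) UNIV = c"
    "AE u in interval_measure (neg_variation \<psi>). \<bar>u\<bar> \<le> real R"
    using variation_measures[OF assms(4,5)] by blast
  then have "compact_signed_measure (interval_measure (pos_variation \<psi>)) (interval_measure (neg_variation \<psi>)) R"
    by (simp add: compact_signed_measure_def)
  then interpret levy_moving_average M \<alpha> S \<psi> R
    using assms(3) by (simp add: levy_moving_average_def)
  let ?Z = "moving_average \<alpha> S \<psi> 1"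
  have "\<exists>l. (scaled_log_mgf M ?Z f \<longlongrightarrow> l) at_top" if f: "f \<in> bcontfun" for f
    using tendsto_scaled_log_mgf[OF bounded_by_bound_of[OF bcontfun_bounded_measurable[OF f]]] by blast
  moreover have "large_deviation_principle M (prob_algebra borel) tau_topology
      (\<lambda>\<epsilon> \<omega>. occupation_measure (\<lambda>t. moving_average \<alpha> S \<psi> \<epsilon> t \<omega>)) (Lambda_star M ?Z)"
    unfolding large_deviation_principle_def Let_def
  proof (intro conjI allI impI ballI)
    show "(\<lambda>\<omega>. occupation_measure (\<lambda>t. moving_average \<alpha> S \<psi> \<epsilon> t \<omega>)) \<in> measurable M (prob_algebra borel)" if "0 < \<epsilon>" for \<epsilon>
      by (rule occupation_measure_measurable[OF moving_average_measurable[OF that]])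
    show "compactin tau_topology {\<mu> \<in> topspace tau_topology. Lambda_star M ?Z \<mu> \<le> ereal c}" for c
      by (rule Lambda_star_good)
    fix \<Gamma> :: "real measure set" assume \<Gamma>: "\<Gamma> \<in> sets (prob_algebra borel)"
    let ?L = "\<lambda>\<epsilon>. ereal \<epsilon> * log_prob (measure M {\<omega> \<in> space M. occupation_measure (\<lambda>t. moving_average \<alpha> S \<psi> \<epsilon> t \<omega>) \<in> \<Gamma>})"
    let ?L' = "\<lambda>\<epsilon>. ereal \<epsilon> * log_prob (measure M {\<omega> \<in> space M. occupation (1 / \<epsilon>) \<omega> \<in> \<Gamma>})"
    have "\<forall>\<^sub>F \<epsilon> in at_right 0. ?L \<epsilon> = ?L' \<epsilon>"
      using eventually_at_right_less[of "0::real"] by eventually_elim (simp only: occupation_scaling[OF _ \<Gamma>])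
    then have eq: "Liminf (at_right 0) ?L = Liminf (at_right 0) ?L'" "Limsup (at_right 0) ?L = Limsup (at_right 0) ?L'"
      by (rule Liminf_eq Limsup_eq)+
    show "- (INF \<mu> \<in> tau_topology interior_of \<Gamma>. Lambda_star M ?Z \<mu>) \<le> Liminf (at_right 0) ?L"
      unfolding eq by (rule occupation_Liminf[OF \<Gamma>])
    show "Liminf (at_right 0) ?L \<le> Limsup (at_right 0) ?L"
      by (rule Liminf_le_Limsup) simp
    show "Limsup (at_right 0) ?L \<le> - (INF \<mu> \<in> tau_topology closure_of \<Gamma>. Lambda_star M ?Z \<mu>)"
      unfolding eq by (rule occupation_Limsup[OF \<Gamma>])
  qed
  ultimately show ?thesis by blast
qed

end
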